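(* Let $B$ be a bialgebra with bijective antipode $S$. Let ${}_BV=B\otimes V$ ($V$ a finite-dimensional $k$-vector space) be the bicovariant $B$-bimodule generated by a right-right Yetter–Drinfeld module $(V,{}_Vm,{}_V\!\triangle)\in\mathcal{YD}^B_B$. Then its left $B$-dual $\tilde V_B=\tilde V\otimes B$ is a right (free) $B^{\mathrm{cop}}$-covariant bimodule generated by $(\tilde V,\widetilde{{}_Vm})$. Moreover $$\bigl(\tilde V,\ \widetilde{{}_Vm},\ (S^{-1})_\star(\widetilde{{}_V\!\triangle}^{\mathrm{cop}})\bigr)\in{}^{B^{\mathrm{cop}}}_{B^{\mathrm{cop}}}\mathcal{YD},$$ so $\tilde V_B$ can also be equipped with a bicovariant $B^{\mathrm{cop}}$-bimodule structure generated by this Yetter–Drinfeld module. The identity $$1_B\,\langle\alpha,v\rangle=\langle\!\langle\,\widetilde{{}_V\!\triangle}(\alpha),\ S_\star({}_V\!\triangle^{\mathrm{cop}})(v)\,\rangle\!\rangle\qquad(\alpha\in\tilde V,\ v\in V)$$ is satisfied.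
   Context: $k$ is a field; tensor products are over $k$; $\tilde V=\mathrm{Hom}(V,k)$; $\{e_i\}$, $\{e^i\}$ are dual bases; repeated upper and lower indices are summed. Sweedler notation $\triangle(a)=a_{(1)}\otimes a_{(2)}$; left coactions are written $v\mapsto v_{(-1)}\otimes v_{(0)}$ and right coactions $v\mapsto v_{(0)}\otimes v_{(1)}$. $B^{\mathrm{cop}}$ is $B$ with the same product and comultiplication $a\mapsto a_{(2)}\otimes a_{(1)}$. Yetter–Drinfeld modules over a bialgebra $C$ (with a module and a comodule structure on the same space): left-left, category ${}^C_C\mathcal{YD}$: $a_{(1)}v_{(-1)}\otimes a_{(2)}v_{(0)}=(a_{(1)}.v)_{(-1)}a_{(2)}\otimes(a_{(1)}.v)_{(0)}$; right-right, category $\mathcal{YD}^C_C$: $v_{(0)}a_{(1)}\otimes v_{(1)}a_{(2)}=(v.a_{(2)})_{(0)}\otimes a_{(1)}(v.a_{(2)})_{(1)}$. For $C=B^{\mathrm{cop}}$, the Sweedler indices refer to the comultiplication of $B^{\mathrm{cop}}$. Bicovariant bimodules. A bicovariant $C$-bimodule is a $C$-bimodule and $C$-bicomodule whose left and right coactions both satisfy $\triangle(a.x.b)=\triangle(a)\triangle(x)\triangle(b)$. A module $(V,{}_Vm,{}_V\!\triangle)\in\mathcal{YD}^C_C$ generates the bicovariant bimodule ${}_CV=C\otimes V$ with left multiplication and left coaction from $C$, right multiplication $(a\otimes v).b=ab_{(1)}\otimes v.b_{(2)}$, and right coaction $a\otimes v\mapsto a_{(1)}\otimes v_{(0)}\otimes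 a_{(2)}v_{(1)}$. A module $(W,m_W,\triangle_W)\in{}^C_C\mathcal{YD}$ generates the bicovariant bimodule $W_C=W\otimes C$ with right multiplication and right coaction from $C$, left multiplication $a.(w\otimes b)=a_{(1)}.w\otimes a_{(2)}b$, and left coaction $w\otimes b\mapsto w_{(-1)}b_{(1)}\otimes w_{(0)}\otimes b_{(2)}$. The right $C$-covariant bimodule generated by a left $C$-module $W$ is $W_C$ with this bimodule structure and only the right coaction $\mathrm{id}\otimes\triangle$. In particular, for $C=B^{\mathrm{cop}}$ the left multiplication on $W_B$, written in Sweedler notation of $B$, is $a.(w\otimes b)=a_{(2)}.w\otimes a_{(1)}b$ and the right coaction is $w\otimes b\mapsto w\otimes b_{(2)}\otimes b_{(1)}$. Left $B$-dual. For a $B$-bimodule $M$, ${}^\dagger M=\mathrm{Hom}_{(B,-)}(M,B)$ is the space of left module maps with bimodule structure $(a.X.b)(x)=X(x.a)\,b$. For $M={}_BV$ it is identified with $\tilde V_B=\tilde V\otimes B$ via $(\alpha\otimes b)(a\otimes v)=ab\,\alpha(v)$. Transposes. $\widetilde{{}_Vm}$ is the left $B$-module structure on $\tilde V$ given by $(a.\alpha)(v)=\alpha(v.a)$. If ${}_V\!\triangle(e_k)=e_m\otimes R^m_k$, then $\widetilde{{}_V\!\triangle}(e^k)=R^k_m\otimes e^m$ is the transpose left $B$-coaction on $\tilde V$. For a left or right coaction, the superscript $\mathrm{cop}$ means composing with the flip, giving a right, respectively left, coaction of $B^{\mathrm{cop}}$. For an anti-coalgebra map $T$, the push-forward $T_\star$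 applies $T$ to the coalgebra leg and changes the side of the coaction. Thus $(S^{-1})_\star(\widetilde{{}_V\!\triangle}^{\mathrm{cop}})(e^k)=S^{-1}(R^k_m)\otimes e^m$, and $S_\star({}_V\!\triangle^{\mathrm{cop}})(e_i)=e_m\otimes S(R^m_i)$. The pairing in the last identity, between $B\otimes\tilde V$ and $V\otimes B$, is $\langle\!\langle a\otimes\alpha, v\otimes b\rangle\!\rangle=ab\,\alpha(v)$, and $\langle\alpha,v\rangle=\alpha(v)$. *)

theory Defs
  imports "Jordan_Normal_Form.Missing_VectorSpace" "HOL-Algebra.AbelCoset"
begin

text \<open>
  Vector spaces over a field \<open>k\<close> are HOL-Algebra \<open>module\<close> records; the \<open>mult\<close> and \<open>one\<close> fields of
  such a record are relevant only when it is used as an algebra.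
\<close>

section \<open>Tensor products over a field\<close>

definition free_vs :: "('k, 'r) ring_scheme \<Rightarrow> 'a set \<Rightarrow> ('k, 'a \<Rightarrow> 'k) module" where
  "free_vs k X =
    \<lparr>carrier = {f. (\<forall>x. f x \<in> carrier k) \<and> (\<forall>x. x \<notin> X \<longrightarrow> f x = \<zero>\<^bsub>k\<^esub>) \<and> finite {x. f x \<noteq> \<zero>\<^bsub>k\<^esub>}},
     mult = undefined, one = undefined,
     zero = (\<lambda>_. \<zero>\<^bsub>k\<^esub>), add = (\<lambda>f g x. f x \<oplus>\<^bsub>k\<^esub> g x), smult = (\<lambda>c f x. c \<otimes>\<^bsub>k\<^esub> f x)\<rparr>"

definition free_gen :: "('k, 'r) ring_scheme \<Rightarrow> 'a \<Rightarrow> 'a \<Rightarrow> 'k" where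
  "free_gen k x = (\<lambda>y. if y = x then \<one>\<^bsub>k\<^esub> else \<zero>\<^bsub>k\<^esub>)"

abbreviation tensor_free where
  "tensor_free k V W \<equiv> free_vs k (carrier V \<times> carrier W)"

definition tensor_relators ::
  "('k, 'r) ring_scheme \<Rightarrow> ('k, 'v, 'p) module_scheme \<Rightarrow> ('k, 'w, 'q) module_scheme
    \<Rightarrow> ('v \<times> 'w \<Rightarrow> 'k) set" where
  "tensor_relators k V W =
    (let F = tensor_free k V W; \<delta> = (\<lambda>v w. free_gen k (v, w)) in
      {\<delta> (v \<oplus>\<^bsub>V\<^esub> v') w \<ominus>\<^bsub>F\<^esub> (\<delta> v w \<oplus>\<^bsub>F\<^esub> \<delta> v' w) | v v' w.
         v \<in> carrier V \<and> v' \<in> carrier V \<and> w \<in> carrier W}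
    \<union> {\<delta> v (w \<oplus>\<^bsub>W\<^esub> w') \<ominus>\<^bsub>F\<^esub> (\<delta> v w \<oplus>\<^bsub>F\<^esub> \<delta> v w') | v w w'.
         v \<in> carrier V \<and> w \<in> carrier W \<and> w' \<in> carrier W}
    \<union> {\<delta> (c \<odot>\<^bsub>V\<^esub> v) w \<ominus>\<^bsub>F\<^esub> c \<odot>\<^bsub>F\<^esub> \<delta> v w | c v w.
         c \<in> carrier k \<and> v \<in> carrier V \<and> w \<in> carrier W}
    \<union> {\<delta> v (c \<odot>\<^bsub>W\<^esub> w) \<ominus>\<^bsub>F\<^esub> c \<odot>\<^bsub>F\<^esub> \<delta> v w | c v w.
         c \<in> carrier k \<and> v \<in> carrier V \<and> w \<in> carrier W})"

definition tensor_null where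
  "tensor_null k V W = LinearCombinations.module.span k (tensor_free k V W) (tensor_relators k V W)"

definition tensor ::
  "('k, 'r) ring_scheme \<Rightarrow> ('k, 'v, 'p) module_scheme \<Rightarrow> ('k, 'w, 'q) module_scheme
    \<Rightarrow> ('k, ('v \<times> 'w \<Rightarrow> 'k) set) module" where
  "tensor k V W =
    (let F = tensor_free k V W; N = tensor_null k V W in
      \<lparr>carrier = a_rcosets\<^bsub>F\<^esub> N, mult = undefined, one = undefined,
       zero = N, add = set_add F, smult = (\<lambda>c t. \<Union>f\<in>t. N +>\<^bsub>F\<^esub> (c \<odot>\<^bsub>F\<^esub> f))\<rparr>)"

definition tens ::
  "('k, 'r) ring_scheme \<Rightarrow> ('k, 'v, 'p) module_scheme \<Rightarrow> ('k, 'w, 'q) module_scheme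
    \<Rightarrow> 'v \<Rightarrow> 'w \<Rightarrow> ('v \<times> 'w \<Rightarrow> 'k) set" where
  "tens k V W v w = tensor_null k V W +>\<^bsub>tensor_free k V W\<^esub> free_gen k (v, w)"

text \<open>
  For \<open>\<beta>\<close> bilinear with values in \<open>U\<close>, the term \<open>tlift k V W U t \<beta>\<close> is the value at \<open>t\<close> of the
  linear map \<open>V \<otimes> W \<rightarrow> U\<close> induced by \<open>\<beta>\<close>; it does not depend on the chosen representative of \<open>t\<close>.
  It renders Sweedler notation: \<open>tlift k C C U (\<Delta> a) (\<lambda>a1 a2. E a1 a2)\<close> is what is written
  \<open>E a\<^sub>(\<^sub>1\<^sub>) a\<^sub>(\<^sub>2\<^sub>)\<close> for an expression \<open>E\<close> that is linear in both Sweedler components.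
\<close>

definition tlift ::
  "('k, 'r) ring_scheme \<Rightarrow> ('k, 'v, 'p) module_scheme \<Rightarrow> ('k, 'w, 'q) module_scheme
    \<Rightarrow> ('k, 'u, 's) module_scheme \<Rightarrow> ('v \<times> 'w \<Rightarrow> 'k) set \<Rightarrow> ('v \<Rightarrow> 'w \<Rightarrow> 'u) \<Rightarrow> 'u" where
  "tlift k V W U t \<beta> =
    (let f = (SOME f. f \<in> t) in
      (\<Oplus>\<^bsub>U\<^esub>x\<in>{x. f x \<noteq> \<zero>\<^bsub>k\<^esub>}. f x \<odot>\<^bsub>U\<^esub> \<beta> (fst x) (snd x)))"

definition flip ::
  "('k, 'r) ring_scheme \<Rightarrow> ('k, 'v, 'p) module_scheme \<Rightarrow> ('k, 'w, 'q) module_scheme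
    \<Rightarrow> ('v \<times> 'w \<Rightarrow> 'k) set \<Rightarrow> ('w \<times> 'v \<Rightarrow> 'k) set" where
  "flip k V W t = tlift k V W (tensor k W V) t (\<lambda>v w. tens k W V w v)"


section \<open>Linear maps and the dual space\<close>

definition scalars :: "('k, 'r) ring_scheme \<Rightarrow> ('k, 'k) module" where
  "scalars k = \<lparr>carrier = carrier k, mult = mult k, one = one k,
     zero = zero k, add = add k, smult = mult k\<rparr>"

definition bilinear ::
  "('k, 'r) ring_scheme \<Rightarrow> ('k, 'v, 'p) module_scheme \<Rightarrow> ('k, 'w, 'q) module_scheme
    \<Rightarrow> ('k, 'u, 's) module_scheme \<Rightarrow> ('v \<Rightarrow> 'w \<Rightarrow> 'u) \<Rightarrow> bool" where
  "bilinear k V W U \<beta> \<longleftrightarrow>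
    (\<forall>v\<in>carrier V. linear_map k W U (\<lambda>w. \<beta> v w)) \<and>
    (\<forall>w\<in>carrier W. linear_map k V U (\<lambda>v. \<beta> v w))"

text \<open>Functionals are taken extensional, so that equal functionals are equal HOL functions.\<close>

definition dual ::
  "('k, 'r) ring_scheme \<Rightarrow> ('k, 'v, 'p) module_scheme \<Rightarrow> ('k, 'v \<Rightarrow> 'k) module" where
  "dual k V =
    \<lparr>carrier = {\<alpha> \<in> extensional (carrier V). linear_map k V (scalars k) \<alpha>},
     mult = undefined, one = undefined,
     zero = (\<lambda>v\<in>carrier V. \<zero>\<^bsub>k\<^esub>),
     add = (\<lambda>\<alpha> \<beta>. \<lambda>v\<in>carrier V. \<alpha> v \<oplus>\<^bsub>k\<^esub> \<beta> v),
     smult = (\<lambda>c \<alpha>. \<lambda>v\<in>carrier V. c \<otimes>\<^bsub>k\<^esub> \<alpha> v)\<rparr>"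

text \<open>A basis \<open>X\<close> is a set of vectors and indexes itself: \<open>dual_vec k V X x\<close> is the member of the
  dual basis paired with \<open>x\<close>.\<close>

definition dual_vec ::
  "('k, 'r) ring_scheme \<Rightarrow> ('k, 'v, 'p) module_scheme \<Rightarrow> 'v set \<Rightarrow> 'v \<Rightarrow> 'v \<Rightarrow> 'k" where
  "dual_vec k V X x =
    (THE \<alpha>. \<alpha> \<in> carrier (dual k V) \<and> (\<forall>y\<in>X. \<alpha> y = (if y = x then \<one>\<^bsub>k\<^esub> else \<zero>\<^bsub>k\<^esub>)))"


section \<open>Bialgebras\<close>

locale k_algebra =
  fixes k :: "('k, 'r) ring_scheme" and A :: "('k, 'a, 'p) module_scheme"
  assumes vs: "vectorspace k A"
    and ring: "ring A"
    and smult_mult_l: "\<lbrakk>c \<in> carrier k; a \<in> carrier A; b \<in> carrier A\<rbrakk>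
      \<Longrightarrow> (c \<odot>\<^bsub>A\<^esub> a) \<otimes>\<^bsub>A\<^esub> b = c \<odot>\<^bsub>A\<^esub> (a \<otimes>\<^bsub>A\<^esub> b)"
    and smult_mult_r: "\<lbrakk>c \<in> carrier k; a \<in> carrier A; b \<in> carrier A\<rbrakk>
      \<Longrightarrow> a \<otimes>\<^bsub>A\<^esub> (c \<odot>\<^bsub>A\<^esub> b) = c \<odot>\<^bsub>A\<^esub> (a \<otimes>\<^bsub>A\<^esub> b)"

record ('k, 'b) bialg = "('k, 'b) module" +
  comult :: "'b \<Rightarrow> ('b \<times> 'b \<Rightarrow> 'k) set"
  counit :: "'b \<Rightarrow> 'k"

locale bialgebra = k_algebra k B
  for k :: "('k, 'r) ring_scheme" and B :: "('k, 'b, 'p) bialg_scheme" +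
  assumes comult_linear: "linear_map k B (tensor k B B) (comult B)"
    and counit_linear: "linear_map k B (scalars k) (counit B)"
    and coassoc: "a \<in> carrier B \<Longrightarrow>
      tlift k B B (tensor k B (tensor k B B)) (comult B a) (\<lambda>x y.
        tlift k B B (tensor k B (tensor k B B)) (comult B x) (\<lambda>p q.
          tens k B (tensor k B B) p (tens k B B q y))) =
      tlift k B B (tensor k B (tensor k B B)) (comult B a) (\<lambda>x y.
        tens k B (tensor k B B) x (comult B y))"
    and counit_l: "a \<in> carrier B \<Longrightarrow>
      tlift k B B B (comult B a) (\<lambda>x y. counit B x \<odot>\<^bsub>B\<^esub> y) = a"
    and counit_r: "a \<in> carrier B \<Longrightarrow>
      tlift k B B B (comult B a) (\<lambda>x y. counit B y \<odot>\<^bsub>B\<^esub> x) = a"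
    and comult_mult: "\<lbrakk>a \<in> carrier B; b \<in> carrier B\<rbrakk> \<Longrightarrow>
      comult B (a \<otimes>\<^bsub>B\<^esub> b) =
      tlift k B B (tensor k B B) (comult B a) (\<lambda>a1 a2.
        tlift k B B (tensor k B B) (comult B b) (\<lambda>b1 b2.
          tens k B B (a1 \<otimes>\<^bsub>B\<^esub> b1) (a2 \<otimes>\<^bsub>B\<^esub> b2)))"
    and comult_one: "comult B \<one>\<^bsub>B\<^esub> = tens k B B \<one>\<^bsub>B\<^esub> \<one>\<^bsub>B\<^esub>"
    and counit_mult: "\<lbrakk>a \<in> carrier B; b \<in> carrier B\<rbrakk> \<Longrightarrow>
      counit B (a \<otimes>\<^bsub>B\<^esub> b) = counit B a \<otimes>\<^bsub>k\<^esub> counit B b"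
    and counit_one: "counit B \<one>\<^bsub>B\<^esub> = \<one>\<^bsub>k\<^esub>"

locale hopf_algebra = bialgebra k B
  for k :: "('k, 'r) ring_scheme" and B :: "('k, 'b, 'p) bialg_scheme" +
  fixes S :: "'b \<Rightarrow> 'b"
  assumes antipode_linear: "linear_map k B B S"
    and antipode_l: "a \<in> carrier B \<Longrightarrow>
      tlift k B B B (comult B a) (\<lambda>a1 a2. S a1 \<otimes>\<^bsub>B\<^esub> a2) = counit B a \<odot>\<^bsub>B\<^esub> \<one>\<^bsub>B\<^esub>"
    and antipode_r: "a \<in> carrier B \<Longrightarrow>
      tlift k B B B (comult B a) (\<lambda>a1 a2. a1 \<otimes>\<^bsub>B\<^esub> S a2) = counit B a \<odot>\<^bsub>B\<^esub> \<one>\<^bsub>B\<^esub>"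

definition cop ::
  "('k, 'r) ring_scheme \<Rightarrow> ('k, 'b, 'p) bialg_scheme \<Rightarrow> ('k, 'b, 'p) bialg_scheme" where
  "cop k B = B\<lparr>comult := (\<lambda>a. flip k B B (comult B a))\<rparr>"


section \<open>Modules, comodules and Yetter--Drinfeld modules\<close>

text \<open>A left action is written \<open>act a v\<close>, a right action \<open>act v a\<close>; the carrier of a left coaction
  on \<open>V\<close> is \<open>C \<otimes> V\<close>, that of a right coaction is \<open>V \<otimes> C\<close>.\<close>

locale left_module =
  fixes k :: "('k, 'r) ring_scheme" and A :: "('k, 'a, 'p) module_scheme"
    and V :: "('k, 'v, 'q) module_scheme" and act :: "'a \<Rightarrow> 'v \<Rightarrow> 'v"
  assumes act_bilinear: "bilinear k A V V act"
    and act_one: "v \<in> carrier V \<Longrightarrow> act \<one>\<^bsub>A\<^esub> v = v"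
    and act_mult: "\<lbrakk>a \<in> carrier A; b \<in> carrier A; v \<in> carrier V\<rbrakk>
      \<Longrightarrow> act (a \<otimes>\<^bsub>A\<^esub> b) v = act a (act b v)"

locale right_module =
  fixes k :: "('k, 'r) ring_scheme" and A :: "('k, 'a, 'p) module_scheme"
    and V :: "('k, 'v, 'q) module_scheme" and act :: "'v \<Rightarrow> 'a \<Rightarrow> 'v"
  assumes act_bilinear: "bilinear k V A V act"
    and act_one: "v \<in> carrier V \<Longrightarrow> act v \<one>\<^bsub>A\<^esub> = v"
    and act_mult: "\<lbrakk>a \<in> carrier A; b \<in> carrier A; v \<in> carrier V\<rbrakk>
      \<Longrightarrow> act v (a \<otimes>\<^bsub>A\<^esub> b) = act (act v a) b"

locale left_comodule =
  fixes k :: "('k, 'r) ring_scheme" and C :: "('k, 'b, 'p) bialg_scheme"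
    and V :: "('k, 'v, 'q) module_scheme" and \<rho> :: "'v \<Rightarrow> ('b \<times> 'v \<Rightarrow> 'k) set"
  assumes coact_linear: "linear_map k V (tensor k C V) \<rho>"
    and coact_coassoc: "v \<in> carrier V \<Longrightarrow>
      tlift k C V (tensor k C (tensor k C V)) (\<rho> v) (\<lambda>c w.
        tlift k C C (tensor k C (tensor k C V)) (comult C c) (\<lambda>c1 c2.
          tens k C (tensor k C V) c1 (tens k C V c2 w))) =
      tlift k C V (tensor k C (tensor k C V)) (\<rho> v) (\<lambda>c w.
        tens k C (tensor k C V) c (\<rho> w))"
    and coact_counit: "v \<in> carrier V \<Longrightarrow>
      tlift k C V V (\<rho> v) (\<lambda>c w. counit C c \<odot>\<^bsub>V\<^esub> w) = v"

locale right_comodule =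
  fixes k :: "('k, 'r) ring_scheme" and C :: "('k, 'b, 'p) bialg_scheme"
    and V :: "('k, 'v, 'q) module_scheme" and \<rho> :: "'v \<Rightarrow> ('v \<times> 'b \<Rightarrow> 'k) set"
  assumes coact_linear: "linear_map k V (tensor k V C) \<rho>"
    and coact_coassoc: "v \<in> carrier V \<Longrightarrow>
      tlift k V C (tensor k (tensor k V C) C) (\<rho> v) (\<lambda>w c.
        tens k (tensor k V C) C (\<rho> w) c) =
      tlift k V C (tensor k (tensor k V C) C) (\<rho> v) (\<lambda>w c.
        tlift k C C (tensor k (tensor k V C) C) (comult C c) (\<lambda>c1 c2.
          tens k (tensor k V C) C (tens k V C w c1) c2))"
    and coact_counit: "v \<in> carrier V \<Longrightarrow>
      tlift k V C V (\<rho> v) (\<lambda>w c. counit C c \<odot>\<^bsub>V\<^esub> w) = v"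

locale yd_left_left = bialgebra k C + left_module k C V act + left_comodule k C V \<rho>
  for k :: "('k, 'r) ring_scheme" and C :: "('k, 'b, 'p) bialg_scheme"
    and V :: "('k, 'v, 'q) module_scheme"
    and act :: "'b \<Rightarrow> 'v \<Rightarrow> 'v" and \<rho> :: "'v \<Rightarrow> ('b \<times> 'v \<Rightarrow> 'k) set" +
  assumes yd: "\<lbrakk>a \<in> carrier C; v \<in> carrier V\<rbrakk> \<Longrightarrow>
      tlift k C C (tensor k C V) (comult C a) (\<lambda>a1 a2.
        tlift k C V (tensor k C V) (\<rho> v) (\<lambda>vm v0.
          tens k C V (a1 \<otimes>\<^bsub>C\<^esub> vm) (act a2 v0))) =
      tlift k C C (tensor k C V) (comult C a) (\<lambda>a1 a2.
        tlift k C V (tensor k C V) (\<rho> (act a1 v)) (\<lambda>um u0.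
          tens k C V (um \<otimes>\<^bsub>C\<^esub> a2) u0))"

locale yd_right_right = bialgebra k C + right_module k C V act + right_comodule k C V \<rho>
  for k :: "('k, 'r) ring_scheme" and C :: "('k, 'b, 'p) bialg_scheme"
    and V :: "('k, 'v, 'q) module_scheme"
    and act :: "'v \<Rightarrow> 'b \<Rightarrow> 'v" and \<rho> :: "'v \<Rightarrow> ('v \<times> 'b \<Rightarrow> 'k) set" +
  assumes yd: "\<lbrakk>a \<in> carrier C; v \<in> carrier V\<rbrakk> \<Longrightarrow>
      tlift k C C (tensor k V C) (comult C a) (\<lambda>a1 a2.
        tlift k V C (tensor k V C) (\<rho> v) (\<lambda>v0 v1.
          tens k V C (act v0 a1) (v1 \<otimes>\<^bsub>C\<^esub> a2))) =
      tlift k C C (tensor k V C) (comult C a) (\<lambda>a1 a2.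
        tlift k V C (tensor k V C) (\<rho> (act v a2)) (\<lambda>u0 u1.
          tens k V C u0 (a1 \<otimes>\<^bsub>C\<^esub> u1)))"


section \<open>Covariant and bicovariant bimodules\<close>

record ('k, 'b, 'm) bimod = "('k, 'm) module" +
  lact :: "'b \<Rightarrow> 'm \<Rightarrow> 'm"
  ract :: "'m \<Rightarrow> 'b \<Rightarrow> 'm"

record ('k, 'b, 'm) rcov_bimod = "('k, 'b, 'm) bimod" +
  rcoact :: "'m \<Rightarrow> ('m \<times> 'b \<Rightarrow> 'k) set"

record ('k, 'b, 'm) bicov_bimod = "('k, 'b, 'm) rcov_bimod" +
  lcoact :: "'m \<Rightarrow> ('b \<times> 'm \<Rightarrow> 'k) set"

locale bimodule =
  k_algebra k A + L: left_module k A M "lact M" + R: right_module k A M "ract M"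
  for k :: "('k, 'r) ring_scheme" and A :: "('k, 'b, 'p) module_scheme"
    and M :: "('k, 'b, 'm, 'q) bimod_scheme" +
  assumes act_commute: "\<lbrakk>a \<in> carrier A; x \<in> carrier M; b \<in> carrier A\<rbrakk> \<Longrightarrow>
      ract M (lact M a x) b = lact M a (ract M x b)"

locale right_covariant_bimodule =
  bialgebra k C + bimodule k C M + RC: right_comodule k C M "rcoact M"
  for k :: "('k, 'r) ring_scheme" and C :: "('k, 'b, 'p) bialg_scheme"
    and M :: "('k, 'b, 'm, 'q) rcov_bimod_scheme" +
  assumes rcoact_covariant: "\<lbrakk>a \<in> carrier C; x \<in> carrier M; b \<in> carrier C\<rbrakk> \<Longrightarrow>
      rcoact M (ract M (lact M a x) b) =
      tlift k C C (tensor k M C) (comult C a) (\<lambda>a1 a2.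
        tlift k M C (tensor k M C) (rcoact M x) (\<lambda>x0 x1.
          tlift k C C (tensor k M C) (comult C b) (\<lambda>b1 b2.
            tens k M C (ract M (lact M a1 x0) b1) (a2 \<otimes>\<^bsub>C\<^esub> x1 \<otimes>\<^bsub>C\<^esub> b2))))"

locale bicovariant_bimodule =
  right_covariant_bimodule k C M + LC: left_comodule k C M "lcoact M"
  for k :: "('k, 'r) ring_scheme" and C :: "('k, 'b, 'p) bialg_scheme"
    and M :: "('k, 'b, 'm, 'q) bicov_bimod_scheme" +
  assumes lcoact_covariant: "\<lbrakk>a \<in> carrier C; x \<in> carrier M; b \<in> carrier C\<rbrakk> \<Longrightarrow>
      lcoact M (ract M (lact M a x) b) =
      tlift k C C (tensor k C M) (comult C a) (\<lambda>a1 a2.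
        tlift k C M (tensor k C M) (lcoact M x) (\<lambda>xm x0.
          tlift k C C (tensor k C M) (comult C b) (\<lambda>b1 b2.
            tens k C M (a1 \<otimes>\<^bsub>C\<^esub> xm \<otimes>\<^bsub>C\<^esub> b1) (ract M (lact M a2 x0) b2))))"
    and coact_commute: "x \<in> carrier M \<Longrightarrow>
      tlift k M C (tensor k C (tensor k M C)) (rcoact M x) (\<lambda>y c.
        tlift k C M (tensor k C (tensor k M C)) (lcoact M y) (\<lambda>d z.
          tens k C (tensor k M C) d (tens k M C z c))) =
      tlift k C M (tensor k C (tensor k M C)) (lcoact M x) (\<lambda>d y.
        tens k C (tensor k M C) d (rcoact M y))"

definition right_free ::
  "('b, 'p) ring_scheme \<Rightarrow> ('k, 'b, 'm, 'q) bimod_scheme \<Rightarrow> bool" where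
  "right_free A M \<longleftrightarrow>
    (\<exists>Y \<subseteq> carrier M. \<forall>x\<in>carrier M.
      \<exists>!b. b \<in> Y \<rightarrow>\<^sub>E carrier A \<and> finite {y\<in>Y. b y \<noteq> \<zero>\<^bsub>A\<^esub>} \<and>
           x = (\<Oplus>\<^bsub>M\<^esub>y\<in>{y\<in>Y. b y \<noteq> \<zero>\<^bsub>A\<^esub>}. ract M y (b y)))"

locale bimodule_iso = M: bimodule k A M + N: bimodule k A N
  for k :: "('k, 'r) ring_scheme" and A :: "('k, 'b, 'p) module_scheme"
    and M :: "('k, 'b, 'm, 'q) bimod_scheme" and N :: "('k, 'b, 'n, 's) bimod_scheme" +
  fixes f :: "'m \<Rightarrow> 'n"
  assumes iso_linear: "linear_map k M N f"
    and iso_bij: "bij_betw f (carrier M) (carrier N)"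
    and iso_lact: "\<lbrakk>a \<in> carrier A; x \<in> carrier M\<rbrakk> \<Longrightarrow> f (lact M a x) = lact N a (f x)"
    and iso_ract: "\<lbrakk>x \<in> carrier M; b \<in> carrier A\<rbrakk> \<Longrightarrow> f (ract M x b) = ract N (f x) b"

text \<open>The bicovariant bimodule \<open>C \<otimes> V\<close> generated by a right-right Yetter--Drinfeld module.\<close>

definition left_generated ::
  "('k, 'r) ring_scheme \<Rightarrow> ('k, 'b, 'p) bialg_scheme \<Rightarrow> ('k, 'v, 'q) module_scheme
    \<Rightarrow> ('v \<Rightarrow> 'b \<Rightarrow> 'v) \<Rightarrow> ('v \<Rightarrow> ('v \<times> 'b \<Rightarrow> 'k) set)
    \<Rightarrow> ('k, 'b, ('b \<times> 'v \<Rightarrow> 'k) set) bicov_bimod" where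
  "left_generated k C V act \<rho> =
    (let T = tensor k C V in
      \<lparr>carrier = carrier T, mult = undefined, one = undefined,
       zero = zero T, add = add T, smult = smult T,
       lact = (\<lambda>a t. tlift k C V T t (\<lambda>b v. tens k C V (a \<otimes>\<^bsub>C\<^esub> b) v)),
       ract = (\<lambda>t b. tlift k C V T t (\<lambda>a v.
         tlift k C C T (comult C b) (\<lambda>b1 b2. tens k C V (a \<otimes>\<^bsub>C\<^esub> b1) (act v b2)))),
       rcoact = (\<lambda>t. tlift k C V (tensor k T C) t (\<lambda>a v.
         tlift k C C (tensor k T C) (comult C a) (\<lambda>a1 a2.
           tlift k V C (tensor k T C) (\<rho> v) (\<lambda>v0 v1.
             tens k T C (tens k C V a1 v0) (a2 \<otimes>\<^bsub>C\<^esub> v1))))),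
       lcoact = (\<lambda>t. tlift k C V (tensor k C T) t (\<lambda>a v.
         tlift k C C (tensor k C T) (comult C a) (\<lambda>a1 a2.
           tens k C T a1 (tens k C V a2 v))))\<rparr>)"

text \<open>The right covariant bimodule \<open>W \<otimes> C\<close> generated by a left module, and its extension by the left
  coaction when \<open>W\<close> is a left-left Yetter--Drinfeld module.\<close>

definition right_generated ::
  "('k, 'r) ring_scheme \<Rightarrow> ('k, 'b, 'p) bialg_scheme \<Rightarrow> ('k, 'w, 'q) module_scheme
    \<Rightarrow> ('b \<Rightarrow> 'w \<Rightarrow> 'w) \<Rightarrow> ('k, 'b, ('w \<times> 'b \<Rightarrow> 'k) set) rcov_bimod" where
  "right_generated k C W act =
    (let T = tensor k W C in
      \<lparr>carrier = carrier T, mult = undefined, one = undefined,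
       zero = zero T, add = add T, smult = smult T,
       lact = (\<lambda>a t. tlift k W C T t (\<lambda>w b.
         tlift k C C T (comult C a) (\<lambda>a1 a2. tens k W C (act a1 w) (a2 \<otimes>\<^bsub>C\<^esub> b)))),
       ract = (\<lambda>t c. tlift k W C T t (\<lambda>w b. tens k W C w (b \<otimes>\<^bsub>C\<^esub> c))),
       rcoact = (\<lambda>t. tlift k W C (tensor k T C) t (\<lambda>w b.
         tlift k C C (tensor k T C) (comult C b) (\<lambda>b1 b2.
           tens k T C (tens k W C w b1) b2)))\<rparr>)"

definition right_generated_yd ::
  "('k, 'r) ring_scheme \<Rightarrow> ('k, 'b, 'p) bialg_scheme \<Rightarrow> ('k, 'w, 'q) module_scheme
    \<Rightarrow> ('b \<Rightarrow> 'w \<Rightarrow> 'w) \<Rightarrow> ('w \<Rightarrow> ('b \<times> 'w \<Rightarrow> 'k) set)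
    \<Rightarrow> ('k, 'b, ('w \<times> 'b \<Rightarrow> 'k) set) bicov_bimod" where
  "right_generated_yd k C W act \<rho> =
    (let T = tensor k W C in
      rcov_bimod.extend (right_generated k C W act)
        (bicov_bimod.fields (\<lambda>t. tlift k W C (tensor k C T) t (\<lambda>w b.
          tlift k C W (tensor k C T) (\<rho> w) (\<lambda>wm w0.
            tlift k C C (tensor k C T) (comult C b) (\<lambda>b1 b2.
              tens k C T (wm \<otimes>\<^bsub>C\<^esub> b1) (tens k W C w0 b2)))))))"

text \<open>All left module maps over the unital algebra \<open>A\<close> are \<open>k\<close>-linear, so requiring linearity
  excludes nothing.\<close>

definition left_dual ::
  "('k, 'r) ring_scheme \<Rightarrow> ('k, 'b, 'p) module_scheme \<Rightarrow> ('k, 'b, 'm, 'q) bimod_scheme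
    \<Rightarrow> ('k, 'b, 'm \<Rightarrow> 'b) bimod" where
  "left_dual k A M =
    \<lparr>carrier = {X \<in> extensional (carrier M). linear_map k M A X \<and>
       (\<forall>a\<in>carrier A. \<forall>x\<in>carrier M. X (lact M a x) = a \<otimes>\<^bsub>A\<^esub> X x)},
     mult = undefined, one = undefined,
     zero = (\<lambda>x\<in>carrier M. \<zero>\<^bsub>A\<^esub>),
     add = (\<lambda>X Y. \<lambda>x\<in>carrier M. X x \<oplus>\<^bsub>A\<^esub> Y x),
     smult = (\<lambda>c X. \<lambda>x\<in>carrier M. c \<odot>\<^bsub>A\<^esub> X x),
     lact = (\<lambda>a X. \<lambda>x\<in>carrier M. X (ract M x a)),
     ract = (\<lambda>X b. \<lambda>x\<in>carrier M. X x \<otimes>\<^bsub>A\<^esub> b)\<rparr>"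

text \<open>The map from \<open>V\<^sup>* \<otimes> B\<close> to the left dual of \<open>B \<otimes> V\<close>,
  \<open>(\<alpha> \<otimes> b) (a \<otimes> v) = \<alpha> v \<odot> (a b)\<close>.\<close>

definition dual_identification ::
  "('k, 'r) ring_scheme \<Rightarrow> ('k, 'b, 'p) module_scheme \<Rightarrow> ('k, 'v, 'q) module_scheme
    \<Rightarrow> (('v \<Rightarrow> 'k) \<times> 'b \<Rightarrow> 'k) set \<Rightarrow> ('b \<times> 'v \<Rightarrow> 'k) set \<Rightarrow> 'b" where
  "dual_identification k B V t =
    (\<lambda>x\<in>carrier (tensor k B V).
      tlift k (dual k V) B B t (\<lambda>\<alpha> b. tlift k B V B x (\<lambda>a v. \<alpha> v \<odot>\<^bsub>B\<^esub> (a \<otimes>\<^bsub>B\<^esub> b))))"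


section \<open>Transposes and push-forwards\<close>

definition transpose_action ::
  "('k, 'v, 'q) module_scheme \<Rightarrow> ('v \<Rightarrow> 'b \<Rightarrow> 'v) \<Rightarrow> 'b \<Rightarrow> ('v \<Rightarrow> 'k) \<Rightarrow> 'v \<Rightarrow> 'k" where
  "transpose_action V act a \<alpha> = (\<lambda>v\<in>carrier V. \<alpha> (act v a))"

text \<open>The matrix \<open>R\<close> with \<open>\<rho> e\<^sub>y = \<Sum>\<^sub>x e\<^sub>x \<otimes> R x y\<close>: the upper index comes first.\<close>

definition coaction_matrix ::
  "('k, 'r) ring_scheme \<Rightarrow> ('k, 'b, 'p) module_scheme \<Rightarrow> ('k, 'v, 'q) module_scheme \<Rightarrow> 'v set
    \<Rightarrow> ('v \<Rightarrow> ('v \<times> 'b \<Rightarrow> 'k) set) \<Rightarrow> 'v \<Rightarrow> 'v \<Rightarrow> 'b" where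
  "coaction_matrix k B V X \<rho> = curry
    (THE R. R \<in> X \<times> X \<rightarrow>\<^sub>E carrier B \<and>
      (\<forall>y\<in>X. \<rho> y = (\<Oplus>\<^bsub>tensor k V B\<^esub>x\<in>X. tens k V B x (R (x, y)))))"

text \<open>The linear extension of \<open>e\<^sup>x \<mapsto> \<Sum>\<^sub>y R x y \<otimes> e\<^sup>y\<close>, using \<open>\<alpha> = \<Sum>\<^sub>x \<alpha> e\<^sub>x \<odot> e\<^sup>x\<close>.\<close>

definition transpose_coaction ::
  "('k, 'r) ring_scheme \<Rightarrow> ('k, 'b, 'p) module_scheme \<Rightarrow> ('k, 'v, 'q) module_scheme \<Rightarrow> 'v set
    \<Rightarrow> ('v \<Rightarrow> ('v \<times> 'b \<Rightarrow> 'k) set) \<Rightarrow> ('v \<Rightarrow> 'k) \<Rightarrow> ('b \<times> ('v \<Rightarrow> 'k) \<Rightarrow> 'k) set" where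
  "transpose_coaction k B V X \<rho> \<alpha> =
    (let T = tensor k B (dual k V) in
      \<Oplus>\<^bsub>T\<^esub>x\<in>X. \<alpha> x \<odot>\<^bsub>T\<^esub>
        (\<Oplus>\<^bsub>T\<^esub>y\<in>X. tens k B (dual k V) (coaction_matrix k B V X \<rho> x y) (dual_vec k V X y)))"

definition coact_cop_of_left where
  "coact_cop_of_left k C V \<rho> = (\<lambda>v. flip k C V (\<rho> v))"

definition coact_cop_of_right where
  "coact_cop_of_right k C V \<rho> = (\<lambda>v. flip k V C (\<rho> v))"

text \<open>Push-forwards along an anti-coalgebra map \<open>T\<close>, which change the side of the coaction.\<close>

definition push_left_to_right ::
  "('k, 'r) ring_scheme \<Rightarrow> ('k, 'b, 'p) module_scheme \<Rightarrow> ('k, 'v, 'q) module_scheme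
    \<Rightarrow> ('b \<Rightarrow> 'b) \<Rightarrow> ('v \<Rightarrow> ('b \<times> 'v \<Rightarrow> 'k) set) \<Rightarrow> 'v \<Rightarrow> ('v \<times> 'b \<Rightarrow> 'k) set" where
  "push_left_to_right k C V T \<rho> =
    (\<lambda>v. tlift k C V (tensor k V C) (\<rho> v) (\<lambda>c w. tens k V C w (T c)))"

definition push_right_to_left ::
  "('k, 'r) ring_scheme \<Rightarrow> ('k, 'b, 'p) module_scheme \<Rightarrow> ('k, 'v, 'q) module_scheme
    \<Rightarrow> ('b \<Rightarrow> 'b) \<Rightarrow> ('v \<Rightarrow> ('v \<times> 'b \<Rightarrow> 'k) set) \<Rightarrow> 'v \<Rightarrow> ('b \<times> 'v \<Rightarrow> 'k) set" where
  "push_right_to_left k C V T \<rho> =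
    (\<lambda>v. tlift k V C (tensor k C V) (\<rho> v) (\<lambda>w c. tens k C V (T c) w))"

text \<open>The pairing of \<open>B \<otimes> V\<^sup>*\<close> with \<open>V \<otimes> B\<close>, \<open>(a \<otimes> \<alpha>, v \<otimes> b) \<mapsto> \<alpha> v \<odot> (a b)\<close>.\<close>

definition tensor_pairing ::
  "('k, 'r) ring_scheme \<Rightarrow> ('k, 'b, 'p) module_scheme \<Rightarrow> ('k, 'v, 'q) module_scheme
    \<Rightarrow> ('b \<times> ('v \<Rightarrow> 'k) \<Rightarrow> 'k) set \<Rightarrow> ('v \<times> 'b \<Rightarrow> 'k) set \<Rightarrow> 'b" where
  "tensor_pairing k B V s t =
    tlift k B (dual k V) B s (\<lambda>a \<alpha>. tlift k V B B t (\<lambda>v b. \<alpha> v \<odot>\<^bsub>B\<^esub> (a \<otimes>\<^bsub>B\<^esub> b)))"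

end

theory Submission
  imports Defs
begin

text \<open>
  For a functional \<open>\<alpha>\<close> and a vector \<open>v\<close> put \<open>hat \<alpha> v = \<alpha>(v\<^sub>0) v\<^sub>1\<close>; these elements of \<open>B\<close> are the coordinate-free
  form of the coaction matrix. As \<open>V\<close> is finite-dimensional, a tensor in \<open>U \<otimes> V\<^sup>*\<close> is determined by its
  evaluations at vectors, and the coaction on the dual is the one whose evaluation at \<open>v\<close> is
  \<open>S\<^sup>-\<^sup>1(hat \<alpha> v)\<close>. Since \<open>S\<close> reverses products and coproducts, coassociativity follows from that of \<open>V\<close>.
  The Yetter--Drinfeld condition, evaluated at \<open>v\<close> and mapped by \<open>S\<close>, becomes
  \<open>hat \<alpha> (v.a\<^sub>1) S(a\<^sub>2) = S(a\<^sub>1) hat (a\<^sub>2.\<alpha>) v\<close>, which is the condition of \<open>V\<close> multiplied by \<open>S(a\<^sub>1)\<close> on the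
  left and by \<open>S(a\<^sub>4)\<close> on the right. In the same way the pairing identity is \<open>\<alpha>(v\<^sub>0) v\<^sub>1 S(v\<^sub>2) = \<alpha>(v) 1\<close>.
\<close>

section \<open>Linear maps and free vector spaces\<close>

text \<open>The co-opposite is forced by transposition. The element
  \<open>a.(\<alpha> \<otimes> b)\<close> sends \<open>c \<otimes> v\<close> to the value of
  \<open>\<alpha> \<otimes> b\<close> at \<open>(c \<otimes> v).a\<close>, which is
  \<open>\<alpha>(v.a2) c a1 b\<close>; so the second Sweedler component acts on \<alpha> and the
  first multiplies \<open>b\<close>, the reverse of the order in a bimodule generated over
  \<open>B\<close> itself. The transposed coaction is a left coaction of \<open>B\<close>; the
  co-opposite makes it a right one, and an anti-coalgebra map brings it back to the left. With the
  inverse antipode in this role, mapping the Yetter-Drinfeld condition by \<open>S\<close> leaves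
  the matrix entries themselves, next to \<open>S\<close> of components of the algebra element. The
  formal obstacle is that a Sweedler sum is a finite sum over an arbitrarily chosen representative
  of a coset. Its manipulation carries linearity side conditions; these are arranged as rewrite
  rules that follow the syntax of the integrand, so that a calculation consists of coassociativity,
  exchanges of independent sums and normalisation.\<close>

lemma vs_smult_closed: "vectorspace k U \<Longrightarrow> c \<in> carrier k \<Longrightarrow> u \<in> carrier U \<Longrightarrow> c \<odot>\<^bsub>U\<^esub> u \<in> carrier U"
  by (rule module.smult_closed[OF vectorspace.axioms(1)])

lemma linear_mapI:
  assumes "vectorspace k V" "vectorspace k W"
    and "\<And>v. v \<in> carrier V \<Longrightarrow> f v \<in> carrier W"
    and "\<And>v w. \<lbrakk>v \<in> carrier V; w \<in> carrier V\<rbrakk> \<Longrightarrow> f (v \<oplus>\<^bsub>V\<^esub> w) = f v \<oplus>\<^bsub>W\<^esub> f w"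
    and "\<And>c v. \<lbrakk>c \<in> carrier k; v \<in> carrier V\<rbrakk> \<Longrightarrow> f (c \<odot>\<^bsub>V\<^esub> v) = c \<odot>\<^bsub>W\<^esub> f v"
  shows "linear_map k V W f"
  using assms
  by (auto simp: linear_map_def mod_hom_def mod_hom_axioms_def module_hom_def vectorspace_def)

lemma linear_mapD:
  assumes "linear_map k V W f"
  shows "vectorspace k V" "vectorspace k W"
    and "v \<in> carrier V \<Longrightarrow> f v \<in> carrier W"
    and "\<lbrakk>v \<in> carrier V; w \<in> carrier V\<rbrakk> \<Longrightarrow> f (v \<oplus>\<^bsub>V\<^esub> w) = f v \<oplus>\<^bsub>W\<^esub> f w"
    and "\<lbrakk>c \<in> carrier k; v \<in> carrier V\<rbrakk> \<Longrightarrow> f (c \<odot>\<^bsub>V\<^esub> v) = c \<odot>\<^bsub>W\<^esub> f v"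
    and "f \<zero>\<^bsub>V\<^esub> = \<zero>\<^bsub>W\<^esub>"
proof -
  interpret linear_map k V W f by fact
  show "vectorspace k V" "vectorspace k W" by unfold_locales
  show "v \<in> carrier V \<Longrightarrow> f v \<in> carrier W"
    "\<lbrakk>v \<in> carrier V; w \<in> carrier V\<rbrakk> \<Longrightarrow> f (v \<oplus>\<^bsub>V\<^esub> w) = f v \<oplus>\<^bsub>W\<^esub> f w"
    "\<lbrakk>c \<in> carrier k; v \<in> carrier V\<rbrakk> \<Longrightarrow> f (c \<odot>\<^bsub>V\<^esub> v) = c \<odot>\<^bsub>W\<^esub> f v"
    "f \<zero>\<^bsub>V\<^esub> = \<zero>\<^bsub>W\<^esub>"
    by (auto simp: f_add f_smult)
qed

lemma linear_map_finsum:
  assumes f: "linear_map k V W f" and g: "\<And>i. i \<in> I \<Longrightarrow> g i \<in> carrier V"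
  shows "f (\<Oplus>\<^bsub>V\<^esub>i\<in>I. g i) = (\<Oplus>\<^bsub>W\<^esub>i\<in>I. f (g i))"
proof -
  interpret linear_map k V W f by fact
  show ?thesis
  proof (cases "finite I")
    case True
    then show ?thesis using g
      by (induction I) (auto simp: f_add)
  qed simp
qed

lemma foldSetD_cong:
  assumes "(A, x) \<in> foldSetD D f e" "\<And>a y. a \<in> A \<Longrightarrow> f a y = g a y"
  shows "(A, x) \<in> foldSetD D g e"
  using assms by induction (auto intro: foldSetD.intros)

text \<open>The fold visits the family only at members of the index set, so the two fold relations
  coincide as sets. The rule therefore works in any structure, before closure of the summands has
  been established.\<close>

lemma finsum_eqI:
  assumes "\<And>a. a \<in> A \<Longrightarrow> f a = g a"
  shows "finsum G f A = finsum G g A"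
proof -
  have "(A, x) \<in> foldSetD D (\<lambda>a. add G (f a)) e \<longleftrightarrow> (A, x) \<in> foldSetD D (\<lambda>a. add G (g a)) e" for x D e
    using foldSetD_cong[of A x D "\<lambda>a. add G (f a)" e "\<lambda>a. add G (g a)"]
      foldSetD_cong[of A x D "\<lambda>a. add G (g a)" e "\<lambda>a. add G (f a)"] assms by auto
  then show ?thesis by (simp add: finsum_def finprod_def foldD_def comp_def)
qed

text \<open>Linearity is a condition on values at carrier elements; this transfers it to restricted
  functions, the form in which functionals are stored.\<close>

lemma linear_map_cong:
  assumes "\<And>v. v \<in> carrier V \<Longrightarrow> f v = g v" "linear_map k V W g"
  shows "linear_map k V W f"
proof -
  note g = linear_mapD[OF assms(2)]
  interpret V: vectorspace k V by (rule g)
  show ?thesis by (rule linear_mapI) (simp_all add: assms(1) g)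
qed

lemma lin_add:
  assumes f: "linear_map k Z U f" and g: "linear_map k Z U g"
  shows "linear_map k Z U (\<lambda>z. f z \<oplus>\<^bsub>U\<^esub> g z)"
proof -
  interpret U: vectorspace k U by (rule linear_mapD[OF f])
  show ?thesis
    by (rule linear_mapI) (simp_all add: linear_mapD[OF f] linear_mapD[OF g] U.smult_r_distr U.M.a_ac)
qed

lemma lin_zero:
  assumes "vectorspace k Z" "vectorspace k U"
  shows "linear_map k Z U (\<lambda>z. \<zero>\<^bsub>U\<^esub>)"
proof -
  interpret U: vectorspace k U by fact
  show ?thesis by (rule linear_mapI) (use assms in \<open>simp_all add: U.smult_r_null\<close>)
qed

lemma lin_finsum:
  assumes "vectorspace k Z" "vectorspace k U" "\<And>i. i \<in> I \<Longrightarrow> linear_map k Z U (f i)"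
  shows "linear_map k Z U (\<lambda>z. \<Oplus>\<^bsub>U\<^esub>i\<in>I. f i z)"
proof -
  interpret U: vectorspace k U by fact
  show ?thesis
  proof (cases "finite I")
    case True
    then show ?thesis using assms(3)
    proof (induction I)
      case (insert i I)
      have "linear_map k Z U (\<lambda>z. f i z \<oplus>\<^bsub>U\<^esub> (\<Oplus>\<^bsub>U\<^esub>i\<in>I. f i z))"
        by (rule lin_add) (use insert in auto)
      then show ?case
        by (rule linear_map_cong[rotated])
          (rule U.M.finsum_insert, use insert linear_mapD(3)[OF insert.prems] in auto)
    qed (simp add: lin_zero assms)
  qed (simp add: lin_zero assms)
qed

lemma lin_smult_r [simp]:
  assumes f: "linear_map k Z U f" and c: "c \<in> carrier k"
  shows "linear_map k Z U (\<lambda>z. c \<odot>\<^bsub>U\<^esub> f z)"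
proof -
  interpret U: vectorspace k U by (rule linear_mapD[OF f])
  show ?thesis
    by (rule linear_mapI)
      (use c in \<open>simp_all add: linear_mapD[OF f] U.smult_r_distr U.m_comm flip: U.smult_assoc1\<close>)
qed

lemma scalars_vs [simp]:
  assumes "field k"
  shows "vectorspace k (scalars k)"
proof -
  interpret field k by fact
  show ?thesis
  proof (rule vs_criteria[OF assms])
    show "\<forall>v\<in>carrier (scalars k). \<exists>w\<in>carrier (scalars k). v \<oplus>\<^bsub>scalars k\<^esub> w = \<zero>\<^bsub>scalars k\<^esub>"
    proof
      fix v assume "v \<in> carrier (scalars k)"
      then show "\<exists>w\<in>carrier (scalars k). v \<oplus>\<^bsub>scalars k\<^esub> w = \<zero>\<^bsub>scalars k\<^esub>"
        by (intro bexI[of _ "\<ominus>\<^bsub>k\<^esub> v"]) (simp_all add: scalars_def r_neg)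
    qed
  qed (simp_all add: scalars_def a_ac m_assoc l_distr r_distr)
qed

lemma lin_smult_l [simp]:
  assumes f: "linear_map k Z (scalars k) f" and u: "u \<in> carrier U" and U: "vectorspace k U"
  shows "linear_map k Z U (\<lambda>z. f z \<odot>\<^bsub>U\<^esub> u)"
proof -
  interpret U: vectorspace k U by (rule U)
  note f' = linear_mapD[OF f, unfolded scalars_def, simplified]
  show ?thesis
    by (rule linear_mapI)
      (use u U in \<open>simp_all add: f' linear_mapD(1)[OF f] U.smult_l_distr U.smult_assoc1\<close>)
qed

text \<open>The common step behind extensionality on free generators, on a basis and on the dual
  basis.\<close>

lemma linear_eq_on_finsum:
  assumes f: "linear_map k V U f" and g: "linear_map k V U g"
    and b: "\<And>x. x \<in> X \<Longrightarrow> b x \<in> carrier V" and c: "\<And>x. x \<in> X \<Longrightarrow> c x \<in> carrier k"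
    and eq: "\<And>x. x \<in> X \<Longrightarrow> f (b x) = g (b x)" and v: "v = (\<Oplus>\<^bsub>V\<^esub>x\<in>X. c x \<odot>\<^bsub>V\<^esub> b x)"
  shows "f v = g v"
proof -
  have cb: "c x \<odot>\<^bsub>V\<^esub> b x \<in> carrier V" if "x \<in> X" for x
    using vs_smult_closed[OF linear_mapD(1)[OF f]] b c that by blast
  have "f v = (\<Oplus>\<^bsub>U\<^esub>x\<in>X. f (c x \<odot>\<^bsub>V\<^esub> b x))"
    unfolding v by (rule linear_map_finsum[OF f cb])
  also have "\<dots> = (\<Oplus>\<^bsub>U\<^esub>x\<in>X. g (c x \<odot>\<^bsub>V\<^esub> b x))"
    by (rule finsum_eqI) (simp add: linear_mapD(5)[OF f] linear_mapD(5)[OF g] b c eq)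
  also have "\<dots> = g v"
    unfolding v by (rule linear_map_finsum[OF g cb, symmetric])
  finally show ?thesis .
qed

text \<open>The dual space and the left dual bimodule are both spaces of extensional functions with
  pointwise operations, so all axioms come from the target. Extensionality turns the pointwise
  identities into equality of functions.\<close>

lemma pointwise_vectorspace:
  assumes U: "vectorspace k U"
    and ext: "\<And>f. f \<in> carrier M \<Longrightarrow> f \<in> extensional Z"
    and val: "\<And>f z. f \<in> carrier M \<Longrightarrow> z \<in> Z \<Longrightarrow> f z \<in> carrier U"
    and zero: "\<zero>\<^bsub>M\<^esub> = (\<lambda>z\<in>Z. \<zero>\<^bsub>U\<^esub>)" "\<zero>\<^bsub>M\<^esub> \<in> carrier M"
    and add: "\<And>f g. f \<oplus>\<^bsub>M\<^esub> g = (\<lambda>z\<in>Z. f z \<oplus>\<^bsub>U\<^esub> g z)"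
      "\<And>f g. f \<in> carrier M \<Longrightarrow> g \<in> carrier M \<Longrightarrow> f \<oplus>\<^bsub>M\<^esub> g \<in> carrier M"
    and smult: "\<And>c f. c \<odot>\<^bsub>M\<^esub> f = (\<lambda>z\<in>Z. c \<odot>\<^bsub>U\<^esub> f z)"
      "\<And>c f. c \<in> carrier k \<Longrightarrow> f \<in> carrier M \<Longrightarrow> c \<odot>\<^bsub>M\<^esub> f \<in> carrier M"
  shows "vectorspace k M"
proof -
  interpret U: vectorspace k U by (rule U)
  show ?thesis
  proof (rule vs_criteria[OF U.field_axioms])
    show "\<forall>f\<in>carrier M. \<exists>g\<in>carrier M. f \<oplus>\<^bsub>M\<^esub> g = \<zero>\<^bsub>M\<^esub>"
    proof
      fix f assume f: "f \<in> carrier M"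
      \<comment> \<open>The negative is taken as the scalar multiple by -1, so closure under scalars
        already provides it.\<close>
      have "f \<oplus>\<^bsub>M\<^esub> ((\<ominus>\<^bsub>k\<^esub> \<one>\<^bsub>k\<^esub>) \<odot>\<^bsub>M\<^esub> f) = \<zero>\<^bsub>M\<^esub>"
        unfolding add(1) smult(1) zero(1)
        by (rule restrict_ext) (simp add: val[OF f] U.smult_l_minus U.M.r_neg)
      then show "\<exists>g\<in>carrier M. f \<oplus>\<^bsub>M\<^esub> g = \<zero>\<^bsub>M\<^esub>" using smult(2)[OF _ f] by blast
    qed
    show "\<forall>f\<in>carrier M. f \<oplus>\<^bsub>M\<^esub> \<zero>\<^bsub>M\<^esub> = f" "\<forall>f\<in>carrier M. \<one>\<^bsub>k\<^esub> \<odot>\<^bsub>M\<^esub> f = f"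
      unfolding add(1) smult(1) zero(1)
      by (auto intro!: extensionalityI[of _ Z] simp: ext val)
  qed (use zero add(2) smult(2) in simp_all, unfold add(1) smult(1),
    auto intro!: restrict_ext U.M.a_comm U.M.a_assoc U.smult_assoc1 U.smult_l_distr U.smult_r_distr val)
qed

lemma pointwise_linear:
  assumes Z: "vectorspace k Z" and M: "vectorspace k M"
    and ops: "\<And>f g. f \<oplus>\<^bsub>M\<^esub> g = (\<lambda>x\<in>D. f x \<oplus>\<^bsub>U\<^esub> g x)" "\<And>c f. c \<odot>\<^bsub>M\<^esub> f = (\<lambda>x\<in>D. c \<odot>\<^bsub>U\<^esub> f x)"
    and ext: "\<And>f. f \<in> carrier M \<Longrightarrow> f \<in> extensional D"
    and cl: "\<And>z. z \<in> carrier Z \<Longrightarrow> F z \<in> carrier M"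
    and lin: "\<And>x. x \<in> D \<Longrightarrow> linear_map k Z U (\<lambda>z. F z x)"
  shows "linear_map k Z M F"
proof (rule linear_mapI[OF Z M cl])
  interpret Z: vectorspace k Z by (rule Z)
  show "F (y \<oplus>\<^bsub>Z\<^esub> z) = F y \<oplus>\<^bsub>M\<^esub> F z" if "y \<in> carrier Z" "z \<in> carrier Z" for y z
    unfolding ops by (rule extensionalityI[of _ D]) (use that in \<open>simp_all add: ext cl linear_mapD(4)[OF lin]\<close>)
  show "F (c \<odot>\<^bsub>Z\<^esub> z) = c \<odot>\<^bsub>M\<^esub> F z" if "c \<in> carrier k" "z \<in> carrier Z" for c z
    unfolding ops by (rule extensionalityI[of _ D]) (use that in \<open>simp_all add: ext cl linear_mapD(5)[OF lin]\<close>)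
qed

section \<open>Free vector spaces and their universal property\<close>

context field
begin

lemma free_vs_vectorspace: "vectorspace R (free_vs R X)"
proof (rule vs_criteria[OF field_axioms])
  have fin: "finite {x. f x \<oplus> g x \<noteq> \<zero>}"
    if "f \<in> carrier (free_vs R X)" "g \<in> carrier (free_vs R X)" for f g
  proof (rule finite_subset)
    show "{x. f x \<oplus> g x \<noteq> \<zero>} \<subseteq> {x. f x \<noteq> \<zero>} \<union> {x. g x \<noteq> \<zero>}" by auto
    show "finite ({x. f x \<noteq> \<zero>} \<union> {x. g x \<noteq> \<zero>})" using that by (auto simp: free_vs_def)
  qed
  have fin2: "finite {x. c \<otimes> f x \<noteq> \<zero>}" if "f \<in> carrier (free_vs R X)" "c \<in> carrier R" for c f
    by (rule finite_subset[of _ "{x. f x \<noteq> \<zero>}"]) (use that in \<open>auto simp: free_vs_def\<close>)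
  show "\<forall>v w. v \<in> carrier (free_vs R X) \<and> w \<in> carrier (free_vs R X) \<longrightarrow>
    v \<oplus>\<^bsub>free_vs R X\<^esub> w \<in> carrier (free_vs R X)"
    using fin by (auto simp: free_vs_def)
  show "\<forall>c v. c \<in> carrier R \<and> v \<in> carrier (free_vs R X) \<longrightarrow>
    c \<odot>\<^bsub>free_vs R X\<^esub> v \<in> carrier (free_vs R X)"
    using fin2 by (auto simp: free_vs_def)
  show "\<forall>v\<in>carrier (free_vs R X). \<exists>w\<in>carrier (free_vs R X). v \<oplus>\<^bsub>free_vs R X\<^esub> w = \<zero>\<^bsub>free_vs R X\<^esub>"
  proof
    fix f assume f: "f \<in> carrier (free_vs R X)"
    have "(\<lambda>x. \<ominus> f x) \<in> carrier (free_vs R X)"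
      using f by (auto simp: free_vs_def intro: finite_subset[of _ "{x. f x \<noteq> \<zero>}"])
    then show "\<exists>w\<in>carrier (free_vs R X). f \<oplus>\<^bsub>free_vs R X\<^esub> w = \<zero>\<^bsub>free_vs R X\<^esub>"
      using f by (intro bexI[of _ "\<lambda>x. \<ominus> f x"]) (auto simp: free_vs_def r_neg)
  qed
qed (auto simp: free_vs_def fun_eq_iff a_ac l_distr r_distr m_assoc)

lemma free_gen_closed [simp]: "x \<in> X \<Longrightarrow> free_gen R x \<in> carrier (free_vs R X)"
  by (auto simp: free_vs_def free_gen_def)

lemma free_vs_simps:
  "f \<in> carrier (free_vs R X) \<longleftrightarrow>
    (\<forall>x. f x \<in> carrier R) \<and> (\<forall>x. x \<notin> X \<longrightarrow> f x = \<zero>) \<and> finite {x. f x \<noteq> \<zero>}"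
  "f \<oplus>\<^bsub>free_vs R X\<^esub> g = (\<lambda>x. f x \<oplus> g x)"
  "c \<odot>\<^bsub>free_vs R X\<^esub> f = (\<lambda>x. c \<otimes> f x)"
  "\<zero>\<^bsub>free_vs R X\<^esub> = (\<lambda>x. \<zero>)"
  by (auto simp: free_vs_def)

end

definition free_lift ::
  "('k, 'r) ring_scheme \<Rightarrow> ('k, 'u, 's) module_scheme \<Rightarrow> ('a \<Rightarrow> 'u) \<Rightarrow> ('a \<Rightarrow> 'k) \<Rightarrow> 'u" where
  "free_lift k U \<beta> f = (\<Oplus>\<^bsub>U\<^esub>x\<in>{x. f x \<noteq> \<zero>\<^bsub>k\<^esub>}. f x \<odot>\<^bsub>U\<^esub> \<beta> x)"

text \<open>The defining sum runs over the support, which changes with \<open>f\<close>. Padding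
  with zero terms lets sums for different functions be compared over one index set.\<close>

lemma free_lift_superset:
  assumes "vectorspace k U" "f \<in> carrier (free_vs k X)" "\<And>x. x \<in> X \<Longrightarrow> \<beta> x \<in> carrier U"
    and "finite A" "{x. f x \<noteq> \<zero>\<^bsub>k\<^esub>} \<subseteq> A" "A \<subseteq> X"
  shows "free_lift k U \<beta> f = (\<Oplus>\<^bsub>U\<^esub>x\<in>A. f x \<odot>\<^bsub>U\<^esub> \<beta> x)"
proof -
  interpret U: vectorspace k U by fact
  show ?thesis unfolding free_lift_def
    by (rule U.M.add.finprod_mono_neutral_cong_left)
      (use assms in \<open>auto simp: U.free_vs_simps subset_iff\<close>)
qed

lemma free_eval_linear:
  assumes "field k"
  shows "linear_map k (free_vs k X) (scalars k) (\<lambda>f. f x)"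
proof -
  interpret field k by fact
  show ?thesis
    by (rule linear_mapI[OF free_vs_vectorspace scalars_vs[OF assms]])
      (simp_all add: free_vs_simps(2,3), simp_all add: free_vs_simps(1) scalars_def)
qed

lemma free_lift_linear:
  assumes "vectorspace k U" "\<And>x. x \<in> X \<Longrightarrow> \<beta> x \<in> carrier U"
  shows "linear_map k (free_vs k X) U (free_lift k U \<beta>)"
proof -
  interpret U: vectorspace k U by fact
  let ?F = "free_vs k X" and ?supp = "\<lambda>f. {x. f x \<noteq> \<zero>\<^bsub>k\<^esub>}"
  note F = U.free_vs_vectorspace[of X]
  note S = free_lift_superset[OF assms(1) _ assms(2), where X = X]
  have supp: "finite (?supp f)" "?supp f \<subseteq> X" if "f \<in> carrier ?F" for f
    using that by (auto simp: U.free_vs_simps)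
  have lin: "linear_map k ?F U (\<lambda>f. \<Oplus>\<^bsub>U\<^esub>x\<in>A. f x \<odot>\<^bsub>U\<^esub> \<beta> x)" if "A \<subseteq> X" for A
    by (intro lin_finsum F assms(1) lin_smult_l free_eval_linear[OF U.field_axioms])
      (use that assms(2) in blast)
  show ?thesis
  proof (rule linear_mapI[OF F assms(1)])
    fix f assume f: "f \<in> carrier ?F"
    have Sf: "free_lift k U \<beta> f = (\<Oplus>\<^bsub>U\<^esub>x\<in>?supp f. f x \<odot>\<^bsub>U\<^esub> \<beta> x)"
      by (simp add: free_lift_def)
    then show "free_lift k U \<beta> f \<in> carrier U"
      using linear_mapD(3)[OF lin[OF supp(2)[OF f]] f] by simp
    fix c assume c: "c \<in> carrier k"
    have cf: "c \<odot>\<^bsub>?F\<^esub> f \<in> carrier ?F"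
      by (rule vs_smult_closed[OF F c f])
    have "free_lift k U \<beta> (c \<odot>\<^bsub>?F\<^esub> f) = (\<Oplus>\<^bsub>U\<^esub>x\<in>?supp f. (c \<odot>\<^bsub>?F\<^esub> f) x \<odot>\<^bsub>U\<^esub> \<beta> x)"
      by (rule S[OF cf _ supp(1)[OF f] _ supp(2)[OF f]]) (use c in \<open>auto simp: U.free_vs_simps\<close>)
    then show "free_lift k U \<beta> (c \<odot>\<^bsub>?F\<^esub> f) = c \<odot>\<^bsub>U\<^esub> free_lift k U \<beta> f"
      using linear_mapD(5)[OF lin[OF supp(2)[OF f]] c f] Sf by simp
  next
    fix f g assume f: "f \<in> carrier ?F" and g: "g \<in> carrier ?F"
    \<comment> \<open>The support of a sum may shrink by cancellation, so all three sums are taken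
      over the union.\<close>
    define A where "A = ?supp f \<union> ?supp g"
    have A: "finite A" "A \<subseteq> X" "?supp f \<subseteq> A" "?supp g \<subseteq> A"
      unfolding A_def using supp[OF f] supp[OF g] by auto
    have fg: "f \<oplus>\<^bsub>?F\<^esub> g \<in> carrier ?F"
      using F f g by (simp add: vectorspace_def module_def abelian_group_def abelian_monoid.a_closed)
    have "free_lift k U \<beta> (f \<oplus>\<^bsub>?F\<^esub> g) = (\<Oplus>\<^bsub>U\<^esub>x\<in>A. (f \<oplus>\<^bsub>?F\<^esub> g) x \<odot>\<^bsub>U\<^esub> \<beta> x)"
      by (rule S[OF fg _ A(1) _ A(2)]) (auto simp: U.free_vs_simps A_def)
    then show "free_lift k U \<beta> (f \<oplus>\<^bsub>?F\<^esub> g) = free_lift k U \<beta> f \<oplus>\<^bsub>U\<^esub> free_lift k U \<beta> g"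
      using linear_mapD(4)[OF lin[OF A(2)] f g] S[OF f _ A(1,3,2)] S[OF g _ A(1,4,2)] by simp
  qed
qed

lemma free_lift_gen:
  assumes "vectorspace k U" "\<beta> x \<in> carrier U"
  shows "free_lift k U \<beta> (free_gen k x) = \<beta> x"
proof -
  interpret U: vectorspace k U by fact
  have "{y. free_gen k x y \<noteq> \<zero>\<^bsub>k\<^esub>} = {x}" by (auto simp: free_gen_def)
  then show ?thesis using assms by (simp add: free_lift_def free_gen_def)
qed

lemma free_vs_ext:
  assumes "linear_map k (free_vs k X) U f" "linear_map k (free_vs k X) U g"
    and eq: "\<And>x. x \<in> X \<Longrightarrow> f (free_gen k x) = g (free_gen k x)" and h: "h \<in> carrier (free_vs k X)"
  shows "f h = g h"
proof -
  note f = linear_mapD[OF assms(1)] and g = linear_mapD[OF assms(2)]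
  interpret U: vectorspace k U by (rule f)
  interpret F: vectorspace k "free_vs k X" by (rule f)
  let ?S = "{x. h x \<noteq> \<zero>\<^bsub>k\<^esub>}"
  have S: "finite ?S" "?S \<subseteq> X" using h by (auto simp: U.free_vs_simps)
  have hc: "h x \<in> carrier k" for x using h by (simp add: U.free_vs_simps)
  \<comment> \<open>Evaluated at \<open>y\<close>, a partial sum of the generator expansion returns
    \<open>h y\<close> if \<open>y\<close> is included and zero otherwise; over the whole support
    this is \<open>h\<close>.\<close>
  have fin: "(\<Oplus>\<^bsub>free_vs k X\<^esub>x\<in>A. h x \<odot>\<^bsub>free_vs k X\<^esub> free_gen k x) y = (if y \<in> A then h y else \<zero>\<^bsub>k\<^esub>)"
    if "finite A" "A \<subseteq> X" for A y
    using that
  proof (induction A)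
    case empty
    then show ?case by (simp add: U.free_vs_simps)
  next
    case (insert a A)
    have "(\<Oplus>\<^bsub>free_vs k X\<^esub>x\<in>insert a A. h x \<odot>\<^bsub>free_vs k X\<^esub> free_gen k x) =
      h a \<odot>\<^bsub>free_vs k X\<^esub> free_gen k a \<oplus>\<^bsub>free_vs k X\<^esub>
        (\<Oplus>\<^bsub>free_vs k X\<^esub>x\<in>A. h x \<odot>\<^bsub>free_vs k X\<^esub> free_gen k x)"
      by (rule F.M.finsum_insert) (use insert hc in \<open>auto simp: subset_iff U.free_gen_closed\<close>)
    then have "(\<Oplus>\<^bsub>free_vs k X\<^esub>x\<in>insert a A. h x \<odot>\<^bsub>free_vs k X\<^esub> free_gen k x) y =
      h a \<otimes>\<^bsub>k\<^esub> free_gen k a y \<oplus>\<^bsub>k\<^esub> (if y \<in> A then h y else \<zero>\<^bsub>k\<^esub>)"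
      using insert by (simp add: U.free_vs_simps)
    then show ?case using insert hc by (auto simp: free_gen_def)
  qed
  have "h = (\<Oplus>\<^bsub>free_vs k X\<^esub>x\<in>?S. h x \<odot>\<^bsub>free_vs k X\<^esub> free_gen k x)"
    using fin[OF S] by (auto simp: fun_eq_iff)
  then show ?thesis
    by (rule linear_eq_on_finsum[OF assms(1,2), rotated 3])
      (use S hc eq in \<open>auto simp: U.free_gen_closed\<close>)
qed

section \<open>Tensor products\<close>

text \<open>The quotient map onto the tensor product. Its linearity replaces direct work with
  cosets, since the vector space axioms can then be read off in the free space.\<close>

definition tproj ::
  "('k, 'r) ring_scheme \<Rightarrow> ('k, 'v, 'p) module_scheme \<Rightarrow> ('k, 'w, 'q) module_scheme
    \<Rightarrow> ('v \<times> 'w \<Rightarrow> 'k) \<Rightarrow> ('v \<times> 'w \<Rightarrow> 'k) set" where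
  "tproj k V W f = tensor_null k V W +>\<^bsub>tensor_free k V W\<^esub> f"

lemma tens_tproj: "tens k V W v w = tproj k V W (free_gen k (v, w))"
  by (simp add: tens_def tproj_def)

lemma tensor_simps:
  "carrier (tensor k V W) = a_rcosets\<^bsub>tensor_free k V W\<^esub> (tensor_null k V W)"
  "\<zero>\<^bsub>tensor k V W\<^esub> = tensor_null k V W"
  "s \<oplus>\<^bsub>tensor k V W\<^esub> t = s <+>\<^bsub>tensor_free k V W\<^esub> t"
  "c \<odot>\<^bsub>tensor k V W\<^esub> t = (\<Union>f\<in>t. tproj k V W (c \<odot>\<^bsub>tensor_free k V W\<^esub> f))"
  by (simp_all add: tensor_def Let_def tproj_def)

locale tensor_pair = V: vectorspace k V + W: vectorspace k W
  for k :: "('k, 'r) ring_scheme" and V :: "('k, 'v, 'p) module_scheme"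
    and W :: "('k, 'w, 'q) module_scheme"
begin

abbreviation "F \<equiv> tensor_free k V W"
abbreviation "N \<equiv> tensor_null k V W"
abbreviation "T \<equiv> tensor k V W"
abbreviation "p \<equiv> tproj k V W"

sublocale F: vectorspace k F
  by (rule V.free_vs_vectorspace)

lemma gen_closed [simp]: "v \<in> carrier V \<Longrightarrow> w \<in> carrier W \<Longrightarrow> free_gen k (v, w) \<in> carrier F"
  by (rule V.free_gen_closed) simp

lemma relators_subset: "tensor_relators k V W \<subseteq> carrier F"
  by (auto simp: tensor_relators_def Let_def)

lemma null_submodule: "submodule k N F"
  unfolding tensor_null_def by (rule F.span_is_submodule[OF relators_subset])

lemma null_subset: "N \<subseteq> carrier F"
  using null_submodule by (simp add: submodule_def)

lemma null_smult: "c \<in> carrier k \<Longrightarrow> n \<in> N \<Longrightarrow> c \<odot>\<^bsub>F\<^esub> n \<in> N"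
  using null_submodule by (simp add: submodule_def)

lemma null_relator: "x \<in> tensor_relators k V W \<Longrightarrow> x \<in> N"
  unfolding tensor_null_def using relators_subset F.in_own_span by blast

lemma null_abelian_subgroup: "abelian_subgroup N F"
proof (rule abelian_subgroupI3)
  show "additive_subgroup N F"
  proof (rule additive_subgroup.intro, rule group.subgroupI)
    show "group (add_monoid F)" by (rule F.M.a_group)
    show "N \<noteq> {}" using null_submodule by (auto simp: submodule_def)
    fix a assume a: "a \<in> N"
    have "inv\<^bsub>add_monoid F\<^esub> a = \<ominus>\<^bsub>F\<^esub> a" by (simp add: a_inv_def)
    also have "\<dots> = (\<ominus>\<^bsub>k\<^esub> \<one>\<^bsub>k\<^esub>) \<odot>\<^bsub>F\<^esub> a" using a null_subset by (simp add: F.smult_l_minus subset_iff)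
    also have "\<dots> \<in> N" using a by (simp add: null_smult)
    finally show "inv\<^bsub>add_monoid F\<^esub> a \<in> N" .
  next
    show "a \<otimes>\<^bsub>add_monoid F\<^esub> b \<in> N" if "a \<in> N" "b \<in> N" for a b
      using that null_submodule by (simp add: submodule_def)
  qed (use null_subset in simp)
qed (rule F.M.abelian_group_axioms)

sublocale N: abelian_subgroup N F
  by (rule null_abelian_subgroup)

lemma carrier_tensor: "carrier T = p ` carrier F"
  by (auto simp: tensor_simps(1) A_RCOSETS_def' tproj_def)

lemma p_closed [simp]: "f \<in> carrier F \<Longrightarrow> p f \<in> carrier T"
  by (simp add: carrier_tensor)

lemma p_add: "f \<in> carrier F \<Longrightarrow> g \<in> carrier F \<Longrightarrow> p (f \<oplus>\<^bsub>F\<^esub> g) = p f \<oplus>\<^bsub>T\<^esub> p g"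
  by (simp add: tproj_def tensor_simps(3) N.a_rcos_sum)

lemma p_zero: "p \<zero>\<^bsub>F\<^esub> = \<zero>\<^bsub>T\<^esub>"
  by (simp add: tproj_def tensor_simps(2) F.M.a_coset_add_zero null_subset)

lemma p_mem: "f \<in> carrier F \<Longrightarrow> f \<in> p f"
  by (simp add: tproj_def N.a_rcos_self)

lemma p_eq: "f \<in> carrier F \<Longrightarrow> g \<in> p f \<Longrightarrow> p g = p f"
  unfolding tproj_def using F.M.a_repr_independence[OF _ _ N.a_subgroup, of g f] by simp

lemma p_memD:
  assumes "f \<in> carrier F" "g \<in> p f"
  obtains n where "n \<in> N" "g = n \<oplus>\<^bsub>F\<^esub> f"
  using assms by (auto simp: tproj_def a_r_coset_def')

lemma p_null: "f \<in> carrier F \<Longrightarrow> n \<in> N \<Longrightarrow> p (n \<oplus>\<^bsub>F\<^esub> f) = p f"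
  by (rule p_eq) (simp_all add: tproj_def F.M.a_rcosI null_subset)

text \<open>Scalar multiplication of a coset is defined as a union over all of its members; the null
  space is a submodule, so every member contributes the same coset and the union collapses.\<close>

lemma p_smult:
  assumes c: "c \<in> carrier k" and f: "f \<in> carrier F"
  shows "p (c \<odot>\<^bsub>F\<^esub> f) = c \<odot>\<^bsub>T\<^esub> p f"
proof -
  have *: "p (c \<odot>\<^bsub>F\<^esub> g) = p (c \<odot>\<^bsub>F\<^esub> f)" if g: "g \<in> p f" for g
  proof -
    obtain n where n: "n \<in> N" "g = n \<oplus>\<^bsub>F\<^esub> f" using p_memD[OF f g] .
    have "n \<in> carrier F" using n(1) null_subset by blast
    then have "c \<odot>\<^bsub>F\<^esub> g = c \<odot>\<^bsub>F\<^esub> n \<oplus>\<^bsub>F\<^esub> c \<odot>\<^bsub>F\<^esub> f"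
      unfolding n(2) using c f by (simp add: F.smult_r_distr)
    then show ?thesis using p_null[OF _ null_smult[OF c n(1)]] c f by simp
  qed
  have "p f \<noteq> {}" using p_mem[OF f] by blast
  then show ?thesis unfolding tensor_simps(4) by (rule SUP_eq_const[symmetric]) (rule *)
qed

lemma tensor_vectorspace: "vectorspace k T"
proof (rule vs_criteria[OF V.field_axioms])
  show "\<zero>\<^bsub>T\<^esub> \<in> carrier T" by (simp flip: p_zero)
  show "\<forall>v w. v \<in> carrier T \<and> w \<in> carrier T \<longrightarrow> v \<oplus>\<^bsub>T\<^esub> w \<in> carrier T"
    by (auto simp: carrier_tensor simp flip: p_add)
  show "\<forall>v\<in>carrier T. \<exists>w\<in>carrier T. v \<oplus>\<^bsub>T\<^esub> w = \<zero>\<^bsub>T\<^esub>"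
  proof
    fix v assume "v \<in> carrier T"
    then obtain f where f: "f \<in> carrier F" "v = p f" by (auto simp: carrier_tensor)
    then show "\<exists>w\<in>carrier T. v \<oplus>\<^bsub>T\<^esub> w = \<zero>\<^bsub>T\<^esub>"
      by (intro bexI[of _ "p (\<ominus>\<^bsub>F\<^esub> f)"]) (simp_all add: F.M.r_neg p_zero flip: p_add)
  qed
qed (auto simp: carrier_tensor F.M.a_ac F.smult_assoc1 F.smult_l_distr F.smult_r_distr
    simp flip: p_add p_smult p_zero)

lemma p_linear: "linear_map k F T p"
  by (rule linear_mapI) (simp_all add: tensor_vectorspace p_add p_smult F.vectorspace_axioms)

text \<open>The entry point of the relators: each bilinearity law of pure tensors below is one of
  the four relator families seen in the quotient.\<close>

lemma p_diff:
  assumes "f \<in> carrier F" "g \<in> carrier F" "f \<ominus>\<^bsub>F\<^esub> g \<in> tensor_relators k V W"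
  shows "p f = p g"
proof -
  have "p ((f \<ominus>\<^bsub>F\<^esub> g) \<oplus>\<^bsub>F\<^esub> g) = p g" using null_relator[OF assms(3)] assms(2) p_null by simp
  moreover have "(f \<ominus>\<^bsub>F\<^esub> g) \<oplus>\<^bsub>F\<^esub> g = f" using assms
    by (simp add: F.M.minus_eq F.M.a_assoc F.M.l_neg)
  ultimately show ?thesis by simp
qed

lemma tens_closed: "v \<in> carrier V \<Longrightarrow> w \<in> carrier W \<Longrightarrow> tens k V W v w \<in> carrier T"
  by (simp add: tens_tproj)

lemma tens_add_l: "\<lbrakk>v \<in> carrier V; v' \<in> carrier V; w \<in> carrier W\<rbrakk> \<Longrightarrow>
    tens k V W (v \<oplus>\<^bsub>V\<^esub> v') w = tens k V W v w \<oplus>\<^bsub>T\<^esub> tens k V W v' w"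
  unfolding tens_tproj
  by (subst p_add[symmetric], simp, simp, rule p_diff)
    (simp_all, unfold tensor_relators_def Let_def, blast)

lemma tens_add_r: "\<lbrakk>v \<in> carrier V; w \<in> carrier W; w' \<in> carrier W\<rbrakk> \<Longrightarrow>
    tens k V W v (w \<oplus>\<^bsub>W\<^esub> w') = tens k V W v w \<oplus>\<^bsub>T\<^esub> tens k V W v w'"
  unfolding tens_tproj
  by (subst p_add[symmetric], simp, simp, rule p_diff)
    (simp_all, unfold tensor_relators_def Let_def, blast)

lemma tens_smult_l: "\<lbrakk>c \<in> carrier k; v \<in> carrier V; w \<in> carrier W\<rbrakk> \<Longrightarrow>
    tens k V W (c \<odot>\<^bsub>V\<^esub> v) w = c \<odot>\<^bsub>T\<^esub> tens k V W v w"
  unfolding tens_tproj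
  by (subst p_smult[symmetric], simp, simp, rule p_diff)
    (simp_all, unfold tensor_relators_def Let_def, blast)

lemma tens_smult_r: "\<lbrakk>c \<in> carrier k; v \<in> carrier V; w \<in> carrier W\<rbrakk> \<Longrightarrow>
    tens k V W v (c \<odot>\<^bsub>W\<^esub> w) = c \<odot>\<^bsub>T\<^esub> tens k V W v w"
  unfolding tens_tproj
  by (subst p_smult[symmetric], simp, simp, rule p_diff)
    (simp_all, unfold tensor_relators_def Let_def, blast)

text \<open>Precomposing with the quotient map reduces equality on the tensor product to the free
  generators.\<close>

lemma tensor_ext:
  assumes f: "linear_map k T U f" and g: "linear_map k T U g"
    and eq: "\<And>v w. v \<in> carrier V \<Longrightarrow> w \<in> carrier W \<Longrightarrow> f (tens k V W v w) = g (tens k V W v w)"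
    and t: "t \<in> carrier T"
  shows "f t = g t"
proof -
  have comp: "linear_map k F U (\<lambda>h. f' (p h))" if f': "linear_map k T U f'" for f'
    by (rule linear_mapI)
      (simp_all add: linear_mapD[OF f'] linear_mapD[OF p_linear])
  obtain h where h: "h \<in> carrier F" "t = p h" using t by (auto simp: carrier_tensor)
  have "f (p h) = g (p h)"
    by (rule free_vs_ext[OF comp[OF f] comp[OF g] _ h(1)]) (use eq in \<open>auto simp: tens_tproj\<close>)
  then show ?thesis by (simp add: h)
qed

text \<open>Links \<open>tlift\<close> to the quotient: the representative it selects by
  \<open>SOME\<close> lies in the free space and projects back to the given tensor.\<close>

lemma choice_closed:
  assumes "t \<in> carrier T"
  shows "(SOME f. f \<in> t) \<in> carrier F" "p (SOME f. f \<in> t) = t"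
proof -
  obtain h where h: "h \<in> carrier F" "t = p h" using assms by (auto simp: carrier_tensor)
  have m: "(SOME f. f \<in> t) \<in> p h" unfolding h(2) using p_mem[OF h(1)] by (rule someI[of "\<lambda>f. f \<in> p h"])
  then obtain n where "n \<in> N" "(SOME f. f \<in> t) = n \<oplus>\<^bsub>F\<^esub> h" using p_memD[OF h(1)] by blast
  then show "(SOME f. f \<in> t) \<in> carrier F" using null_subset h(1) by (simp add: subset_iff)
  show "p (SOME f. f \<in> t) = t" using p_eq[OF h(1) m] h(2) by simp
qed

lemma choice_supp:
  assumes "t \<in> carrier T"
  shows "(SOME f. f \<in> t) x \<in> carrier k" "finite {x. (SOME f. f \<in> t) x \<noteq> \<zero>\<^bsub>k\<^esub>}"
    "(SOME f. f \<in> t) x \<noteq> \<zero>\<^bsub>k\<^esub> \<Longrightarrow> fst x \<in> carrier V"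
    "(SOME f. f \<in> t) x \<noteq> \<zero>\<^bsub>k\<^esub> \<Longrightarrow> snd x \<in> carrier W"
  using choice_closed(1)[OF assms] by (cases x; auto simp: V.free_vs_simps)+

end

lemma tlift_free_lift:
  "tlift k V W U t \<beta> = free_lift k U (\<lambda>x. \<beta> (fst x) (snd x)) (SOME f. f \<in> t)"
  by (simp add: tlift_def free_lift_def Let_def)

lemma bilinearI:
  assumes "\<And>v. v \<in> carrier V \<Longrightarrow> linear_map k W U (\<beta> v)"
    and "\<And>w. w \<in> carrier W \<Longrightarrow> linear_map k V U (\<lambda>v. \<beta> v w)"
  shows "bilinear k V W U \<beta>"
  using assms by (simp add: bilinear_def)

lemma bilinearD:
  assumes "bilinear k V W U \<beta>"
  shows "v \<in> carrier V \<Longrightarrow> linear_map k W U (\<beta> v)"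
    and "w \<in> carrier W \<Longrightarrow> linear_map k V U (\<lambda>v. \<beta> v w)"
    and "v \<in> carrier V \<Longrightarrow> w \<in> carrier W \<Longrightarrow> \<beta> v w \<in> carrier U"
  using assms linear_mapD(3)[of k W U "\<beta> v" w] by (auto simp: bilinear_def)

context tensor_pair
begin

text \<open>This makes \<open>tlift\<close> independent of the representative: a bilinear map kills
  the relators, hence the span that is factored out.\<close>

lemma free_lift_null:
  assumes U: "vectorspace k U"
    and bil: "bilinear k V W U \<beta>" and n: "n \<in> N"
  shows "free_lift k U (\<lambda>x. \<beta> (fst x) (snd x)) n = \<zero>\<^bsub>U\<^esub>"
proof -
  interpret U: vectorspace k U by fact
  let ?L = "free_lift k U (\<lambda>x. \<beta> (fst x) (snd x))"
  have bl: "linear_map k V U (\<lambda>v. \<beta> v w)" if "w \<in> carrier W" for w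
    using bil that by (simp add: bilinear_def)
  have br: "linear_map k W U (\<lambda>w. \<beta> v w)" if "v \<in> carrier V" for v
    using bil that by (simp add: bilinear_def)
  have L: "linear_map k F U ?L"
    by (rule free_lift_linear[OF U]) (use bilinearD(3)[OF bil] in auto)
  note LD = linear_mapD[OF L]
  have Lm: "?L (f \<ominus>\<^bsub>F\<^esub> g) = ?L f \<ominus>\<^bsub>U\<^esub> ?L g" if "f \<in> carrier F" "g \<in> carrier F" for f g
  proof -
    have "\<ominus>\<^bsub>F\<^esub> g = (\<ominus>\<^bsub>k\<^esub> \<one>\<^bsub>k\<^esub>) \<odot>\<^bsub>F\<^esub> g" using that by (simp add: F.smult_l_minus)
    then have "?L (\<ominus>\<^bsub>F\<^esub> g) = \<ominus>\<^bsub>U\<^esub> ?L g" using that by (simp add: LD U.smult_l_minus)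
    then show ?thesis using that by (simp add: F.M.minus_eq U.M.minus_eq LD)
  qed
  have Lz: "?L (f \<ominus>\<^bsub>F\<^esub> g) = \<zero>\<^bsub>U\<^esub>" if "?L f = ?L g" "f \<in> carrier F" "g \<in> carrier F" for f g
    using that LD(3)[of g] by (simp add: Lm U.M.r_neg U.M.minus_eq)
  have gen: "?L (free_gen k (v, w)) = \<beta> v w" if "v \<in> carrier V" "w \<in> carrier W" for v w
    using free_lift_gen[OF U, of "\<lambda>x. \<beta> (fst x) (snd x)" "(v, w)"] linear_mapD(3)[OF bl] that by simp
  have cl: "\<beta> v w \<in> carrier U" if "v \<in> carrier V" "w \<in> carrier W" for v w
    using linear_mapD(3)[OF bl] that by simp
  have rel: "?L x = \<zero>\<^bsub>U\<^esub>" if "x \<in> tensor_relators k V W" for x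
    using that unfolding tensor_relators_def Let_def
    by (elim UnE; clarify; intro Lz;
      simp add: LD gen cl linear_mapD(4,5)[OF bl] linear_mapD(4,5)[OF br])
  obtain a A where A: "finite A" "A \<subseteq> tensor_relators k V W" "a \<in> A \<rightarrow> carrier k" "n = F.lincomb a A"
    using n by (auto simp: tensor_null_def F.span_def)
  have "?L n = (\<Oplus>\<^bsub>U\<^esub>x\<in>A. ?L (a x \<odot>\<^bsub>F\<^esub> x))"
    unfolding A(4) F.lincomb_def
    by (rule linear_map_finsum[OF L]) (use A relators_subset in auto)
  also have "\<dots> = (\<Oplus>\<^bsub>U\<^esub>x\<in>A. \<zero>\<^bsub>U\<^esub>)"
    by (rule U.M.finsum_cong') (use A relators_subset rel in \<open>auto simp: LD(5) subset_iff Pi_iff\<close>)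
  finally show ?thesis by simp
qed

lemma tlift_p:
  assumes U: "vectorspace k U" and bil: "bilinear k V W U \<beta>" and h: "h \<in> carrier F"
  shows "tlift k V W U (p h) \<beta> = free_lift k U (\<lambda>x. \<beta> (fst x) (snd x)) h"
proof -
  interpret U: vectorspace k U by fact
  let ?g = "SOME f. f \<in> p h"
  have "?g \<in> p h" using p_mem[OF h] by (rule someI[of "\<lambda>f. f \<in> p h"])
  then obtain n where n: "n \<in> N" "?g = n \<oplus>\<^bsub>F\<^esub> h" using p_memD[OF h] by blast
  have L: "linear_map k F U (free_lift k U (\<lambda>x. \<beta> (fst x) (snd x)))"
    by (rule free_lift_linear[OF U]) (use bilinearD(3)[OF bil] in auto)
  show ?thesis
    unfolding tlift_free_lift n(2)
    using n h null_subset free_lift_null[OF U bil n(1)] linear_mapD(3)[OF L]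
    by (simp add: linear_mapD(4)[OF L] subset_iff)
qed

lemma tlift_tens:
  assumes U: "vectorspace k U" and bil: "bilinear k V W U \<beta>" and vw: "v \<in> carrier V" "w \<in> carrier W"
  shows "tlift k V W U (tens k V W v w) \<beta> = \<beta> v w"
  unfolding tens_tproj
  using tlift_p[OF U bil gen_closed[OF vw]] vw
    free_lift_gen[OF U, of "\<lambda>x. \<beta> (fst x) (snd x)" "(v, w)"]
  by (simp add: bilinearD(3)[OF bil])

lemma tlift_linear:
  assumes U: "vectorspace k U" and bil: "bilinear k V W U \<beta>"
  shows "linear_map k T U (\<lambda>t. tlift k V W U t \<beta>)"
proof -
  have L: "linear_map k F U (free_lift k U (\<lambda>x. \<beta> (fst x) (snd x)))"
    by (rule free_lift_linear[OF U]) (use bilinearD(3)[OF bil] in auto)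
  show ?thesis
    by (rule linear_mapI[OF tensor_vectorspace U])
      (auto simp: carrier_tensor tlift_p[OF U bil] linear_mapD[OF L] simp flip: p_add p_smult)
qed

lemma tlift_closed:
  assumes "vectorspace k U" "t \<in> carrier T"
    and "\<And>v w. v \<in> carrier V \<Longrightarrow> w \<in> carrier W \<Longrightarrow> \<beta> v w \<in> carrier U"
  shows "tlift k V W U t \<beta> \<in> carrier U"
proof -
  interpret U: vectorspace k U by fact
  show ?thesis unfolding tlift_def Let_def
    by (rule U.M.finsum_closed) (use assms(3) choice_supp[OF assms(2)] in simp)
qed

text \<open>Both sides use the same chosen representative, so a finite sum is mapped term by term.
  Only membership of the values in \<open>U\<close> is asked of the integrand, which keeps the
  rewrite rules built from this cheap to apply.\<close>

lemma tlift_comp: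
  assumes h: "linear_map k U U' h" and t: "t \<in> carrier T"
    and cl: "\<And>v w. v \<in> carrier V \<Longrightarrow> w \<in> carrier W \<Longrightarrow> \<beta> v w \<in> carrier U"
  shows "h (tlift k V W U t \<beta>) = tlift k V W U' t (\<lambda>v w. h (\<beta> v w))"
proof -
  interpret U: vectorspace k U by (rule linear_mapD[OF h])
  interpret U': vectorspace k U' by (rule linear_mapD[OF h])
  let ?f = "SOME f. f \<in> t"
  have f: "?f \<in> carrier F" by (rule choice_closed[OF t])
  then have fx: "?f (v, w) \<in> carrier k" "?f (v, w) \<noteq> \<zero>\<^bsub>k\<^esub> \<Longrightarrow> v \<in> carrier V \<and> w \<in> carrier W" for v w
    by (auto simp: V.free_vs_simps)
  have "h (tlift k V W U t \<beta>) = (\<Oplus>\<^bsub>U'\<^esub>x\<in>{x. ?f x \<noteq> \<zero>\<^bsub>k\<^esub>}. h (?f x \<odot>\<^bsub>U\<^esub> \<beta> (fst x) (snd x)))"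
    unfolding tlift_def Let_def
    by (rule linear_map_finsum[OF h]) (use fx cl in auto)
  also have "\<dots> = tlift k V W U' t (\<lambda>v w. h (\<beta> v w))"
    unfolding tlift_def Let_def
    by (rule U'.M.finsum_cong') (use fx cl in \<open>auto simp: linear_mapD(3,5)[OF h]\<close>)
  finally show ?thesis .
qed

lemma tlift_linear_param:
  assumes U: "vectorspace k U" and Z: "vectorspace k Z" and t: "t \<in> carrier T"
    and lin: "\<And>v w. v \<in> carrier V \<Longrightarrow> w \<in> carrier W \<Longrightarrow> linear_map k Z U (\<lambda>z. \<beta> z v w)"
  shows "linear_map k Z U (\<lambda>z. tlift k V W U t (\<beta> z))"
  unfolding tlift_def Let_def
  by (intro lin_finsum U Z lin_smult_r lin) (use choice_supp[OF t] in simp_all)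

end

section \<open>Rewrite rules for linearity and Sweedler sums\<close>

lemma tensor_pairI: "vectorspace k V \<Longrightarrow> vectorspace k W \<Longrightarrow> tensor_pair k V W"
  by (rule tensor_pair.intro)

lemmas vs_tensor [simp] = tensor_pair.tensor_vectorspace[OF tensor_pairI]
lemmas tens_closed [simp] = tensor_pair.tens_closed[OF tensor_pairI]
lemmas tensor_ext = tensor_pair.tensor_ext[OF tensor_pairI]

lemma tensor_ext_ball:
  assumes "vectorspace k V" "vectorspace k W"
    and "linear_map k (tensor k V W) U f" "linear_map k (tensor k V W) U g"
    and "\<And>v w. v \<in> carrier V \<Longrightarrow> w \<in> carrier W \<Longrightarrow> f (tens k V W v w) = g (tens k V W v w)"
  shows "\<forall>t\<in>carrier (tensor k V W). f t = g t"
  using tensor_ext[OF assms] by blast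

text \<open>As a congruence rule this hands the simplifier the membership of the Sweedler components in the
  carriers, so that the closure and linearity side conditions below the binder are solved by
  rewriting.\<close>

lemma tlift_cong [cong]:
  assumes "t = t'" "vectorspace k V" "vectorspace k W" "t' \<in> carrier (tensor k V W)"
    and "\<And>v w. v \<in> carrier V \<Longrightarrow> w \<in> carrier W \<Longrightarrow> \<beta> v w = \<gamma> v w"
  shows "tlift k V W U t \<beta> = tlift k V W U t' \<gamma>"
  unfolding tlift_def Let_def assms(1)
  by (rule finsum_eqI)
    (use tensor_pair.choice_supp[OF tensor_pairI[OF assms(2,3)] assms(4)] assms(5) in simp)

lemmas tlift_closed [simp] = tensor_pair.tlift_closed[OF tensor_pairI]
lemmas lin_tlift_param [simp] = tensor_pair.tlift_linear_param[OF tensor_pairI]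
lemmas tlift_comp = tensor_pair.tlift_comp[OF tensor_pairI, rotated 2]

lemma lin_id [simp]: "vectorspace k V \<Longrightarrow> linear_map k V V (\<lambda>v. v)"
  by (rule linear_mapI) auto

lemma lin_comp:
  assumes h: "linear_map k U W h" and f: "linear_map k Z U f"
  shows "linear_map k Z W (\<lambda>z. h (f z))"
  by (rule linear_mapI) (simp_all add: linear_mapD[OF h] linear_mapD[OF f])

lemma lin_tens_l [simp]:
  assumes f: "linear_map k Z V f" and W: "vectorspace k W" "w \<in> carrier W"
  shows "linear_map k Z (tensor k V W) (\<lambda>z. tens k V W (f z) w)"
proof -
  interpret tensor_pair k V W by (rule tensor_pairI[OF linear_mapD(2)[OF f] W(1)])
  show ?thesis
    by (rule linear_mapI)
      (use W in \<open>simp_all add: linear_mapD[OF f] tens_add_l tens_smult_l V.vectorspace_axioms\<close>)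
qed

lemma lin_tens_r [simp]:
  assumes f: "linear_map k Z W f" and V: "vectorspace k V" "v \<in> carrier V"
  shows "linear_map k Z (tensor k V W) (\<lambda>z. tens k V W v (f z))"
proof -
  interpret tensor_pair k V W by (rule tensor_pairI[OF V(1) linear_mapD(2)[OF f]])
  show ?thesis
    by (rule linear_mapI)
      (use V in \<open>simp_all add: linear_mapD[OF f] tens_add_r tens_smult_r W.vectorspace_axioms\<close>)
qed

text \<open>Here the tensor varies, and with it the chosen representative, so linearity rests on the
  bilinearity of the integrand. \<open>lin_tlift_param\<close> is the complementary case, a fixed
  tensor with an integrand depending linearly on a parameter.\<close>

lemma lin_tlift [simp]:
  assumes t: "linear_map k Z (tensor k V W) t" and V: "vectorspace k V" and W: "vectorspace k W"
    and l: "\<And>v. v \<in> carrier V \<Longrightarrow> linear_map k W U (\<beta> v)"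
    and r: "\<And>w. w \<in> carrier W \<Longrightarrow> linear_map k V U (\<lambda>v. \<beta> v w)"
  shows "linear_map k Z U (\<lambda>z. tlift k V W U (t z) \<beta>)"
proof -
  interpret tensor_pair k V W by (rule tensor_pairI[OF V W])
  have U: "vectorspace k U" using linear_mapD(2)[OF l[OF V.M.zero_closed]] .
  show ?thesis
    by (rule lin_comp[OF tlift_linear[OF U bilinearI] t]) (use l r in auto)
qed

lemma tlift_tens [simp]:
  assumes "v \<in> carrier V" "w \<in> carrier W" "vectorspace k V" "vectorspace k W"
    and l: "\<And>v. v \<in> carrier V \<Longrightarrow> linear_map k W U (\<beta> v)"
    and r: "\<And>w. w \<in> carrier W \<Longrightarrow> linear_map k V U (\<lambda>v. \<beta> v w)"
  shows "tlift k V W U (tens k V W v w) \<beta> = \<beta> v w"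
  by (rule tensor_pair.tlift_tens[OF tensor_pairI])
    (use assms linear_mapD(2)[OF l] in \<open>auto intro: bilinearI\<close>)

lemmas tlift_tlift = tlift_comp[OF lin_tlift[OF lin_id]]

lemmas tens_tlift_l = tlift_comp[OF lin_tens_l[OF lin_id]]

lemmas tens_tlift_r = tlift_comp[OF lin_tens_r[OF lin_id]]

text \<open>Normal form for nested Sweedler sums: a sum standing inside a pure tensor, or as the
  tensor argument of another sum, is moved outwards.\<close>

lemmas pull = tlift_tlift tens_tlift_l tens_tlift_r

lemma (in abelian_monoid) finsum_swap:
  assumes "finite A" "finite C" "\<And>x y. x \<in> A \<Longrightarrow> y \<in> C \<Longrightarrow> h x y \<in> carrier G"
  shows "(\<Oplus>x\<in>A. \<Oplus>y\<in>C. h x y) = (\<Oplus>y\<in>C. \<Oplus>x\<in>A. h x y)"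
  using assms
proof (induction A)
  case (insert a A)
  have "(\<Oplus>x\<in>insert a A. \<Oplus>y\<in>C. h x y) = (\<Oplus>y\<in>C. h a y) \<oplus> (\<Oplus>y\<in>C. \<Oplus>x\<in>A. h x y)"
    using insert by (simp add: Pi_iff)
  also have "\<dots> = (\<Oplus>y\<in>C. h a y \<oplus> (\<Oplus>x\<in>A. h x y))"
    by (rule finsum_addf[symmetric]) (use insert in \<open>auto intro!: finsum_closed\<close>)
  also have "\<dots> = (\<Oplus>y\<in>C. \<Oplus>x\<in>insert a A. h x y)"
    by (rule finsum_eqI, subst finsum_insert) (use insert in auto)
  finally show ?case .
qed simp

text \<open>Both sides are double sums over the same two representatives, so exchanging independent
  Sweedler sums is exchanging finite sums.\<close>

lemma tlift_swap:
  assumes vs: "vectorspace k V" "vectorspace k W" "vectorspace k A" "vectorspace k C" "vectorspace k U"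
    and t: "t \<in> carrier (tensor k V W)" and s: "s \<in> carrier (tensor k A C)"
    and cl: "\<And>v w a c. v \<in> carrier V \<Longrightarrow> w \<in> carrier W \<Longrightarrow> a \<in> carrier A \<Longrightarrow> c \<in> carrier C \<Longrightarrow>
      \<beta> v w a c \<in> carrier U"
  shows "tlift k V W U t (\<lambda>v w. tlift k A C U s (\<beta> v w)) =
    tlift k A C U s (\<lambda>a c. tlift k V W U t (\<lambda>v w. \<beta> v w a c))"
proof -
  interpret U: vectorspace k U by (rule vs)
  let ?f = "SOME f. f \<in> t" and ?g = "SOME g. g \<in> s"
  note f = tensor_pair.choice_supp[OF tensor_pairI[OF vs(1,2)] t]
  note g = tensor_pair.choice_supp[OF tensor_pairI[OF vs(3,4)] s]
  have fin: "c \<odot>\<^bsub>U\<^esub> finsum U u I = (\<Oplus>\<^bsub>U\<^esub>i\<in>I. c \<odot>\<^bsub>U\<^esub> u i)" if "c \<in> carrier k" "u \<in> I \<rightarrow> carrier U"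
    for c u and I :: "'z set"
    using U.finsum_smult[OF that] .
  let ?F = "{x. ?f x \<noteq> \<zero>\<^bsub>k\<^esub>}" and ?G = "{x. ?g x \<noteq> \<zero>\<^bsub>k\<^esub>}"
  let ?b = "\<lambda>x y. \<beta> (fst x) (snd x) (fst y) (snd y)"
  have b: "?b x y \<in> carrier U" if "x \<in> ?F" "y \<in> ?G" for x y
    using that f g cl by simp
  have "tlift k V W U t (\<lambda>v w. tlift k A C U s (\<beta> v w)) =
    (\<Oplus>\<^bsub>U\<^esub>x\<in>?F. \<Oplus>\<^bsub>U\<^esub>y\<in>?G. ?f x \<odot>\<^bsub>U\<^esub> (?g y \<odot>\<^bsub>U\<^esub> ?b x y))"
    unfolding tlift_def Let_def
    by (intro finsum_eqI U.finsum_smult) (use f(1) g(1) b in auto)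
  also have "\<dots> = (\<Oplus>\<^bsub>U\<^esub>y\<in>?G. \<Oplus>\<^bsub>U\<^esub>x\<in>?F. ?f x \<odot>\<^bsub>U\<^esub> (?g y \<odot>\<^bsub>U\<^esub> ?b x y))"
    by (rule U.M.finsum_swap) (use f(1,2) g(1,2) b in auto)
  \<comment> \<open>Commutativity of the field exchanges the two coefficients.\<close>
  also have "\<dots> = (\<Oplus>\<^bsub>U\<^esub>y\<in>?G. \<Oplus>\<^bsub>U\<^esub>x\<in>?F. ?g y \<odot>\<^bsub>U\<^esub> (?f x \<odot>\<^bsub>U\<^esub> ?b x y))"
    by (intro finsum_eqI) (use f(1) g(1) b in \<open>simp add: U.m_comm flip: U.smult_assoc1\<close>)
  also have "\<dots> = tlift k A C U s (\<lambda>a c. tlift k V W U t (\<lambda>v w. \<beta> v w a c))"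
    unfolding tlift_def Let_def
    by (intro finsum_eqI U.finsum_smult[symmetric]) (use f(1) g(1) b in auto)
  finally show ?thesis .
qed

section \<open>Bialgebras and antipodes\<close>

lemma tensor_smult_closed [simp]:
  "\<lbrakk>vectorspace k V; vectorspace k W; c \<in> carrier k; t \<in> carrier (tensor k V W)\<rbrakk>
    \<Longrightarrow> c \<odot>\<^bsub>tensor k V W\<^esub> t \<in> carrier (tensor k V W)"
  by (rule vs_smult_closed) simp_all

lemmas smult_tlift = tlift_comp[OF lin_smult_r[OF lin_id]]

lemma tens_smult_l:
  assumes "vectorspace k V" "vectorspace k W" "c \<in> carrier k" "v \<in> carrier V" "w \<in> carrier W"
  shows "tens k V W (c \<odot>\<^bsub>V\<^esub> v) w = c \<odot>\<^bsub>tensor k V W\<^esub> tens k V W v w"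
  by (rule tensor_pair.tens_smult_l[OF tensor_pairI]) fact+

lemma tens_smult_r:
  assumes "vectorspace k V" "vectorspace k W" "c \<in> carrier k" "v \<in> carrier V" "w \<in> carrier W"
  shows "tens k V W v (c \<odot>\<^bsub>W\<^esub> w) = c \<odot>\<^bsub>tensor k V W\<^esub> tens k V W v w"
  by (rule tensor_pair.tens_smult_r[OF tensor_pairI]) fact+

context k_algebra
begin

abbreviation amult (infixl "\<cdot>" 70) where "a \<cdot> b \<equiv> a \<otimes>\<^bsub>A\<^esub> b"

lemmas [simp] = vs vs_smult_closed[OF vs]

lemma mult_closed [simp]: "a \<in> carrier A \<Longrightarrow> b \<in> carrier A \<Longrightarrow> a \<cdot> b \<in> carrier A"
  by (rule ring.ring_simprules(5)[OF ring])

lemma unit_closed [simp]: "\<one>\<^bsub>A\<^esub> \<in> carrier A"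
  by (rule ring.ring_simprules(6)[OF ring])

lemma mult_one [simp]: "a \<in> carrier A \<Longrightarrow> \<one>\<^bsub>A\<^esub> \<cdot> a = a" "a \<in> carrier A \<Longrightarrow> a \<cdot> \<one>\<^bsub>A\<^esub> = a"
proof -
  interpret ring A by (rule ring)
  show "a \<in> carrier A \<Longrightarrow> \<one>\<^bsub>A\<^esub> \<cdot> a = a" "a \<in> carrier A \<Longrightarrow> a \<cdot> \<one>\<^bsub>A\<^esub> = a" by simp_all
qed

lemma mult_assoc: "a \<in> carrier A \<Longrightarrow> b \<in> carrier A \<Longrightarrow> c \<in> carrier A \<Longrightarrow>
    a \<cdot> b \<cdot> c = a \<cdot> (b \<cdot> c)"
  by (rule ring.ring_simprules(11)[OF ring])

lemma lin_mult_l [simp]: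
  assumes f: "linear_map k Z A f" and b: "b \<in> carrier A"
  shows "linear_map k Z A (\<lambda>z. f z \<cdot> b)"
proof -
  interpret ring A by (rule ring)
  show ?thesis
    by (rule linear_mapI) (use b in \<open>simp_all add: linear_mapD[OF f] l_distr smult_mult_l\<close>)
qed

lemma lin_mult_r [simp]:
  assumes f: "linear_map k Z A f" and b: "b \<in> carrier A"
  shows "linear_map k Z A (\<lambda>z. b \<cdot> f z)"
proof -
  interpret ring A by (rule ring)
  show ?thesis
    by (rule linear_mapI) (use b in \<open>simp_all add: linear_mapD[OF f] r_distr smult_mult_r\<close>)
qed

lemmas mult_tlift_l = tlift_comp[OF lin_mult_l[OF lin_id]]

lemmas mult_tlift_r = tlift_comp[OF lin_mult_r[OF lin_id]]

lemmas pull_alg = pull mult_tlift_l mult_tlift_r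

end

context bialgebra
begin

notation amult (infixl "\<cdot>" 70)

abbreviation "BB \<equiv> tensor k B B"

abbreviation sw where "sw U a \<beta> \<equiv> tlift k B B U (comult B a) \<beta>"

lemma comult_closed [simp]: "a \<in> carrier B \<Longrightarrow> comult B a \<in> carrier BB"
  by (rule linear_mapD(3)[OF comult_linear])

lemma counit_closed [simp]: "a \<in> carrier B \<Longrightarrow> counit B a \<in> carrier k"
  using linear_mapD(3)[OF counit_linear] by (simp add: scalars_def)

lemma lin_comult [simp]: "linear_map k Z B f \<Longrightarrow> linear_map k Z BB (\<lambda>z. comult B (f z))"
  by (rule lin_comp[OF comult_linear])

lemma lin_counit [simp]: "linear_map k Z B f \<Longrightarrow> linear_map k Z (scalars k) (\<lambda>z. counit B (f z))"
  by (rule lin_comp[OF counit_linear])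

lemmas comult_tlift = tlift_comp[OF comult_linear]

lemma sw_mult:
  assumes a: "a \<in> carrier B" "b \<in> carrier B"
    and l: "\<And>v. v \<in> carrier B \<Longrightarrow> linear_map k B U (\<beta> v)"
    and r: "\<And>w. w \<in> carrier B \<Longrightarrow> linear_map k B U (\<lambda>v. \<beta> v w)"
  shows "sw U (a \<cdot> b) \<beta> = sw U a (\<lambda>a1 a2. sw U b (\<lambda>b1 b2. \<beta> (a1 \<cdot> b1) (a2 \<cdot> b2)))"
proof -
  have [simp]: "vectorspace k U" using linear_mapD(2)[OF l[OF unit_closed]] .
  show ?thesis
    by (simp add: comult_mult pull assms)
qed

lemma sw_one:
  assumes l: "\<And>v. v \<in> carrier B \<Longrightarrow> linear_map k B U (\<beta> v)"
    and r: "\<And>w. w \<in> carrier B \<Longrightarrow> linear_map k B U (\<lambda>v. \<beta> v w)"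
  shows "sw U \<one>\<^bsub>B\<^esub> \<beta> = \<beta> \<one>\<^bsub>B\<^esub> \<one>\<^bsub>B\<^esub>"
  by (simp add: comult_one assms)

text \<open>The axiom compares two elements of a triple tensor product. Applying the linear map
  induced there by a trilinear \<open>\<beta>\<close> turns it into a rule for regrouping arbitrary
  integrands.\<close>

lemma sw_coassoc:
  assumes a: "a \<in> carrier B"
    and l1: "\<And>q r. q \<in> carrier B \<Longrightarrow> r \<in> carrier B \<Longrightarrow> linear_map k B U (\<lambda>p. \<beta> p q r)"
    and l2: "\<And>p r. p \<in> carrier B \<Longrightarrow> r \<in> carrier B \<Longrightarrow> linear_map k B U (\<lambda>q. \<beta> p q r)"
    and l3: "\<And>p q. p \<in> carrier B \<Longrightarrow> q \<in> carrier B \<Longrightarrow> linear_map k B U (\<lambda>r. \<beta> p q r)"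
  shows "sw U a (\<lambda>x r. sw U x (\<lambda>p q. \<beta> p q r)) = sw U a (\<lambda>p y. sw U y (\<lambda>q r. \<beta> p q r))"
proof -
  have [simp]: "vectorspace k U" using linear_mapD(2)[OF l1[OF unit_closed unit_closed]] .
  define L where "L = (\<lambda>t. tlift k B BB U t (\<lambda>p s. tlift k B B U s (\<lambda>q y. \<beta> p q y)))"
  have "L (sw (tensor k B BB) a (\<lambda>x y. sw (tensor k B BB) x (\<lambda>p q. tens k B BB p (tens k B B q y))))
     = L (sw (tensor k B BB) a (\<lambda>x y. tens k B BB x (comult B y)))"
    by (simp only: coassoc[OF a])
  then show ?thesis
    by (simp add: L_def pull a l1 l2 l3)
qed

lemma sw_counit_l:
  assumes a: "a \<in> carrier B" and f: "linear_map k B U f"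
  shows "sw U a (\<lambda>x y. counit B x \<odot>\<^bsub>U\<^esub> f y) = f a"
proof -
  have "f (sw B a (\<lambda>x y. counit B x \<odot>\<^bsub>B\<^esub> y)) = f a" by (simp only: counit_l[OF a])
  moreover have "f (sw B a (\<lambda>x y. counit B x \<odot>\<^bsub>B\<^esub> y)) = sw U a (\<lambda>x y. f (counit B x \<odot>\<^bsub>B\<^esub> y))"
    by (rule tlift_comp[OF f]) (use a in simp_all)
  ultimately show ?thesis using a by (simp add: linear_mapD(5)[OF f])
qed

lemma sw_counit_r:
  assumes a: "a \<in> carrier B" and f: "linear_map k B U f"
  shows "sw U a (\<lambda>x y. counit B y \<odot>\<^bsub>U\<^esub> f x) = f a"
proof -
  have "f (sw B a (\<lambda>x y. counit B y \<odot>\<^bsub>B\<^esub> x)) = f a" by (simp only: counit_r[OF a])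
  moreover have "f (sw B a (\<lambda>x y. counit B y \<odot>\<^bsub>B\<^esub> x)) = sw U a (\<lambda>x y. f (counit B y \<odot>\<^bsub>B\<^esub> x))"
    by (rule tlift_comp[OF f]) (use a in simp_all)
  ultimately show ?thesis using a by (simp add: linear_mapD(5)[OF f])
qed

end

section \<open>Convolution inverses and the product on the tensor square\<close>

context bialgebra
begin

text \<open>In the convolution algebra of linear maps from \<open>B\<close> to \<open>A\<close>, a
  left inverse \<open>f\<close> and a right inverse \<open>h\<close> of \<open>g\<close> agree, by
  \<open>f = f * (g * h) = (f * g) * h = h\<close>. The product is a parameter \<open>\<mu>\<close>
  because the tensor square, to which this is applied, leaves the product of its record
  undefined.\<close>

lemma convolution_unique:
  assumes A [simp]: "vectorspace k A" and u: "u \<in> carrier A"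
    and bil: "bilinear k A A A \<mu>"
    and assoc: "\<And>x y z. x \<in> carrier A \<Longrightarrow> y \<in> carrier A \<Longrightarrow> z \<in> carrier A \<Longrightarrow> \<mu> (\<mu> x y) z = \<mu> x (\<mu> y z)"
    and unit: "\<And>x. x \<in> carrier A \<Longrightarrow> \<mu> u x = x" "\<And>x. x \<in> carrier A \<Longrightarrow> \<mu> x u = x"
    and f: "linear_map k B A f" and g: "linear_map k B A g" and h: "linear_map k B A h"
    and fg: "\<And>a. a \<in> carrier B \<Longrightarrow> sw A a (\<lambda>x y. \<mu> (f x) (g y)) = counit B a \<odot>\<^bsub>A\<^esub> u"
    and gh: "\<And>a. a \<in> carrier B \<Longrightarrow> sw A a (\<lambda>x y. \<mu> (g x) (h y)) = counit B a \<odot>\<^bsub>A\<^esub> u"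
    and a: "a \<in> carrier B"
  shows "f a = h a"
proof -
  have l [simp]: "linear_map k Z A (\<lambda>z. \<mu> (F z) b)" if "linear_map k Z A F" "b \<in> carrier A" for Z F b
    using lin_comp[OF bilinearD(2)[OF bil that(2)] that(1)] .
  have r [simp]: "linear_map k Z A (\<lambda>z. \<mu> b (F z))" if "linear_map k Z A F" "b \<in> carrier A" for Z F b
    using lin_comp[OF bilinearD(1)[OF bil that(2)] that(1)] .
  have [simp]: "\<mu> x y \<in> carrier A" if "x \<in> carrier A" "y \<in> carrier A" for x y
    using bilinearD(3)[OF bil] that .
  note [simp] = linear_mapD(3)[OF f] linear_mapD(3)[OF g] linear_mapD(3)[OF h] u
    lin_comp[OF f] lin_comp[OF g] lin_comp[OF h] a vs_smult_closed[OF A]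
  have sm: "\<mu> x (c \<odot>\<^bsub>A\<^esub> u) = c \<odot>\<^bsub>A\<^esub> x" "\<mu> (c \<odot>\<^bsub>A\<^esub> u) x = c \<odot>\<^bsub>A\<^esub> x"
    if "c \<in> carrier k" "x \<in> carrier A" for c x
    using linear_mapD(5)[OF bilinearD(1)[OF bil that(2)] that(1) u]
      linear_mapD(5)[OF bilinearD(2)[OF bil that(2)] that(1) u] that by (simp_all add: unit)
  have pr: "\<mu> z (sw A y \<beta>) = sw A y (\<lambda>p q. \<mu> z (\<beta> p q))"
    if "z \<in> carrier A" "y \<in> carrier B"
      "\<And>p q. p \<in> carrier B \<Longrightarrow> q \<in> carrier B \<Longrightarrow> \<beta> p q \<in> carrier A" for z y \<beta>
    by (rule tlift_comp[where h = "\<mu> z"]) (use that in simp_all)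
  have pl: "\<mu> (sw A y \<beta>) z = sw A y (\<lambda>p q. \<mu> (\<beta> p q) z)"
    if "z \<in> carrier A" "y \<in> carrier B"
      "\<And>p q. p \<in> carrier B \<Longrightarrow> q \<in> carrier B \<Longrightarrow> \<beta> p q \<in> carrier A" for z y \<beta>
    by (rule tlift_comp[where h = "\<lambda>s. \<mu> s z"]) (use that in simp_all)
  have "f a = sw A a (\<lambda>x y. counit B y \<odot>\<^bsub>A\<^esub> f x)"
    by (rule sw_counit_r[OF a f, symmetric])
  also have "\<dots> = sw A a (\<lambda>x y. \<mu> (f x) (sw A y (\<lambda>p q. \<mu> (g p) (h q))))"
    by (simp add: gh sm)
  also have "\<dots> = sw A a (\<lambda>x y. sw A y (\<lambda>p q. \<mu> (f x) (\<mu> (g p) (h q))))"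
    by (simp add: pr)
  also have "\<dots> = sw A a (\<lambda>x y. sw A x (\<lambda>p q. \<mu> (f p) (\<mu> (g q) (h y))))"
    by (rule sw_coassoc[symmetric]) simp_all
  also have "\<dots> = sw A a (\<lambda>x y. \<mu> (sw A x (\<lambda>p q. \<mu> (f p) (g q))) (h y))"
    by (simp add: pl assoc)
  also have "\<dots> = sw A a (\<lambda>x y. counit B x \<odot>\<^bsub>A\<^esub> h y)"
    by (simp add: fg sm)
  also have "\<dots> = h a"
    by (rule sw_counit_l[OF a h])
  finally show ?thesis .
qed

definition mult2 where
  "mult2 s t = tlift k B B BB s (\<lambda>a b. tlift k B B BB t (\<lambda>c d. tens k B B (a \<cdot> c) (b \<cdot> d)))"

lemma mult2_closed [simp]: "s \<in> carrier BB \<Longrightarrow> t \<in> carrier BB \<Longrightarrow> mult2 s t \<in> carrier BB"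
  by (simp add: mult2_def)

lemma lin_mult2_l [simp]: "linear_map k Z BB f \<Longrightarrow> t \<in> carrier BB \<Longrightarrow> linear_map k Z BB (\<lambda>z. mult2 (f z) t)"
  by (simp add: mult2_def)

lemma lin_mult2_r [simp]: "linear_map k Z BB f \<Longrightarrow> t \<in> carrier BB \<Longrightarrow> linear_map k Z BB (\<lambda>z. mult2 t (f z))"
  by (simp add: mult2_def linear_mapD(1))

lemma mult2_tens [simp]:
  "\<lbrakk>a \<in> carrier B; b \<in> carrier B; c \<in> carrier B; d \<in> carrier B\<rbrakk> \<Longrightarrow>
    mult2 (tens k B B a b) (tens k B B c d) = tens k B B (a \<cdot> c) (b \<cdot> d)"
  by (simp add: mult2_def)

text \<open>Extensionality on pure tensors handles one argument at a time; generality is gained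
  first in \<open>t\<close>, then in \<open>s\<close>, then in \<open>r\<close>.\<close>

lemma mult2_assoc:
  assumes "r \<in> carrier BB" "s \<in> carrier BB" "t \<in> carrier BB"
  shows "mult2 (mult2 r s) t = mult2 r (mult2 s t)"
proof -
  have 1: "\<forall>t\<in>carrier BB. mult2 (mult2 (tens k B B a b) (tens k B B c d)) t
      = mult2 (tens k B B a b) (mult2 (tens k B B c d) t)"
    if "a \<in> carrier B" "b \<in> carrier B" "c \<in> carrier B" "d \<in> carrier B" for a b c d
    by (rule tensor_ext_ball[where U = BB]) (use that in \<open>simp_all add: mult_assoc\<close>)
  have 2: "\<forall>s\<in>carrier BB. mult2 (mult2 (tens k B B a b) s) t = mult2 (tens k B B a b) (mult2 s t)"
    if "a \<in> carrier B" "b \<in> carrier B" "t \<in> carrier BB" for a b t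
    by (rule tensor_ext_ball[where U = BB]) (use that 1 in \<open>simp_all del: mult2_tens\<close>)
  have "\<forall>r\<in>carrier BB. mult2 (mult2 r s) t = mult2 r (mult2 s t)"
    by (rule tensor_ext_ball[where U = BB]) (use assms 2 in simp_all)
  then show ?thesis using assms by blast
qed

lemma mult2_one:
  assumes "s \<in> carrier BB"
  shows "mult2 (tens k B B \<one>\<^bsub>B\<^esub> \<one>\<^bsub>B\<^esub>) s = s" "mult2 s (tens k B B \<one>\<^bsub>B\<^esub> \<one>\<^bsub>B\<^esub>) = s"
proof -
  have "\<forall>s\<in>carrier BB. mult2 (tens k B B \<one>\<^bsub>B\<^esub> \<one>\<^bsub>B\<^esub>) s = s"
    by (rule tensor_ext_ball[where U = BB]) simp_all
  moreover have "\<forall>s\<in>carrier BB. mult2 s (tens k B B \<one>\<^bsub>B\<^esub> \<one>\<^bsub>B\<^esub>) = s"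
    by (rule tensor_ext_ball[where U = BB]) simp_all
  ultimately show "mult2 (tens k B B \<one>\<^bsub>B\<^esub> \<one>\<^bsub>B\<^esub>) s = s" "mult2 s (tens k B B \<one>\<^bsub>B\<^esub> \<one>\<^bsub>B\<^esub>) = s"
    using assms by blast+
qed

lemma comult_mult2: "a \<in> carrier B \<Longrightarrow> b \<in> carrier B \<Longrightarrow>
    comult B (a \<cdot> b) = mult2 (comult B a) (comult B b)"
  by (simp add: comult_mult mult2_def)

end

section \<open>The antipode reverses products and coproducts\<close>

context hopf_algebra
begin

notation amult (infixl "\<cdot>" 70)

lemma S_closed [simp]: "a \<in> carrier B \<Longrightarrow> S a \<in> carrier B"
  by (rule linear_mapD(3)[OF antipode_linear])

lemma lin_S [simp]: "linear_map k Z B f \<Longrightarrow> linear_map k Z B (\<lambda>z. S (f z))"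
  by (rule lin_comp[OF antipode_linear])

lemmas S_tlift = tlift_comp[OF antipode_linear]

text \<open>Both sides are obtained by evaluating \<open>S(a\<^sub>1 b\<^sub>1) a\<^sub>2 b\<^sub>2 S(b\<^sub>3) S(a\<^sub>3)\<close>.\<close>

lemma S_mult:
  assumes [simp]: "a \<in> carrier B" "b \<in> carrier B"
  shows "S (a \<cdot> b) = S b \<cdot> S a"
proof -
  let ?m = "\<lambda>x y. x \<cdot> y"
  define T where "T = (\<lambda>p q r p' q' r'. S (?m p p') \<cdot> (?m q q' \<cdot> (S r' \<cdot> S r)))"
  have in1: "sw B y' (\<lambda>q' r'. ?m q q' \<cdot> (S r' \<cdot> S r)) = counit B y' \<odot>\<^bsub>B\<^esub> (q \<cdot> S r)"
    if "y' \<in> carrier B" "q \<in> carrier B" "r \<in> carrier B" for y' q r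
  proof -
    have "sw B y' (\<lambda>q' r'. ?m q q' \<cdot> (S r' \<cdot> S r)) = q \<cdot> (sw B y' (\<lambda>q' r'. q' \<cdot> S r') \<cdot> S r)"
      using that by (simp add: pull_alg mult_assoc)
    then show ?thesis using that by (simp add: antipode_r smult_mult_l smult_mult_r)
  qed
  have in2: "sw B y (\<lambda>q r. sw B y' (\<lambda>q' r'. ?m q q' \<cdot> (S r' \<cdot> S r)))
      = counit B y' \<odot>\<^bsub>B\<^esub> (counit B y \<odot>\<^bsub>B\<^esub> \<one>\<^bsub>B\<^esub>)"
    if "y \<in> carrier B" "y' \<in> carrier B" for y y'
    using that by (simp add: in1 antipode_r flip: smult_tlift)
  have in3: "sw B x (\<lambda>p q. sw B x' (\<lambda>p' q'. S (?m p p') \<cdot> ?m q q')) = counit B (x \<cdot> x') \<odot>\<^bsub>B\<^esub> \<one>\<^bsub>B\<^esub>"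
    if "x \<in> carrier B" "x' \<in> carrier B" for x x'
    using antipode_l[of "x \<cdot> x'"] that by (simp add: sw_mult)
  have co: "sw B b (\<lambda>p' y'. sw B y' (\<lambda>q' r'. T p q r p' q' r')) = sw B b (\<lambda>x' r'. sw B x' (\<lambda>p' q'. T p q r p' q' r'))"
    if "p \<in> carrier B" "q \<in> carrier B" "r \<in> carrier B" for p q r
    unfolding T_def by (rule sw_coassoc[symmetric]) (use that in simp_all)
  have [simp]: "T p q r p' q' r' \<in> carrier B"
    if "p \<in> carrier B" "q \<in> carrier B" "r \<in> carrier B" "p' \<in> carrier B" "q' \<in> carrier B" "r' \<in> carrier B"
    for p q r p' q' r'
    using that by (simp add: T_def)
  \<comment> \<open>Counits are split off from \<open>a\<close> and \<open>b\<close> so that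
    \<open>in2\<close> can replace them by the cancelling product of the second and third
    components.\<close>
  have "S (a \<cdot> b) = sw B a (\<lambda>p y. counit B y \<odot>\<^bsub>B\<^esub> S (?m p b))"
    by (rule sw_counit_r[symmetric]) simp_all
  also have "\<dots> = sw B a (\<lambda>p y. sw B b (\<lambda>p' y'. counit B y' \<odot>\<^bsub>B\<^esub> (counit B y \<odot>\<^bsub>B\<^esub> S (?m p p'))))"
    by (rule tlift_cong, simp_all, rule sw_counit_r[symmetric], simp_all)
  also have "\<dots> = sw B a (\<lambda>p y. sw B b (\<lambda>p' y'. S (?m p p') \<cdot>
      sw B y (\<lambda>q r. sw B y' (\<lambda>q' r'. ?m q q' \<cdot> (S r' \<cdot> S r)))))"
    by (simp add: in2 smult_mult_r)
  also have "\<dots> = sw B a (\<lambda>p y. sw B b (\<lambda>p' y'. sw B y (\<lambda>q r. sw B y' (\<lambda>q' r'. T p q r p' q' r'))))"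
    by (simp add: pull_alg T_def)
  also have "\<dots> = sw B a (\<lambda>p y. sw B y (\<lambda>q r. sw B b (\<lambda>p' y'. sw B y' (\<lambda>q' r'. T p q r p' q' r'))))"
    unfolding T_def by (rule tlift_cong, simp_all, rule tlift_swap, simp_all)
  also have "\<dots> = sw B a (\<lambda>p y. sw B y (\<lambda>q r. sw B b (\<lambda>x' r'. sw B x' (\<lambda>p' q'. T p q r p' q' r'))))"
    by (simp add: co)
  also have "\<dots> = sw B a (\<lambda>x r. sw B x (\<lambda>p q. sw B b (\<lambda>x' r'. sw B x' (\<lambda>p' q'. T p q r p' q' r'))))"
    unfolding T_def by (rule sw_coassoc[symmetric], simp_all)
  also have "\<dots> = sw B a (\<lambda>x r. sw B b (\<lambda>x' r'. sw B x (\<lambda>p q. sw B x' (\<lambda>p' q'. T p q r p' q' r'))))"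
    unfolding T_def by (rule tlift_cong, simp_all, rule tlift_swap, simp_all)
  also have "\<dots> = sw B a (\<lambda>x r. sw B b (\<lambda>x' r'.
      sw B x (\<lambda>p q. sw B x' (\<lambda>p' q'. S (?m p p') \<cdot> ?m q q')) \<cdot> (S r' \<cdot> S r)))"
    by (simp add: pull_alg T_def mult_assoc)
  also have "\<dots> = sw B a (\<lambda>x r. sw B b (\<lambda>x' r'. counit B x \<odot>\<^bsub>B\<^esub> (counit B x' \<odot>\<^bsub>B\<^esub> (S r' \<cdot> S r))))"
  proof -
    interpret vectorspace k B by (rule vs)
    show ?thesis by (simp add: in3 smult_mult_l counit_mult smult_assoc1)
  qed
  also have "\<dots> = sw B a (\<lambda>x r. counit B x \<odot>\<^bsub>B\<^esub> (S b \<cdot> S r))"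
    by (simp add: sw_counit_l flip: smult_tlift)
  also have "\<dots> = S b \<cdot> S a"
    by (rule sw_counit_l, simp_all)
  finally show ?thesis .
qed

text \<open>Apply the counit to \<open>S(a1) a2\<close>; multiplicativity and the counit axiom
  reduce the result to the counit of \<open>S a\<close>.\<close>

lemma counit_S:
  assumes [simp]: "a \<in> carrier B"
  shows "counit B (S a) = counit B a"
proof -
  interpret vectorspace k B by (rule vs)
  have "counit B (sw B a (\<lambda>x y. S x \<cdot> y)) = sw (scalars k) a (\<lambda>x y. counit B (S x \<cdot> y))"
    by (rule tlift_comp[OF counit_linear]) simp_all
  also have "\<dots> = sw (scalars k) a (\<lambda>x y. counit B y \<odot>\<^bsub>scalars k\<^esub> counit B (S x))"
    by (simp add: counit_mult scalars_def m_comm cong: tlift_cong)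
  also have "\<dots> = counit B (S a)"
    by (rule sw_counit_r) simp_all
  finally show ?thesis
    using linear_mapD(5)[OF counit_linear, of "counit B a" "\<one>\<^bsub>B\<^esub>"]
    by (simp add: antipode_l counit_one scalars_def)
qed

text \<open>Both sides are convolution inverse to the comultiplication.\<close>

lemma comult_S:
  assumes [simp]: "a \<in> carrier B"
  shows "comult B (S a) = sw BB a (\<lambda>x y. tens k B B (S y) (S x))"
proof (rule convolution_unique[where A = BB and \<mu> = mult2 and u = "tens k B B \<one>\<^bsub>B\<^esub> \<one>\<^bsub>B\<^esub>"
      and f = "\<lambda>a. comult B (S a)" and g = "comult B" and h = "\<lambda>a. sw BB a (\<lambda>x y. tens k B B (S y) (S x))"])
  show "bilinear k BB BB BB mult2"
    by (rule bilinearI) simp_all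
next
  fix a assume [simp]: "a \<in> carrier B"
  have "sw BB a (\<lambda>x y. mult2 (comult B (S x)) (comult B y)) = comult B (sw B a (\<lambda>x y. S x \<cdot> y))"
    by (simp add: comult_tlift comult_mult2)
  then show "sw BB a (\<lambda>x y. mult2 (comult B (S x)) (comult B y))
      = counit B a \<odot>\<^bsub>BB\<^esub> tens k B B \<one>\<^bsub>B\<^esub> \<one>\<^bsub>B\<^esub>"
    by (simp add: antipode_l linear_mapD(5)[OF comult_linear] comult_one)
next
  fix a assume [simp]: "a \<in> carrier B"
  \<comment> \<open>Of \<open>a1 S(a4) \<otimes> a2 S(a3)\<close> the inner product in the second
    factor cancels first, which leaves \<open>a1 S(a2) \<otimes> 1\<close>.\<close>
  have in1: "sw BB z (\<lambda>x2 y. sw BB y (\<lambda>p q. tens k B B (x1 \<cdot> S q) (x2 \<cdot> S p)))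
     = tens k B B (x1 \<cdot> S z) \<one>\<^bsub>B\<^esub>"
    if [simp]: "z \<in> carrier B" "x1 \<in> carrier B" for x1 z
  proof -
    have "sw BB z (\<lambda>x2 y. sw BB y (\<lambda>p q. tens k B B (x1 \<cdot> S q) (x2 \<cdot> S p)))
      = sw BB z (\<lambda>y q. sw BB y (\<lambda>x2 p. tens k B B (x1 \<cdot> S q) (x2 \<cdot> S p)))"
      by (rule sw_coassoc[symmetric]) simp_all
    also have "\<dots> = sw BB z (\<lambda>y q. tens k B B (x1 \<cdot> S q) (sw B y (\<lambda>x2 p. x2 \<cdot> S p)))"
      by (simp add: pull)
    also have "\<dots> = sw BB z (\<lambda>y q. counit B y \<odot>\<^bsub>BB\<^esub> tens k B B (x1 \<cdot> S q) \<one>\<^bsub>B\<^esub>)"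
      by (simp add: antipode_r tens_smult_r)
    also have "\<dots> = tens k B B (x1 \<cdot> S z) \<one>\<^bsub>B\<^esub>"
      by (rule sw_counit_l) simp_all
    finally show ?thesis .
  qed
  have "sw BB a (\<lambda>x y. mult2 (comult B x) (sw BB y (\<lambda>p q. tens k B B (S q) (S p))))
    = sw BB a (\<lambda>x y. sw BB x (\<lambda>x1 x2. sw BB y (\<lambda>p q. tens k B B (x1 \<cdot> S q) (x2 \<cdot> S p))))"
    by (simp add: mult2_def pull)
  also have "\<dots> = sw BB a (\<lambda>x1 z. sw BB z (\<lambda>x2 y. sw BB y (\<lambda>p q. tens k B B (x1 \<cdot> S q) (x2 \<cdot> S p))))"
    by (rule sw_coassoc) simp_all
  also have "\<dots> = tens k B B (sw B a (\<lambda>x1 z. x1 \<cdot> S z)) \<one>\<^bsub>B\<^esub>"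
    by (simp add: in1 pull)
  finally show "sw BB a (\<lambda>x y. mult2 (comult B x) (sw BB y (\<lambda>p q. tens k B B (S q) (S p))))
      = counit B a \<odot>\<^bsub>BB\<^esub> tens k B B \<one>\<^bsub>B\<^esub> \<one>\<^bsub>B\<^esub>"
    by (simp add: antipode_r tens_smult_l)
qed (simp_all add: mult2_assoc mult2_one comult_linear)

lemma sw_S:
  assumes [simp]: "a \<in> carrier B"
    and l: "\<And>v. v \<in> carrier B \<Longrightarrow> linear_map k B U (\<beta> v)"
    and r: "\<And>w. w \<in> carrier B \<Longrightarrow> linear_map k B U (\<lambda>v. \<beta> v w)"
  shows "sw U (S a) \<beta> = sw U a (\<lambda>x y. \<beta> (S y) (S x))"
proof -
  have [simp]: "vectorspace k U" using linear_mapD(2)[OF l[OF unit_closed]] .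
  show ?thesis by (simp add: comult_S pull l r)
qed

end

section \<open>The co-opposite bialgebra\<close>

text \<open>Generated bimodules and the co-opposite carry the vector space structure of a tensor product or
  of \<open>B\<close>, but are different records; this relation transfers the linear notions between them.\<close>

definition same_vs ::
  "('k, 'v, 'p) module_scheme \<Rightarrow> ('k, 'v, 'q) module_scheme \<Rightarrow> bool" where
  "same_vs M N \<longleftrightarrow> carrier M = carrier N \<and> zero M = zero N \<and> add M = add N \<and> smult M = smult N"

lemma same_vs_vectorspace: "same_vs M N \<Longrightarrow> vectorspace k M = vectorspace k N"
  by (simp add: same_vs_def vectorspace_def module_def module_axioms_def abelian_group_def
      abelian_monoid_def abelian_group_axioms_def comm_monoid_def comm_monoid_axioms_def monoid_def
      comm_group_def group_def group_axioms_def Units_def)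

lemma same_vs_linear_map_l:
  assumes "same_vs M N"
  shows "linear_map k M = linear_map k N"
proof (intro ext)
  fix U :: "('b, 'e, 'f) module_scheme" and f
  show "linear_map k M U f = linear_map k N U f"
    using assms same_vs_vectorspace[OF assms, of k]
    by (auto simp: same_vs_def linear_map_def mod_hom_def mod_hom_axioms_def module_hom_def vectorspace_def)
qed

lemma same_vs_linear_map_r:
  assumes "same_vs M N"
  shows "linear_map k U M = linear_map k U N"
proof (intro ext)
  fix f
  show "linear_map k U M f = linear_map k U N f"
    using assms same_vs_vectorspace[OF assms, of k]
    by (auto simp: same_vs_def linear_map_def mod_hom_def mod_hom_axioms_def module_hom_def vectorspace_def)
qed

text \<open>Literal equality, since the construction reads only the carrier, addition and scalar
  multiplication. Expressions over the co-opposite or over a generated bimodule can then be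
  rewritten to the plain tensor product.\<close>

lemma tensor_cong_vs:
  assumes "same_vs V V'" "same_vs W W'"
  shows "tensor k V W = tensor k V' W'" "tens k V W = tens k V' W'"
proof -
  have n: "tensor_null k V W = tensor_null k V' W'"
    using assms by (simp add: tensor_null_def tensor_relators_def same_vs_def)
  then show "tensor k V W = tensor k V' W'"
    using assms by (simp add: tensor_def same_vs_def)
  show "tens k V W = tens k V' W'"
    using n assms by (intro ext) (simp add: tens_def same_vs_def)
qed

lemma same_vs_refl [simp]: "same_vs M M"
  by (simp add: same_vs_def)

text \<open>The sum uses the operations of the target and a representative supplied by the tensor,
  so the source records can be exchanged freely.\<close>

lemma tlift_cong_vs:
  assumes "same_vs U U'"
  shows "tlift k V W U = tlift k V' W' U'"
  using assms by (intro ext) (simp add: tlift_def Let_def finsum_def finprod_def same_vs_def comp_def)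

lemma bilinear_cong_vs:
  assumes "same_vs V V'" "same_vs W W'" "same_vs U U'"
  shows "bilinear k V W U \<beta> = bilinear k V' W' U' \<beta>"
  unfolding bilinear_def same_vs_linear_map_l[OF assms(1)] same_vs_linear_map_l[OF assms(2)]
    same_vs_linear_map_r[OF assms(3)]
  using assms by (simp add: same_vs_def fun_eq_iff)

lemma cop_simps [simp]:
  "carrier (cop k B) = carrier B" "mult (cop k B) = mult B" "one (cop k B) = one B"
  "zero (cop k B) = zero B" "add (cop k B) = add B" "smult (cop k B) = smult B"
  "counit (cop k B) = counit B"
  by (simp_all add: cop_def)

lemma same_vs_cop: "same_vs (cop k B) B"
  by (simp add: same_vs_def)

lemmas cop_norm =
  tensor_cong_vs[OF same_vs_cop same_vs_cop] tensor_cong_vs[OF same_vs_cop same_vs_refl]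
  tensor_cong_vs[OF same_vs_refl same_vs_cop]
  same_vs_vectorspace[OF same_vs_cop] same_vs_linear_map_l[OF same_vs_cop]
  same_vs_linear_map_r[OF same_vs_cop]

lemma tlift_cop:
  "tlift k (cop k B) (cop k B) U = tlift k B B U"
  "tlift k (cop k B) W U = tlift k B W U" "tlift k V (cop k B) U = tlift k V B U"
  "tlift k V W (cop k B) = tlift k V W B"
  by (rule tlift_cong_vs, simp add: same_vs_cop)+

lemma ring_cong:
  assumes "same_vs A A'" "mult A = mult A'" "one A = one A'"
  shows "ring A = ring A'"
proof -
  have e: "carrier A = carrier A'" "zero A = zero A'" "add A = add A'" "mult A = mult A'" "one A = one A'"
    using assms by (simp_all add: same_vs_def)
  show ?thesis
    unfolding ring_def ring_axioms_def abelian_group_def abelian_monoid_def abelian_group_axioms_def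
      comm_monoid_def comm_monoid_axioms_def monoid_def comm_group_def group_def group_axioms_def Units_def
    by (simp only: e partial_object.select_convs monoid.select_convs)
qed

lemma k_algebra_cong:
  assumes "same_vs A A'" "mult A = mult A'" "one A = one A'"
  shows "k_algebra k A = k_algebra k A'"
proof -
  have e: "carrier A = carrier A'" "smult A = smult A'" "mult A = mult A'"
    using assms by (simp_all add: same_vs_def)
  show ?thesis
    by (simp only: k_algebra_def same_vs_vectorspace[OF assms(1)] ring_cong[OF assms] e)
qed

lemma flip_linear:
  assumes "vectorspace k V" "vectorspace k W"
  shows "linear_map k (tensor k V W) (tensor k W V) (flip k V W)"
  unfolding flip_def using assms by simp

lemma lin_flip [simp]:
  "\<lbrakk>vectorspace k V; vectorspace k W; linear_map k Z (tensor k V W) f\<rbrakk> \<Longrightarrow>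
    linear_map k Z (tensor k W V) (\<lambda>z. flip k V W (f z))"
  by (rule lin_comp[OF flip_linear])

lemma flip_closed [simp]:
  "\<lbrakk>vectorspace k V; vectorspace k W; t \<in> carrier (tensor k V W)\<rbrakk> \<Longrightarrow> flip k V W t \<in> carrier (tensor k W V)"
  by (rule linear_mapD(3)[OF flip_linear])

text \<open>Flipping a tensor amounts to swapping the arguments of the integrand; this reduces
  Sweedler sums over the co-opposite to sums over \<open>B\<close>.\<close>

lemma tlift_flip:
  assumes "vectorspace k V" "vectorspace k W" "t \<in> carrier (tensor k V W)"
    and "\<And>v. v \<in> carrier W \<Longrightarrow> linear_map k V U (\<beta> v)"
    and "\<And>w. w \<in> carrier V \<Longrightarrow> linear_map k W U (\<lambda>v. \<beta> v w)"
  shows "tlift k W V U (flip k V W t) \<beta> = tlift k V W U t (\<lambda>v w. \<beta> w v)"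
  unfolding flip_def using assms by (simp add: pull)

context bialgebra
begin

lemma comult_cop: "comult (cop k B) a = flip k B B (comult B a)"
  by (simp add: cop_def)

lemma cop_bialgebra: "bialgebra k (cop k B)"
proof (intro bialgebra.intro bialgebra_axioms.intro)
  show "k_algebra k (cop k B)"
    using k_algebra_axioms k_algebra_cong[of "cop k B" B k] by (simp add: same_vs_def)
  show "linear_map k (cop k B) (tensor k (cop k B) (cop k B)) (comult (cop k B))"
    unfolding cop_norm comult_cop by simp
  show "linear_map k (cop k B) (scalars k) (counit (cop k B))"
    by (simp add: cop_norm counit_linear)
next
  fix a assume a: "a \<in> carrier (cop k B)"
  let ?U = "tensor k B BB"
  \<comment> \<open>Coassociativity of the co-opposite is that of \<open>B\<close> read from right
    to left.\<close>
  have "sw ?U a (\<lambda>y x. sw ?U x (\<lambda>q p. tens k B BB p (tens k B B q y))) =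
        sw ?U a (\<lambda>x p. sw ?U x (\<lambda>y q. tens k B BB p (tens k B B q y)))"
    by (rule sw_coassoc[symmetric]) (use a in simp_all)
  then show "tlift k (cop k B) (cop k B) (tensor k (cop k B) (tensor k (cop k B) (cop k B))) (comult (cop k B) a)
     (\<lambda>x y. tlift k (cop k B) (cop k B) (tensor k (cop k B) (tensor k (cop k B) (cop k B))) (comult (cop k B) x)
        (\<lambda>p q. tens k (cop k B) (tensor k (cop k B) (cop k B)) p (tens k (cop k B) (cop k B) q y))) =
    tlift k (cop k B) (cop k B) (tensor k (cop k B) (tensor k (cop k B) (cop k B))) (comult (cop k B) a)
     (\<lambda>x y. tens k (cop k B) (tensor k (cop k B) (cop k B)) x (comult (cop k B) y))"
    using a unfolding cop_norm tlift_cop comult_cop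
    by (simp add: tlift_flip) (simp add: flip_def pull)
next
  fix a assume a: "a \<in> carrier (cop k B)"
  \<comment> \<open>Reversal exchanges the two counit laws.\<close>
  show "tlift k (cop k B) (cop k B) (cop k B) (comult (cop k B) a) (\<lambda>x y. counit (cop k B) x \<odot>\<^bsub>cop k B\<^esub> y) = a"
    using a unfolding cop_norm tlift_cop comult_cop by (simp add: tlift_flip counit_r)
  show "tlift k (cop k B) (cop k B) (cop k B) (comult (cop k B) a) (\<lambda>x y. counit (cop k B) y \<odot>\<^bsub>cop k B\<^esub> x) = a"
    using a unfolding cop_norm tlift_cop comult_cop by (simp add: tlift_flip counit_l)
  fix b assume b: "b \<in> carrier (cop k B)"
  show "comult (cop k B) (a \<otimes>\<^bsub>cop k B\<^esub> b) =
    tlift k (cop k B) (cop k B) (tensor k (cop k B) (cop k B)) (comult (cop k B) a) (\<lambda>a1 a2.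
      tlift k (cop k B) (cop k B) (tensor k (cop k B) (cop k B)) (comult (cop k B) b) (\<lambda>b1 b2.
        tens k (cop k B) (cop k B) (a1 \<otimes>\<^bsub>cop k B\<^esub> b1) (a2 \<otimes>\<^bsub>cop k B\<^esub> b2)))"
    using a b unfolding cop_norm tlift_cop comult_cop by (simp add: tlift_flip) (simp add: flip_def sw_mult)
  show "counit (cop k B) (a \<otimes>\<^bsub>cop k B\<^esub> b) = counit (cop k B) a \<otimes>\<^bsub>k\<^esub> counit (cop k B) b"
    using a b by (simp add: counit_mult)
next
  show "comult (cop k B) \<one>\<^bsub>cop k B\<^esub> = tens k (cop k B) (cop k B) \<one>\<^bsub>cop k B\<^esub> \<one>\<^bsub>cop k B\<^esub>"
    unfolding cop_norm tlift_cop comult_cop by (simp add: flip_def sw_one)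
  show "counit (cop k B) \<one>\<^bsub>cop k B\<^esub> = \<one>\<^bsub>k\<^esub>" by (simp add: counit_one)
qed

lemma sw_cop:
  assumes "a \<in> carrier B"
    and "\<And>v. v \<in> carrier B \<Longrightarrow> linear_map k B U (\<beta> v)"
    and "\<And>w. w \<in> carrier B \<Longrightarrow> linear_map k B U (\<lambda>v. \<beta> v w)"
  shows "tlift k B B U (comult (cop k B) a) \<beta> = sw U a (\<lambda>x y. \<beta> y x)"
  unfolding comult_cop by (rule tlift_flip) (use assms in simp_all)

end

section \<open>Bimodules generated by modules\<close>

locale bialg_left_module = bialgebra k C + left_module k C W act
  for k :: "('k, 'r) ring_scheme" and C :: "('k, 'b, 'p) bialg_scheme"
    and W :: "('k, 'w, 'q) module_scheme" and act :: "'b \<Rightarrow> 'w \<Rightarrow> 'w"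
begin

notation amult (infixl "\<cdot>" 70)

lemma W_vs [simp]: "vectorspace k W"
  using linear_mapD(2)[OF bilinearD(1)[OF act_bilinear unit_closed]] .

lemma act_closed [simp]: "a \<in> carrier C \<Longrightarrow> w \<in> carrier W \<Longrightarrow> act a w \<in> carrier W"
  by (rule bilinearD(3)[OF act_bilinear])

lemma lin_act_l [simp]: "linear_map k Z C f \<Longrightarrow> w \<in> carrier W \<Longrightarrow> linear_map k Z W (\<lambda>z. act (f z) w)"
  by (rule lin_comp[OF bilinearD(2)[OF act_bilinear]])

lemma lin_act_r [simp]: "linear_map k Z W f \<Longrightarrow> a \<in> carrier C \<Longrightarrow> linear_map k Z W (\<lambda>z. act a (f z))"
  by (rule lin_comp[OF bilinearD(1)[OF act_bilinear]])

abbreviation "T \<equiv> tensor k W C"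

text \<open>\<open>la\<close>, \<open>ra\<close> and \<open>rd\<close> are the operations of
  \<open>right_generated\<close>, placed on the plain tensor product \<open>T\<close>. The axioms
  are proved for them and then transferred to records carrying them.\<close>

definition la where
  "la a t = tlift k W C T t (\<lambda>w b. sw T a (\<lambda>a1 a2. tens k W C (act a1 w) (a2 \<cdot> b)))"

definition ra where
  "ra t c = tlift k W C T t (\<lambda>w b. tens k W C w (b \<cdot> c))"

definition rd where
  "rd t = tlift k W C (tensor k T C) t (\<lambda>w b. sw (tensor k T C) b (\<lambda>b1 b2. tens k T C (tens k W C w b1) b2))"

lemma generated_closed [simp]:
  assumes "t \<in> carrier T"
  shows "a \<in> carrier C \<Longrightarrow> la a t \<in> carrier T" "a \<in> carrier C \<Longrightarrow> ra t a \<in> carrier T"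
    "rd t \<in> carrier (tensor k T C)"
  using assms by (simp_all add: la_def ra_def rd_def)

lemma lin_generated_coeff [simp]:
  assumes "linear_map k Z C f" "t \<in> carrier T"
  shows "linear_map k Z T (\<lambda>z. la (f z) t)" "linear_map k Z T (\<lambda>z. ra t (f z))"
  using assms by (simp_all add: la_def ra_def linear_mapD(1)[OF assms(1)])

lemma lin_generated [simp]:
  assumes "linear_map k Z T f"
  shows "a \<in> carrier C \<Longrightarrow> linear_map k Z T (\<lambda>z. la a (f z))"
    "a \<in> carrier C \<Longrightarrow> linear_map k Z T (\<lambda>z. ra (f z) a)"
    "linear_map k Z (tensor k T C) (\<lambda>z. rd (f z))"
  using assms by (simp_all add: la_def ra_def rd_def)

lemma generated_tens:
  assumes "w \<in> carrier W" "b \<in> carrier C"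
  shows "a \<in> carrier C \<Longrightarrow> la a (tens k W C w b) = sw T a (\<lambda>a1 a2. tens k W C (act a1 w) (a2 \<cdot> b))"
    "c \<in> carrier C \<Longrightarrow> ra (tens k W C w b) c = tens k W C w (b \<cdot> c)"
    "rd (tens k W C w b) = sw (tensor k T C) b (\<lambda>b1 b2. tens k T C (tens k W C w b1) b2)"
  using assms by (simp_all add: la_def ra_def rd_def)

lemmas mod_simps = generated_tens lin_generated[OF lin_id, THEN tlift_comp]

lemma la_one:
  assumes t: "t \<in> carrier T"
  shows "la \<one>\<^bsub>C\<^esub> t = t"
proof -
  have "\<forall>t\<in>carrier T. la \<one>\<^bsub>C\<^esub> t = t"
    by (rule tensor_ext_ball[where U = T]) (simp_all add: mod_simps sw_one act_one)
  with t show ?thesis by blast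
qed

lemma ra_one:
  assumes t: "t \<in> carrier T"
  shows "ra t \<one>\<^bsub>C\<^esub> = t"
proof -
  have "\<forall>t\<in>carrier T. ra t \<one>\<^bsub>C\<^esub> = t"
    by (rule tensor_ext_ball[where U = T]) (simp_all add: mod_simps)
  with t show ?thesis by blast
qed

text \<open>Expanding either side gives the coproducts of \<open>a\<close> and \<open>b\<close>
  acting on the same pure tensor, but nested in opposite orders; \<open>tlift_swap\<close>
  reconciles them.\<close>

lemma la_mult:
  assumes [simp]: "a \<in> carrier C" "b \<in> carrier C" and t: "t \<in> carrier T"
  shows "la (a \<cdot> b) t = la a (la b t)"
proof -
  have "la (a \<cdot> b) (tens k W C w c) = la a (la b (tens k W C w c))"
    if [simp]: "w \<in> carrier W" "c \<in> carrier C" for w c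
  proof -
    have "la (a \<cdot> b) (tens k W C w c) = sw T a (\<lambda>a1 a2. sw T b (\<lambda>b1 b2.
        tens k W C (act a1 (act b1 w)) (a2 \<cdot> (b2 \<cdot> c))))"
      by (simp add: mod_simps sw_mult act_mult mult_assoc)
    also have "\<dots> = sw T b (\<lambda>b1 b2. sw T a (\<lambda>a1 a2.
        tens k W C (act a1 (act b1 w)) (a2 \<cdot> (b2 \<cdot> c))))"
      by (rule tlift_swap) simp_all
    also have "\<dots> = la a (la b (tens k W C w c))"
      by (simp add: mod_simps)
    finally show ?thesis .
  qed
  then have "\<forall>t\<in>carrier T. la (a \<cdot> b) t = la a (la b t)"
    by (intro tensor_ext_ball[where U = T]) simp_all
  with t show ?thesis by blast
qed

lemma ra_mult:
  assumes [simp]: "a \<in> carrier C" "b \<in> carrier C" and t: "t \<in> carrier T"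
  shows "ra t (a \<cdot> b) = ra (ra t a) b"
proof -
  have "\<forall>t\<in>carrier T. ra t (a \<cdot> b) = ra (ra t a) b"
    by (rule tensor_ext_ball[where U = T]) (simp_all add: mod_simps mult_assoc)
  with t show ?thesis by blast
qed

lemma ra_la:
  assumes [simp]: "a \<in> carrier C" "b \<in> carrier C" and t: "t \<in> carrier T"
  shows "ra (la a t) b = la a (ra t b)"
proof -
  have "\<forall>t\<in>carrier T. ra (la a t) b = la a (ra t b)"
    by (rule tensor_ext_ball[where U = T]) (simp_all add: mod_simps mult_assoc)
  with t show ?thesis by blast
qed

lemma rd_coassoc:
  assumes t: "t \<in> carrier T"
  shows "tlift k T C (tensor k (tensor k T C) C) (rd t) (\<lambda>w c. tens k (tensor k T C) C (rd w) c) =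
    tlift k T C (tensor k (tensor k T C) C) (rd t) (\<lambda>w c.
      sw (tensor k (tensor k T C) C) c (\<lambda>c1 c2. tens k (tensor k T C) C (tens k T C w c1) c2))"
    (is "?L t = ?R t")
proof -
  have "?L (tens k W C w b) = ?R (tens k W C w b)" if [simp]: "w \<in> carrier W" "b \<in> carrier C" for w b
    by (simp add: mod_simps pull) (rule sw_coassoc; simp)
  then have "\<forall>t\<in>carrier T. ?L t = ?R t"
    by (intro tensor_ext_ball[where U = "tensor k (tensor k T C) C"]) simp_all
  with t show ?thesis by blast
qed

lemma rd_counit:
  assumes t: "t \<in> carrier T"
  shows "tlift k T C T (rd t) (\<lambda>w c. counit C c \<odot>\<^bsub>T\<^esub> w) = t"
proof -
  have "\<forall>t\<in>carrier T. tlift k T C T (rd t) (\<lambda>w c. counit C c \<odot>\<^bsub>T\<^esub> w) = t"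
    by (rule tensor_ext_ball[where U = T]) (simp_all add: mod_simps pull sw_counit_r)
  with t show ?thesis by blast
qed

text \<open>The coaction splits the second component of \<open>a\<close>, while the covariance law
  splits the first; coassociativity passes between the two. The rest brings the independent sums
  into the order of the law.\<close>

lemma rd_covariant:
  assumes [simp]: "a \<in> carrier C" "b \<in> carrier C" and t: "t \<in> carrier T"
  shows "rd (ra (la a t) b) =
    sw (tensor k T C) a (\<lambda>a1 a2. tlift k T C (tensor k T C) (rd t) (\<lambda>x0 x1.
      sw (tensor k T C) b (\<lambda>b1 b2. tens k T C (ra (la a1 x0) b1) (a2 \<cdot> x1 \<cdot> b2))))"
    (is "_ = ?R t")
proof -
  let ?U = "tensor k T C"
  have "rd (ra (la a (tens k W C w c)) b) = ?R (tens k W C w c)"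
    if [simp]: "w \<in> carrier W" "c \<in> carrier C" for w c
  proof -
    \<comment> \<open>Naming the integrand fixes its shape while the sums around it are
      rearranged.\<close>
    define F where "F = (\<lambda>p q r c1 c2 b1 b2.
      tens k T C (tens k W C (act p w) (q \<cdot> (c1 \<cdot> b1))) (r \<cdot> (c2 \<cdot> b2)))"
    have "rd (ra (la a (tens k W C w c)) b) = sw ?U a (\<lambda>p y. sw ?U y (\<lambda>q r.
        sw ?U c (\<lambda>c1 c2. sw ?U b (\<lambda>b1 b2. F p q r c1 c2 b1 b2))))"
      by (simp add: mod_simps pull sw_mult mult_assoc F_def)
    also have "\<dots> = sw ?U a (\<lambda>x r. sw ?U x (\<lambda>p q.
        sw ?U c (\<lambda>c1 c2. sw ?U b (\<lambda>b1 b2. F p q r c1 c2 b1 b2))))"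
      unfolding F_def by (rule sw_coassoc[symmetric]) simp_all
    also have "\<dots> = sw ?U a (\<lambda>x r. sw ?U c (\<lambda>c1 c2. sw ?U x (\<lambda>p q.
        sw ?U b (\<lambda>b1 b2. F p q r c1 c2 b1 b2))))"
      unfolding F_def by (rule tlift_cong, simp_all, rule tlift_swap, simp_all)
    also have "\<dots> = sw ?U a (\<lambda>x r. sw ?U c (\<lambda>c1 c2. sw ?U b (\<lambda>b1 b2. sw ?U x (\<lambda>p q.
        F p q r c1 c2 b1 b2))))"
      unfolding F_def by (rule tlift_cong, simp_all, rule tlift_cong, simp_all, rule tlift_swap, simp_all)
    also have "\<dots> = ?R (tens k W C w c)"
      by (simp add: mod_simps pull mult_assoc F_def)
    finally show ?thesis .
  qed
  then have "\<forall>t\<in>carrier T. rd (ra (la a t) b) = ?R t"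
    by (intro tensor_ext_ball[where U = ?U]) simp_all
  with t show ?thesis by blast
qed

lemma same_vs_right_generated: "same_vs (right_generated k C W act) T"
  by (simp add: same_vs_def right_generated_def Let_def)

lemma right_generated_simps:
  "lact (right_generated k C W act) = la" "ract (right_generated k C W act) = ra"
  "rcoact (right_generated k C W act) = rd"
  by (simp_all add: right_generated_def Let_def la_def ra_def rd_def fun_eq_iff)

text \<open>Stated for any record with these operations, so that it covers both the bimodule of a
  left module and its extension by a left coaction.\<close>

lemma right_generated_covariant:
  assumes M: "same_vs M T" "lact M = la" "ract M = ra" "rcoact M = rd"
  shows "right_covariant_bimodule k C M"
proof -
  have c: "carrier M = carrier T" "smult M = smult T" using M(1) by (simp_all add: same_vs_def)
  note tn = tensor_cong_vs[OF M(1) same_vs_refl[of C]]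
  show ?thesis
  proof (intro right_covariant_bimodule.intro bimodule.intro left_module.intro right_module.intro
      right_comodule.intro bimodule_axioms.intro right_covariant_bimodule_axioms.intro)
    show "bialgebra k C" "k_algebra k C" by unfold_locales
    show "bilinear k C M M (lact M)" "bilinear k M C M (ract M)"
      unfolding bilinear_cong_vs[OF same_vs_refl M(1) M(1)] bilinear_cong_vs[OF M(1) same_vs_refl M(1)] M
      by (auto intro!: bilinearI)
    show "linear_map k M (tensor k M C) (rcoact M)"
      unfolding tn same_vs_linear_map_l[OF M(1)] M by simp
  next
    fix x assume x: "x \<in> carrier M"
    then have [simp]: "x \<in> carrier T" by (simp add: c)
    show "lact M \<one>\<^bsub>C\<^esub> x = x" "ract M x \<one>\<^bsub>C\<^esub> = x" by (simp_all add: M la_one ra_one)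
    show "tlift k M C M (rcoact M x) (\<lambda>w c. counit C c \<odot>\<^bsub>M\<^esub> w) = x"
      unfolding tlift_cong_vs[OF M(1), of k M C T C] c M by (simp add: rd_counit)
    show "tlift k M C (tensor k (tensor k M C) C) (rcoact M x) (\<lambda>w c. tens k (tensor k M C) C (rcoact M w) c) =
      tlift k M C (tensor k (tensor k M C) C) (rcoact M x) (\<lambda>w c.
        sw (tensor k (tensor k M C) C) c (\<lambda>c1 c2. tens k (tensor k M C) C (tens k M C w c1) c2))"
      unfolding tn M tlift_cong_vs[OF same_vs_refl, of k M C _ T C] by (rule rd_coassoc) simp
    fix a b assume [simp]: "a \<in> carrier C" "b \<in> carrier C"
    show "lact M (a \<cdot> b) x = lact M a (lact M b x)" "ract M x (a \<cdot> b) = ract M (ract M x a) b"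
      "ract M (lact M a x) b = lact M a (ract M x b)"
      by (simp_all add: M la_mult ra_mult ra_la)
    show "rcoact M (ract M (lact M a x) b) =
      sw (tensor k M C) a (\<lambda>a1 a2. tlift k M C (tensor k M C) (rcoact M x) (\<lambda>x0 x1.
          sw (tensor k M C) b (\<lambda>b1 b2.
            tens k M C (ract M (lact M a1 x0) b1) (a2 \<cdot> x1 \<cdot> b2))))"
      unfolding tn M tlift_cong_vs[OF same_vs_refl, of k M C _ T C] by (rule rd_covariant) simp_all
  qed
qed

end

sublocale yd_left_left \<subseteq> bialg_left_module k C V act ..

context yd_left_left
begin

notation amult (infixl "\<cdot>" 70)

lemma rho_closed [simp]: "v \<in> carrier V \<Longrightarrow> \<rho> v \<in> carrier (tensor k C V)"
  by (rule linear_mapD(3)[OF coact_linear])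

lemma lin_rho [simp]: "linear_map k Z V f \<Longrightarrow> linear_map k Z (tensor k C V) (\<lambda>z. \<rho> (f z))"
  by (rule lin_comp[OF coact_linear])

lemma rho_coassoc:
  assumes [simp]: "v \<in> carrier V"
    and [simp]: "\<And>q r. q \<in> carrier C \<Longrightarrow> r \<in> carrier V \<Longrightarrow> linear_map k C U (\<lambda>p. \<beta> p q r)"
      "\<And>p r. p \<in> carrier C \<Longrightarrow> r \<in> carrier V \<Longrightarrow> linear_map k C U (\<lambda>q. \<beta> p q r)"
      "\<And>p q. p \<in> carrier C \<Longrightarrow> q \<in> carrier C \<Longrightarrow> linear_map k V U (\<lambda>r. \<beta> p q r)"
    and [simp]: "vectorspace k U"
  shows "tlift k C V U (\<rho> v) (\<lambda>c w. sw U c (\<lambda>c1 c2. \<beta> c1 c2 w)) =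
    tlift k C V U (\<rho> v) (\<lambda>c w. tlift k C V U (\<rho> w) (\<lambda>d u. \<beta> c d u))"
proof -
  let ?X = "tensor k C (tensor k C V)"
  define L where "L = (\<lambda>t. tlift k C (tensor k C V) U t (\<lambda>p s. tlift k C V U s (\<lambda>q y. \<beta> p q y)))"
  have "L (tlift k C V ?X (\<rho> v) (\<lambda>c w. sw ?X c (\<lambda>c1 c2. tens k C (tensor k C V) c1 (tens k C V c2 w)))) =
      L (tlift k C V ?X (\<rho> v) (\<lambda>c w. tens k C (tensor k C V) c (\<rho> w)))"
    by (simp only: coact_coassoc[OF assms(1)])
  then show ?thesis
    by (simp add: L_def pull)
qed

lemma rho_counit:
  assumes v: "v \<in> carrier V" and f: "linear_map k V U f"
  shows "tlift k C V U (\<rho> v) (\<lambda>c w. counit C c \<odot>\<^bsub>U\<^esub> f w) = f v"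
proof -
  have "f (tlift k C V V (\<rho> v) (\<lambda>x y. counit C x \<odot>\<^bsub>V\<^esub> y)) = f v" by (simp only: coact_counit[OF v])
  moreover have "f (tlift k C V V (\<rho> v) (\<lambda>x y. counit C x \<odot>\<^bsub>V\<^esub> y))
      = tlift k C V U (\<rho> v) (\<lambda>x y. f (counit C x \<odot>\<^bsub>V\<^esub> y))"
    by (rule tlift_comp[OF f]) (use v in \<open>simp_all add: vs_smult_closed[OF W_vs]\<close>)
  ultimately show ?thesis using v by (simp add: linear_mapD(5)[OF f])
qed

text \<open>The Yetter-Drinfeld identity pushed through the linear map that a bilinear
  \<open>\<beta>\<close> induces on the tensor product, so that it applies below other
  operations.\<close>

lemma yd_lift:
  assumes [simp]: "a \<in> carrier C" "v \<in> carrier V"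
    and [simp]: "\<And>q. q \<in> carrier V \<Longrightarrow> linear_map k C U (\<lambda>p. \<beta> p q)"
      "\<And>p. p \<in> carrier C \<Longrightarrow> linear_map k V U (\<lambda>q. \<beta> p q)"
    and [simp]: "vectorspace k U"
  shows "sw U a (\<lambda>a1 a2. tlift k C V U (\<rho> v) (\<lambda>vm v0. \<beta> (a1 \<cdot> vm) (act a2 v0))) =
    sw U a (\<lambda>a1 a2. tlift k C V U (\<rho> (act a1 v)) (\<lambda>um u0. \<beta> (um \<cdot> a2) u0))"
proof -
  let ?X = "tensor k C V"
  define L where "L = (\<lambda>t. tlift k C V U t \<beta>)"
  have "L (sw ?X a (\<lambda>a1 a2. tlift k C V ?X (\<rho> v) (\<lambda>vm v0. tens k C V (a1 \<cdot> vm) (act a2 v0)))) =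
      L (sw ?X a (\<lambda>a1 a2. tlift k C V ?X (\<rho> (act a1 v)) (\<lambda>um u0. tens k C V (um \<cdot> a2) u0)))"
    by (simp only: yd[OF assms(1,2)])
  then show ?thesis
    by (simp add: L_def pull)
qed

abbreviation "CT \<equiv> tensor k C T"

definition ld where
  "ld t = tlift k V C CT t (\<lambda>w b. tlift k C V CT (\<rho> w) (\<lambda>wm w0.
     sw CT b (\<lambda>b1 b2. tens k C T (wm \<cdot> b1) (tens k V C w0 b2))))"

lemma ld_closed [simp]: "t \<in> carrier T \<Longrightarrow> ld t \<in> carrier CT"
  by (simp add: ld_def)

lemma lin_ld [simp]: "linear_map k Z T f \<Longrightarrow> linear_map k Z CT (\<lambda>z. ld (f z))"
  by (simp add: ld_def)

lemma ld_tens: "w \<in> carrier V \<Longrightarrow> b \<in> carrier C \<Longrightarrow>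
    ld (tens k V C w b) = tlift k C V CT (\<rho> w) (\<lambda>wm w0.
     sw CT b (\<lambda>b1 b2. tens k C T (wm \<cdot> b1) (tens k V C w0 b2)))"
  by (simp add: ld_def)

lemmas ld_tlift = tlift_comp[OF lin_ld[OF lin_id]]

lemmas bimod_simps = mod_simps ld_tens ld_tlift

text \<open>The components of \<open>\<rho> w\<close> and of \<open>b\<close> meet only in products,
  so coassociativity of the coaction and of the coproduct apply to separate sums; the exchanges
  bring the nested sums of each kind next to each other.\<close>

lemma ld_coassoc:
  assumes t: "t \<in> carrier T"
  shows "tlift k C T (tensor k C CT) (ld t) (\<lambda>c w. sw (tensor k C CT) c (\<lambda>c1 c2.
      tens k C CT c1 (tens k C T c2 w))) =
    tlift k C T (tensor k C CT) (ld t) (\<lambda>c w. tens k C CT c (ld w))"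
    (is "?L t = ?R t")
proof -
  let ?U = "tensor k C CT"
  have "?L (tens k V C w b) = ?R (tens k V C w b)" if [simp]: "w \<in> carrier V" "b \<in> carrier C" for w b
  proof -
    define F where "F = (\<lambda>m1 m2 w0 p q r.
      tens k C CT (m1 \<cdot> p) (tens k C T (m2 \<cdot> q) (tens k V C w0 r)))"
    have "?L (tens k V C w b) = tlift k C V ?U (\<rho> w) (\<lambda>m w0. sw ?U b (\<lambda>x r. sw ?U m (\<lambda>m1 m2.
        sw ?U x (\<lambda>p q. F m1 m2 w0 p q r))))"
      by (simp add: bimod_simps pull sw_mult F_def)
    also have "\<dots> = tlift k C V ?U (\<rho> w) (\<lambda>m w0. sw ?U m (\<lambda>m1 m2. sw ?U b (\<lambda>x r.
        sw ?U x (\<lambda>p q. F m1 m2 w0 p q r))))"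
      unfolding F_def by (rule tlift_cong, simp_all, rule tlift_swap, simp_all)
    also have "\<dots> = tlift k C V ?U (\<rho> w) (\<lambda>m w0. sw ?U m (\<lambda>m1 m2. sw ?U b (\<lambda>p y.
        sw ?U y (\<lambda>q r. F m1 m2 w0 p q r))))"
      unfolding F_def by (rule tlift_cong, simp_all, rule tlift_cong, simp_all, rule sw_coassoc, simp_all)
    also have "\<dots> = tlift k C V ?U (\<rho> w) (\<lambda>m1 w'. tlift k C V ?U (\<rho> w') (\<lambda>m2 w0. sw ?U b (\<lambda>p y.
        sw ?U y (\<lambda>q r. F m1 m2 w0 p q r))))"
      unfolding F_def by (rule rho_coassoc, simp_all)
    also have "\<dots> = tlift k C V ?U (\<rho> w) (\<lambda>m1 w'. sw ?U b (\<lambda>p y. tlift k C V ?U (\<rho> w') (\<lambda>m2 w0.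
        sw ?U y (\<lambda>q r. F m1 m2 w0 p q r))))"
      unfolding F_def by (rule tlift_cong, simp_all, rule tlift_swap, simp_all)
    also have "\<dots> = ?R (tens k V C w b)"
      by (simp add: bimod_simps pull F_def)
    finally show ?thesis .
  qed
  then have "\<forall>t\<in>carrier T. ?L t = ?R t"
    by (intro tensor_ext_ball[where U = ?U]) simp_all
  with t show ?thesis by blast
qed

text \<open>The counit of a product splits into a factor for \<open>\<rho> w\<close> and one for
  \<open>b\<close>, and each counit law removes its own sum.\<close>

lemma ld_counit:
  assumes t: "t \<in> carrier T"
  shows "tlift k C T T (ld t) (\<lambda>c w. counit C c \<odot>\<^bsub>T\<^esub> w) = t"
proof -
  have "tlift k C T T (ld (tens k V C w b)) (\<lambda>c w. counit C c \<odot>\<^bsub>T\<^esub> w) = tens k V C w b"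
    if [simp]: "w \<in> carrier V" "b \<in> carrier C" for w b
  proof -
    interpret TV: vectorspace k T by simp
    have "tlift k C T T (ld (tens k V C w b)) (\<lambda>c w. counit C c \<odot>\<^bsub>T\<^esub> w) =
      tlift k C V T (\<rho> w) (\<lambda>wm w0. counit C wm \<odot>\<^bsub>T\<^esub> sw T b (\<lambda>b1 b2. counit C b1 \<odot>\<^bsub>T\<^esub> tens k V C w0 b2))"
      by (simp add: bimod_simps pull counit_mult TV.smult_assoc1 smult_tlift)
    then show ?thesis by (simp add: sw_counit_l rho_counit)
  qed
  then have "\<forall>t\<in>carrier T. tlift k C T T (ld t) (\<lambda>c w. counit C c \<odot>\<^bsub>T\<^esub> w) = t"
    by (intro tensor_ext_ball[where U = T]) simp_all
  with t show ?thesis by blast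
qed

text \<open>The Yetter-Drinfeld condition enters the bimodule construction here. Left multiplication
  acts before the coaction on one side and after it on the other; these are the two sides of the
  condition for the first two components of \<open>a\<close>.\<close>

lemma ld_covariant:
  assumes [simp]: "a \<in> carrier C" "b \<in> carrier C" and t: "t \<in> carrier T"
  shows "ld (ra (la a t) b) =
    sw CT a (\<lambda>a1 a2. tlift k C T CT (ld t) (\<lambda>xm x0.
      sw CT b (\<lambda>b1 b2. tens k C T (a1 \<cdot> xm \<cdot> b1) (ra (la a2 x0) b2))))"
    (is "_ = ?R t")
proof -
  have "ld (ra (la a (tens k V C w c)) b) = ?R (tens k V C w c)"
    if [simp]: "w \<in> carrier V" "c \<in> carrier C" for w c
  proof -
    define F where "F = (\<lambda>z u r c1 c2 b1 b2.
      tens k C T (z \<cdot> (c1 \<cdot> b1)) (tens k V C u (r \<cdot> (c2 \<cdot> b2))))"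
    \<comment> \<open>The sums over \<open>c\<close> and \<open>b\<close> are hidden in a map linear
      in three slots, so that the Yetter-Drinfeld step sees only an element of \<open>C\<close>, a
      vector and the last component of \<open>a\<close>.\<close>
    define G where "G = (\<lambda>z u r. sw CT c (\<lambda>c1 c2. sw CT b (\<lambda>b1 b2. F z u r c1 c2 b1 b2)))"
    have [simp]: "linear_map k Z CT (\<lambda>x. G (f x) u r)" if "linear_map k Z C f" "u \<in> carrier V" "r \<in> carrier C" for Z f u r
      using that by (simp add: G_def F_def linear_mapD(1))
    have [simp]: "linear_map k Z CT (\<lambda>x. G u (f x) r)" if "linear_map k Z V f" "u \<in> carrier C" "r \<in> carrier C" for Z f u r
      using that by (simp add: G_def F_def linear_mapD(1))
    have [simp]: "linear_map k Z CT (\<lambda>x. G u r (f x))" if "linear_map k Z C f" "u \<in> carrier C" "r \<in> carrier V" for Z f u r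
      using that by (simp add: G_def F_def linear_mapD(1))
    have [simp]: "G z u r \<in> carrier CT" if "z \<in> carrier C" "u \<in> carrier V" "r \<in> carrier C" for z u r
      using that by (simp add: G_def F_def)
    have "ld (ra (la a (tens k V C w c)) b) = sw CT a (\<lambda>p y. tlift k C V CT (\<rho> (act p w)) (\<lambda>um u0.
        sw CT y (\<lambda>q r. G (um \<cdot> q) u0 r)))"
      by (simp add: bimod_simps pull sw_mult mult_assoc F_def G_def)
    also have "\<dots> = sw CT a (\<lambda>p y. sw CT y (\<lambda>q r. tlift k C V CT (\<rho> (act p w)) (\<lambda>um u0.
        G (um \<cdot> q) u0 r)))"
      by (rule tlift_cong, simp_all, rule tlift_swap, simp_all)
    also have "\<dots> = sw CT a (\<lambda>x r. sw CT x (\<lambda>p q. tlift k C V CT (\<rho> (act p w)) (\<lambda>um u0.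
        G (um \<cdot> q) u0 r)))"
      by (rule sw_coassoc[symmetric], simp_all)
    \<comment> \<open>Coassociativity has made \<open>p\<close> and \<open>q\<close> the components
      of one element \<open>x\<close>, the form the condition requires.\<close>
    also have "\<dots> = sw CT a (\<lambda>x r. sw CT x (\<lambda>p q. tlift k C V CT (\<rho> w) (\<lambda>vm v0.
        G (p \<cdot> vm) (act q v0) r)))"
      by (rule tlift_cong, simp_all, rule yd_lift[symmetric], simp_all)
    also have "\<dots> = sw CT a (\<lambda>p y. sw CT y (\<lambda>q r. tlift k C V CT (\<rho> w) (\<lambda>vm v0.
        G (p \<cdot> vm) (act q v0) r)))"
      by (rule sw_coassoc, simp_all)
    also have "\<dots> = sw CT a (\<lambda>p y. tlift k C V CT (\<rho> w) (\<lambda>vm v0. sw CT y (\<lambda>q r.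
        G (p \<cdot> vm) (act q v0) r)))"
      by (rule tlift_cong, simp_all, rule tlift_swap, simp_all)
    also have "\<dots> = sw CT a (\<lambda>p y. tlift k C V CT (\<rho> w) (\<lambda>vm v0. sw CT c (\<lambda>c1 c2. sw CT y (\<lambda>q r.
        sw CT b (\<lambda>b1 b2. F (p \<cdot> vm) (act q v0) r c1 c2 b1 b2)))))"
      unfolding G_def F_def
      by (rule tlift_cong, simp_all, rule tlift_cong, simp_all, rule tlift_swap, simp_all)
    also have "\<dots> = sw CT a (\<lambda>p y. tlift k C V CT (\<rho> w) (\<lambda>vm v0. sw CT c (\<lambda>c1 c2.
        sw CT b (\<lambda>b1 b2. sw CT y (\<lambda>q r. F (p \<cdot> vm) (act q v0) r c1 c2 b1 b2)))))"
      unfolding F_def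
      by (rule tlift_cong, simp_all, rule tlift_cong, simp_all, rule tlift_cong, simp_all, rule tlift_swap, simp_all)
    also have "\<dots> = ?R (tens k V C w c)"
      by (simp add: bimod_simps pull mult_assoc F_def)
    finally show ?thesis .
  qed
  then have "\<forall>t\<in>carrier T. ld (ra (la a t) b) = ?R t"
    by (intro tensor_ext_ball[where U = CT]) simp_all
  with t show ?thesis by blast
qed

text \<open>The left coaction multiplies into the first component of \<open>b\<close> and the right
  coaction splits off the last, so the two orders differ by coassociativity of
  \<open>C\<close>.\<close>

lemma rd_ld:
  assumes t: "t \<in> carrier T"
  shows "tlift k T C (tensor k C (tensor k T C)) (rd t) (\<lambda>y c.
        tlift k C T (tensor k C (tensor k T C)) (ld y) (\<lambda>d z.
          tens k C (tensor k T C) d (tens k T C z c))) =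
      tlift k C T (tensor k C (tensor k T C)) (ld t) (\<lambda>d y. tens k C (tensor k T C) d (rd y))"
    (is "?L t = ?R t")
proof -
  let ?U = "tensor k C (tensor k T C)"
  have "?L (tens k V C w b) = ?R (tens k V C w b)" if [simp]: "w \<in> carrier V" "b \<in> carrier C" for w b
  proof -
    define F where "F = (\<lambda>m u p q r.
      tens k C (tensor k T C) (m \<cdot> p) (tens k T C (tens k V C u q) r))"
    have "?L (tens k V C w b) = sw ?U b (\<lambda>x r. tlift k C V ?U (\<rho> w) (\<lambda>m u. sw ?U x (\<lambda>p q. F m u p q r)))"
      by (simp add: bimod_simps pull F_def)
    also have "\<dots> = tlift k C V ?U (\<rho> w) (\<lambda>m u. sw ?U b (\<lambda>x r. sw ?U x (\<lambda>p q. F m u p q r)))"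
      unfolding F_def by (rule tlift_swap, simp_all)
    also have "\<dots> = tlift k C V ?U (\<rho> w) (\<lambda>m u. sw ?U b (\<lambda>p y. sw ?U y (\<lambda>q r. F m u p q r)))"
      unfolding F_def by (rule tlift_cong, simp_all, rule sw_coassoc, simp_all)
    also have "\<dots> = ?R (tens k V C w b)"
      by (simp add: bimod_simps pull F_def)
    finally show ?thesis .
  qed
  then have "\<forall>t\<in>carrier T. ?L t = ?R t"
    by (intro tensor_ext_ball[where U = ?U]) simp_all
  with t show ?thesis by blast
qed

lemma right_generated_yd_bicovariant: "bicovariant_bimodule k C (right_generated_yd k C V act \<rho>)"
proof -
  define M where "M = right_generated_yd k C V act \<rho>"
  have M: "same_vs M T" "lact M = la" "ract M = ra" "rcoact M = rd" "lcoact M = ld"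
    by (simp_all add: M_def right_generated_yd_def right_generated_def Let_def same_vs_def
        rcov_bimod.defs bicov_bimod.defs la_def ra_def rd_def ld_def fun_eq_iff)
  have c: "carrier M = carrier T" "smult M = smult T" using M(1) by (simp_all add: same_vs_def)
  note tn = tensor_cong_vs[OF M(1) same_vs_refl[of C]] tensor_cong_vs[OF same_vs_refl[of C] M(1)]
  have "bicovariant_bimodule k C M"
  proof (intro bicovariant_bimodule.intro bicovariant_bimodule_axioms.intro left_comodule.intro)
    show "right_covariant_bimodule k C M"
      by (rule right_generated_covariant) (rule M)+
    show "linear_map k M (tensor k C M) (lcoact M)"
      unfolding tn same_vs_linear_map_l[OF M(1)] M by simp
  next
    fix x assume x: "x \<in> carrier M"
    then have [simp]: "x \<in> carrier T" by (simp add: c)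
    show "tlift k C M M (lcoact M x) (\<lambda>c w. counit C c \<odot>\<^bsub>M\<^esub> w) = x"
      unfolding tlift_cong_vs[OF M(1), of k C M C T] c M by (simp add: ld_counit)
    show "tlift k C M (tensor k C (tensor k C M)) (lcoact M x) (\<lambda>c w.
        sw (tensor k C (tensor k C M)) c (\<lambda>c1 c2. tens k C (tensor k C M) c1 (tens k C M c2 w))) =
      tlift k C M (tensor k C (tensor k C M)) (lcoact M x) (\<lambda>c w. tens k C (tensor k C M) c (lcoact M w))"
      unfolding tn M tlift_cong_vs[OF same_vs_refl, of k C M _ C T] by (rule ld_coassoc) simp
    show "tlift k M C (tensor k C (tensor k M C)) (rcoact M x) (\<lambda>y c.
        tlift k C M (tensor k C (tensor k M C)) (lcoact M y) (\<lambda>d z.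
          tens k C (tensor k M C) d (tens k M C z c))) =
      tlift k C M (tensor k C (tensor k M C)) (lcoact M x) (\<lambda>d y.
        tens k C (tensor k M C) d (rcoact M y))"
      unfolding tn M tlift_cong_vs[OF same_vs_refl, of k C M _ C T] tlift_cong_vs[OF same_vs_refl, of k M C _ T C]
      by (rule rd_ld) simp
    fix a b assume [simp]: "a \<in> carrier C" "b \<in> carrier C"
    show "lcoact M (ract M (lact M a x) b) =
      sw (tensor k C M) a (\<lambda>a1 a2. tlift k C M (tensor k C M) (lcoact M x) (\<lambda>xm x0.
          sw (tensor k C M) b (\<lambda>b1 b2.
            tens k C M (a1 \<cdot> xm \<cdot> b1) (ract M (lact M a2 x0) b2))))"
      unfolding tn M tlift_cong_vs[OF same_vs_refl, of k C M _ C T] by (rule ld_covariant) simp_all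
  qed
  then show ?thesis by (simp add: M_def)
qed

end

section \<open>Free bimodules and left duals\<close>

locale bialg_right_module = bialgebra k C + right_module k C V act
  for k :: "('k, 'r) ring_scheme" and C :: "('k, 'b, 'p) bialg_scheme"
    and V :: "('k, 'v, 'q) module_scheme" and act :: "'v \<Rightarrow> 'b \<Rightarrow> 'v"
begin

notation amult (infixl "\<cdot>" 70)

lemma V_vs [simp]: "vectorspace k V"
  using linear_mapD(2)[OF bilinearD(2)[OF act_bilinear unit_closed]] .

lemma act_closed [simp]: "v \<in> carrier V \<Longrightarrow> a \<in> carrier C \<Longrightarrow> act v a \<in> carrier V"
  by (rule bilinearD(3)[OF act_bilinear])

lemma lin_act_l [simp]: "linear_map k Z V f \<Longrightarrow> a \<in> carrier C \<Longrightarrow> linear_map k Z V (\<lambda>z. act (f z) a)"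
  by (rule lin_comp[OF bilinearD(2)[OF act_bilinear]])

lemma lin_act_r [simp]: "linear_map k Z C f \<Longrightarrow> v \<in> carrier V \<Longrightarrow> linear_map k Z V (\<lambda>z. act v (f z))"
  by (rule lin_comp[OF bilinearD(1)[OF act_bilinear]])

abbreviation "CV \<equiv> tensor k C V"

definition gla where
  "gla a t = tlift k C V CV t (\<lambda>b v. tens k C V (a \<cdot> b) v)"

definition gra where
  "gra t b = tlift k C V CV t (\<lambda>a v. sw CV b (\<lambda>b1 b2. tens k C V (a \<cdot> b1) (act v b2)))"

lemma free_closed [simp]:
  assumes "a \<in> carrier C" "t \<in> carrier CV"
  shows "gla a t \<in> carrier CV" "gra t a \<in> carrier CV"
  using assms by (simp_all add: gla_def gra_def)

lemma lin_free_coeff [simp]: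
  assumes "linear_map k Z C f" "t \<in> carrier CV"
  shows "linear_map k Z CV (\<lambda>z. gla (f z) t)" "linear_map k Z CV (\<lambda>z. gra t (f z))"
  using assms by (simp_all add: gla_def gra_def linear_mapD(1)[OF assms(1)])

lemma lin_free [simp]:
  assumes "linear_map k Z CV f" "a \<in> carrier C"
  shows "linear_map k Z CV (\<lambda>z. gla a (f z))" "linear_map k Z CV (\<lambda>z. gra (f z) a)"
  using assms by (simp_all add: gla_def gra_def)

lemma gla_tens: "a \<in> carrier C \<Longrightarrow> v \<in> carrier V \<Longrightarrow> b \<in> carrier C \<Longrightarrow>
    gla a (tens k C V b v) = tens k C V (a \<cdot> b) v"
  by (simp add: gla_def)

lemma gra_tens: "b \<in> carrier C \<Longrightarrow> v \<in> carrier V \<Longrightarrow> a \<in> carrier C \<Longrightarrow>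
    gra (tens k C V a v) b = sw CV b (\<lambda>b1 b2. tens k C V (a \<cdot> b1) (act v b2))"
  by (simp add: gra_def)

lemmas gmod_simps = gla_tens gra_tens lin_free[OF lin_id, THEN tlift_comp]

lemma left_generated_simps:
  "lact (left_generated k C V act \<rho>) = gla" "ract (left_generated k C V act \<rho>) = gra"
  by (simp_all add: left_generated_def Let_def gla_def gra_def fun_eq_iff)

lemma same_vs_left_generated: "same_vs (left_generated k C V act \<rho>) CV"
  by (simp add: same_vs_def left_generated_def Let_def)

lemma carrier_left_generated [simp]: "carrier (left_generated k C V act \<rho>) = carrier CV"
  by (simp add: left_generated_def Let_def)

lemma left_generated_bimodule: "bimodule k C (left_generated k C V act \<rho>)"
proof -
  define M where "M = left_generated k C V act \<rho>"
  have M: "same_vs M CV" "lact M = gla" "ract M = gra" "carrier M = carrier CV"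
    by (simp_all add: M_def left_generated_simps same_vs_left_generated)
  have "bimodule k C M"
  proof (intro bimodule.intro left_module.intro right_module.intro bimodule_axioms.intro)
    show "k_algebra k C" by unfold_locales
    show "bilinear k C M M (lact M)" "bilinear k M C M (ract M)"
      unfolding bilinear_cong_vs[OF same_vs_refl M(1) M(1)] bilinear_cong_vs[OF M(1) same_vs_refl M(1)] M
      by (auto intro!: bilinearI)
    fix x assume x: "x \<in> carrier M"
    have "\<forall>x\<in>carrier CV. gla \<one>\<^bsub>C\<^esub> x = x" "\<forall>x\<in>carrier CV. gra x \<one>\<^bsub>C\<^esub> = x"
      by (rule tensor_ext_ball[where U = CV]; simp add: gmod_simps sw_one act_one)+
    then show "lact M \<one>\<^bsub>C\<^esub> x = x" "ract M x \<one>\<^bsub>C\<^esub> = x" using x by (simp_all add: M)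
    fix a b assume [simp]: "a \<in> carrier C" "b \<in> carrier C"
    have "\<forall>x\<in>carrier CV. gla (a \<cdot> b) x = gla a (gla b x)"
      "\<forall>x\<in>carrier CV. gra x (a \<cdot> b) = gra (gra x a) b"
      "\<forall>x\<in>carrier CV. gra (gla a x) b = gla a (gra x b)"
      by (rule tensor_ext_ball[where U = CV]; simp add: gmod_simps sw_mult mult_assoc act_mult)+
    then show "lact M (a \<cdot> b) x = lact M a (lact M b x)" "ract M x (a \<cdot> b) = ract M (ract M x a) b"
      "ract M (lact M a x) b = lact M a (ract M x b)"
      using x by (simp_all add: M)
  qed
  then show ?thesis by (simp add: M_def)
qed

end

section \<open>The left dual of a bimodule\<close>

context bimodule
begin

notation amult (infixl "\<cdot>" 70)

abbreviation "LD \<equiv> left_dual k A M"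

lemma M_vs [simp]: "vectorspace k M"
  using linear_mapD(2)[OF bilinearD(1)[OF L.act_bilinear unit_closed]] .

lemma act_closed: "a \<in> carrier A \<Longrightarrow> x \<in> carrier M \<Longrightarrow> lact M a x \<in> carrier M"
  "a \<in> carrier A \<Longrightarrow> x \<in> carrier M \<Longrightarrow> ract M x a \<in> carrier M"
  by (rule bilinearD(3)[OF L.act_bilinear] bilinearD(3)[OF R.act_bilinear]; assumption)+

lemma LD_iff: "X \<in> carrier LD \<longleftrightarrow> X \<in> extensional (carrier M) \<and> linear_map k M A X \<and>
    (\<forall>a\<in>carrier A. \<forall>x\<in>carrier M. X (lact M a x) = a \<cdot> X x)"
  by (auto simp: left_dual_def)

lemma LD_restrictI:
  assumes "linear_map k M A f" "\<And>a x. a \<in> carrier A \<Longrightarrow> x \<in> carrier M \<Longrightarrow> f (lact M a x) = a \<cdot> f x"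
  shows "(\<lambda>x\<in>carrier M. f x) \<in> carrier LD"
  using assms by (auto simp: LD_iff act_closed intro: linear_map_cong[OF _ assms(1)])

lemma LD_D:
  assumes "X \<in> carrier LD"
  shows "linear_map k M A X" "x \<in> carrier M \<Longrightarrow> X x \<in> carrier A"
    "a \<in> carrier A \<Longrightarrow> x \<in> carrier M \<Longrightarrow> X (lact M a x) = a \<cdot> X x"
    "X \<in> extensional (carrier M)"
  using assms by (auto simp: LD_iff dest: linear_mapD(3))

lemma LD_simps:
  "\<zero>\<^bsub>LD\<^esub> = (\<lambda>x\<in>carrier M. \<zero>\<^bsub>A\<^esub>)"
  "X \<oplus>\<^bsub>LD\<^esub> Y = (\<lambda>x\<in>carrier M. X x \<oplus>\<^bsub>A\<^esub> Y x)"
  "c \<odot>\<^bsub>LD\<^esub> X = (\<lambda>x\<in>carrier M. c \<odot>\<^bsub>A\<^esub> X x)"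
  "lact LD a X = (\<lambda>x\<in>carrier M. X (ract M x a))"
  "ract LD X a = (\<lambda>x\<in>carrier M. X x \<cdot> a)"
  by (simp_all add: left_dual_def)

lemma LD_ops:
  assumes X: "X \<in> carrier LD" and c: "c \<in> carrier k" and a: "a \<in> carrier A"
  shows "Y \<in> carrier LD \<Longrightarrow> X \<oplus>\<^bsub>LD\<^esub> Y \<in> carrier LD" "c \<odot>\<^bsub>LD\<^esub> X \<in> carrier LD"
    "lact LD a X \<in> carrier LD" "ract LD X a \<in> carrier LD"
proof -
  interpret A: vectorspace k A by (rule vs)
  interpret RA: ring A by (rule ring)
  show "X \<oplus>\<^bsub>LD\<^esub> Y \<in> carrier LD" if Y: "Y \<in> carrier LD"
    unfolding LD_simps
    by (rule LD_restrictI[OF lin_add]) (simp_all add: LD_D[OF X] LD_D[OF Y] RA.r_distr)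
  show "c \<odot>\<^bsub>LD\<^esub> X \<in> carrier LD" unfolding LD_simps
    by (rule LD_restrictI[OF lin_smult_r]) (simp_all add: LD_D[OF X] c smult_mult_r)
  \<comment> \<open>Left linearity survives because the two actions on \<open>M\<close>
    commute.\<close>
  show "lact LD a X \<in> carrier LD" unfolding LD_simps
    by (rule LD_restrictI[OF lin_comp[OF LD_D(1)[OF X] bilinearD(2)[OF R.act_bilinear]]])
      (simp_all add: LD_D[OF X] a act_commute act_closed)
  show "ract LD X a \<in> carrier LD" unfolding LD_simps
    by (rule LD_restrictI[OF lin_mult_l]) (simp_all add: LD_D[OF X] a mult_assoc)
qed

lemma LD_vs: "vectorspace k LD"
proof (rule pointwise_vectorspace[OF vs, where Z = "carrier M"])
  interpret A: vectorspace k A by (rule vs)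
  interpret RA: ring A by (rule ring)
  show "\<zero>\<^bsub>LD\<^esub> \<in> carrier LD" unfolding LD_simps by (rule LD_restrictI[OF lin_zero]) simp_all
  show "X \<oplus>\<^bsub>LD\<^esub> Y \<in> carrier LD" if "X \<in> carrier LD" "Y \<in> carrier LD" for X Y
    by (rule LD_ops(1)[OF that(1) A.one_closed unit_closed that(2)])
  show "c \<odot>\<^bsub>LD\<^esub> X \<in> carrier LD" if "c \<in> carrier k" "X \<in> carrier LD" for c X
    by (rule LD_ops(2)[OF that(2,1) unit_closed])
qed (fact LD_D LD_simps)+

lemma lin_LDI:
  assumes "vectorspace k Z" "\<And>z. z \<in> carrier Z \<Longrightarrow> F z \<in> carrier LD"
    and "\<And>x. x \<in> carrier M \<Longrightarrow> linear_map k Z A (\<lambda>z. F z x)"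
  shows "linear_map k Z LD F"
  by (rule pointwise_linear[OF assms(1) LD_vs LD_simps(2,3) LD_D(4) assms(2,3)])

lemma lin_LD_eval: "x \<in> carrier M \<Longrightarrow> linear_map k LD A (\<lambda>X. X x)"
  by (rule linear_mapI[OF LD_vs vs]) (simp_all add: LD_D LD_simps)

lemma left_dual_bimodule: "bimodule k A LD"
proof (intro bimodule.intro left_module.intro right_module.intro bimodule_axioms.intro bilinearI)
  interpret A: vectorspace k A by (rule vs)
  note cl = LD_ops(3,4)[OF _ A.one_closed]
  have vs: "vectorspace k A" by (rule vs)
  show "k_algebra k A" by unfold_locales
  fix X assume X: "X \<in> carrier LD"
  note XD = LD_D[OF X]
  show "linear_map k A LD (ract LD X)"
    by (rule lin_LDI[OF vs cl(2)[OF X]]) (simp_all add: LD_simps XD)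
  show "linear_map k A LD (\<lambda>a. lact LD a X)"
    by (rule lin_LDI[OF vs cl(1)[OF X]])
      (simp_all add: LD_simps lin_comp[OF XD(1) bilinearD(1)[OF R.act_bilinear]])
  show "lact LD \<one>\<^bsub>A\<^esub> X = X" "ract LD X \<one>\<^bsub>A\<^esub> = X"
    unfolding LD_simps by (auto intro!: extensionalityI[of _ "carrier M"] simp: XD R.act_one)
  fix a b assume ab: "a \<in> carrier A" "b \<in> carrier A"
  show "lact LD (a \<cdot> b) X = lact LD a (lact LD b X)"
    "ract LD X (a \<cdot> b) = ract LD (ract LD X a) b"
    "ract LD (lact LD a X) b = lact LD a (ract LD X b)"
    unfolding LD_simps
    by (rule restrict_ext, use ab in \<open>simp add: XD R.act_mult act_closed mult_assoc\<close>)+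
next
  interpret A: vectorspace k A by (rule vs)
  note cl = LD_ops(3,4)[OF _ A.one_closed]
  fix a assume a: "a \<in> carrier A"
  show "linear_map k LD LD (lact LD a)"
    by (rule lin_LDI[OF LD_vs cl(1)[OF _ a]]) (simp_all add: LD_simps lin_LD_eval act_closed a)
  show "linear_map k LD LD (\<lambda>X. ract LD X a)"
    by (rule lin_LDI[OF LD_vs cl(2)[OF _ a]]) (simp_all add: LD_simps lin_LD_eval a)
qed

end

section \<open>Dual bases\<close>

lemma tens_finsum_l:
  assumes "vectorspace k P" "vectorspace k Q" "q \<in> carrier Q" "\<And>i. i \<in> I \<Longrightarrow> f i \<in> carrier P"
  shows "tens k P Q (\<Oplus>\<^bsub>P\<^esub>i\<in>I. f i) q = (\<Oplus>\<^bsub>tensor k P Q\<^esub>i\<in>I. tens k P Q (f i) q)"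
  by (rule linear_map_finsum[where k = k and f = "\<lambda>p. tens k P Q p q"]) (use assms in simp_all)

lemma tens_finsum_r:
  assumes "vectorspace k P" "vectorspace k Q" "p \<in> carrier P" "\<And>i. i \<in> I \<Longrightarrow> f i \<in> carrier Q"
  shows "tens k P Q p (\<Oplus>\<^bsub>Q\<^esub>i\<in>I. f i) = (\<Oplus>\<^bsub>tensor k P Q\<^esub>i\<in>I. tens k P Q p (f i))"
  by (rule linear_map_finsum[where k = k and f = "\<lambda>q. tens k P Q p q"]) (use assms in simp_all)

context vectorspace
begin

abbreviation "VD \<equiv> dual K V"

lemma dual_iff: "\<alpha> \<in> carrier VD \<longleftrightarrow> \<alpha> \<in> extensional (carrier V) \<and> linear_map K V (scalars K) \<alpha>"
  by (simp add: dual_def)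

lemma dual_simps:
  "\<zero>\<^bsub>VD\<^esub> = (\<lambda>v\<in>carrier V. \<zero>\<^bsub>K\<^esub>)" "\<alpha> \<oplus>\<^bsub>VD\<^esub> \<beta> = (\<lambda>v\<in>carrier V. \<alpha> v \<oplus>\<^bsub>K\<^esub> \<beta> v)"
  "c \<odot>\<^bsub>VD\<^esub> \<alpha> = (\<lambda>v\<in>carrier V. c \<otimes>\<^bsub>K\<^esub> \<alpha> v)"
  by (simp_all add: dual_def)

lemma dual_restrictI:
  assumes "linear_map K V (scalars K) f"
  shows "(\<lambda>v\<in>carrier V. f v) \<in> carrier VD"
  unfolding dual_iff using linear_map_cong[OF _ assms, of "restrict f (carrier V)"] by simp

lemma dual_lin [simp]: "\<alpha> \<in> carrier VD \<Longrightarrow> linear_map K V (scalars K) \<alpha>"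
  by (simp add: dual_iff)

lemma dual_closed [simp]: "\<alpha> \<in> carrier VD \<Longrightarrow> v \<in> carrier V \<Longrightarrow> \<alpha> v \<in> carrier K"
  using linear_mapD(3)[OF dual_lin] by (simp add: scalars_def)

lemma dual_eqI:
  assumes "\<alpha> \<in> carrier VD" "\<beta> \<in> carrier VD" "\<And>v. v \<in> carrier V \<Longrightarrow> \<alpha> v = \<beta> v"
  shows "\<alpha> = \<beta>"
  using assms by (intro extensionalityI[of _ "carrier V"]) (auto simp: dual_iff)

lemma dual_ops:
  assumes a: "\<alpha> \<in> carrier VD"
  shows "\<beta> \<in> carrier VD \<Longrightarrow> \<alpha> \<oplus>\<^bsub>VD\<^esub> \<beta> \<in> carrier VD" "c \<in> carrier K \<Longrightarrow> c \<odot>\<^bsub>VD\<^esub> \<alpha> \<in> carrier VD"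
proof -
  show "\<alpha> \<oplus>\<^bsub>VD\<^esub> \<beta> \<in> carrier VD" if b: "\<beta> \<in> carrier VD"
    using dual_restrictI[OF lin_add[OF dual_lin[OF a] dual_lin[OF b]]]
    by (simp add: dual_simps) (simp add: scalars_def)
  show "c \<odot>\<^bsub>VD\<^esub> \<alpha> \<in> carrier VD" if c: "c \<in> carrier K"
    using dual_restrictI[OF lin_smult_r[OF dual_lin[OF a] c]]
    by (simp add: dual_simps) (simp add: scalars_def)
qed

lemma dual_vs [simp]: "vectorspace K VD"
proof (rule pointwise_vectorspace[OF scalars_vs[OF field_axioms]])
  show "\<zero>\<^bsub>VD\<^esub> \<in> carrier VD"
    using dual_restrictI[OF lin_zero[OF vectorspace_axioms scalars_vs[OF field_axioms]]]
    by (simp add: dual_simps) (simp add: scalars_def)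
  show "f \<in> extensional (carrier V)" if "f \<in> carrier VD" for f
    using that by (simp add: dual_iff)
  show "f z \<in> carrier (scalars K)" if "f \<in> carrier VD" "z \<in> carrier V" for f z
    using that by (simp add: scalars_def)
  show "f \<oplus>\<^bsub>VD\<^esub> g \<in> carrier VD" if "f \<in> carrier VD" "g \<in> carrier VD" for f g
    by (rule dual_ops(1)[OF that])
  show "c \<odot>\<^bsub>VD\<^esub> f \<in> carrier VD" if "c \<in> carrier K" "f \<in> carrier VD" for c f
    by (rule dual_ops(2)[OF that(2,1)])
qed (simp_all add: dual_simps scalars_def)

lemma lin_eval [simp]:
  assumes "v \<in> carrier V"
  shows "linear_map K VD (scalars K) (\<lambda>\<alpha>. \<alpha> v)"
  by (rule linear_mapI[OF dual_vs scalars_vs[OF field_axioms]])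
    (use assms in \<open>simp_all add: dual_simps\<close>, simp_all add: scalars_def)

lemma lin_dualI:
  assumes "vectorspace K Z" "\<And>z. z \<in> carrier Z \<Longrightarrow> F z \<in> carrier VD"
    and "\<And>v. v \<in> carrier V \<Longrightarrow> linear_map K Z (scalars K) (\<lambda>z. F z v)"
  shows "linear_map K Z VD F"
  by (rule pointwise_linear[OF assms(1) dual_vs _ _ _ assms(2,3)])
    (simp_all add: dual_simps scalars_def dual_iff)

end

locale based_space = vectorspace k V
  for k :: "('k, 'r) ring_scheme" and V :: "('k, 'v, 'q) module_scheme" +
  fixes X :: "'v set"
  assumes basis: "basis X" and finite_X [simp]: "finite X"
begin

lemma X_carrier [simp]: "x \<in> X \<Longrightarrow> x \<in> carrier V"
  using basis by (auto simp: basis_def)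

text \<open>Extensional families make the coefficients unique as a function, so that the description
  is definite.\<close>

definition coord where
  "coord v = (THE a. a \<in> X \<rightarrow>\<^sub>E carrier k \<and> lincomb a X = v)"

lemma X_subset: "X \<subseteq> carrier V"
  using X_carrier by blast

lemma coord_ex1: "v \<in> carrier V \<Longrightarrow> \<exists>!a. a \<in> X \<rightarrow>\<^sub>E carrier k \<and> lincomb a X = v"
  using basis_criterion[OF finite_X X_subset] basis by blast

lemma coord:
  assumes "v \<in> carrier V"
  shows "coord v \<in> X \<rightarrow>\<^sub>E carrier k" "lincomb (coord v) X = v"
  using theI'[OF coord_ex1[OF assms]] by (auto simp: coord_def)

lemma coord_closed [simp]: "v \<in> carrier V \<Longrightarrow> x \<in> X \<Longrightarrow> coord v x \<in> carrier k"
  using coord(1) by blast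

text \<open>Uniqueness of coordinates in usable form: any coefficient family with the right sum
  computes \<open>coord\<close>. Linearity of coordinates and their values on the basis follow by
  exhibiting coefficients.\<close>

lemma coord_eqI:
  assumes a: "\<And>x. x \<in> X \<Longrightarrow> a x \<in> carrier k" and v: "lincomb a X = v" and x: "x \<in> X"
  shows "coord v x = a x"
proof -
  have c: "lincomb (restrict a X) X = v"
    unfolding v[symmetric] by (rule lincomb_cong) (use a X_subset in auto)
  have vc: "v \<in> carrier V" unfolding v[symmetric] using a X_subset by (intro lincomb_closed) auto
  have "restrict a X \<in> X \<rightarrow>\<^sub>E carrier k" using a by auto
  then have "coord v = restrict a X"
    using coord_ex1[OF vc] coord[OF vc] c by blast
  then show ?thesis using x by simp
qed

lemma coord_linear: "x \<in> X \<Longrightarrow> linear_map k V (scalars k) (\<lambda>v. coord v x)"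
proof (rule linear_mapI)
  assume x: "x \<in> X"
  show "vectorspace k (scalars k)" by (simp add: field_axioms)
  show "coord v x \<in> carrier (scalars k)" if "v \<in> carrier V" for v
    using that x by (simp add: scalars_def)
  have "coord (v \<oplus>\<^bsub>V\<^esub> w) x = coord v x \<oplus>\<^bsub>k\<^esub> coord w x" if v: "v \<in> carrier V" and w: "w \<in> carrier V" for v w
    by (rule coord_eqI)
      (use v w x lincomb_sum[OF finite_X X_subset, of "coord v" "coord w"] coord(2) in auto)
  then show "coord (v \<oplus>\<^bsub>V\<^esub> w) x = coord v x \<oplus>\<^bsub>scalars k\<^esub> coord w x"
    if "v \<in> carrier V" "w \<in> carrier V" for v w
    using that by (simp add: scalars_def)
  have "coord (c \<odot>\<^bsub>V\<^esub> v) x = c \<otimes>\<^bsub>k\<^esub> coord v x" if v: "v \<in> carrier V" and c: "c \<in> carrier k" for v c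
    by (rule coord_eqI) (use v c x lincomb_smult[OF X_subset _ c, of "coord v"] coord(2) in auto)
  then show "coord (c \<odot>\<^bsub>V\<^esub> v) x = c \<odot>\<^bsub>scalars k\<^esub> coord v x"
    if "c \<in> carrier k" "v \<in> carrier V" for c v
    using that by (simp add: scalars_def)
qed (rule vectorspace_axioms)

lemma coord_basis:
  assumes x: "x \<in> X" and y: "y \<in> X"
  shows "coord y x = (if y = x then \<one>\<^bsub>k\<^esub> else \<zero>\<^bsub>k\<^esub>)"
proof -
  let ?a = "\<lambda>x. if y = x then \<one>\<^bsub>k\<^esub> else \<zero>\<^bsub>k\<^esub>"
  have "lincomb ?a X = (\<Oplus>\<^bsub>V\<^esub>x\<in>X. if x = y then x else \<zero>\<^bsub>V\<^esub>)"
    unfolding lincomb_def by (rule finsum_eqI) (use X_subset in auto)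
  also have "\<dots> = y"
    using M.add.finprod_singleton_swap[of y X "\<lambda>x. x"] y X_subset by (auto simp: Pi_iff)
  finally show ?thesis by (intro coord_eqI) (use x in auto)
qed

lemma basis_expand: "v \<in> carrier V \<Longrightarrow> v = (\<Oplus>\<^bsub>V\<^esub>x\<in>X. coord v x \<odot>\<^bsub>V\<^esub> x)"
  using coord(2)[of v] by (simp add: lincomb_def)

lemma basis_ext:
  assumes f: "linear_map k V U f" and g: "linear_map k V U g"
    and eq: "\<And>x. x \<in> X \<Longrightarrow> f x = g x" and v: "v \<in> carrier V"
  shows "f v = g v"
  by (rule linear_eq_on_finsum[OF f g _ _ eq basis_expand[OF v]]) (use v in simp_all)

abbreviation "e \<equiv> dual_vec k V X"

text \<open>Replaces the definite description in \<open>dual_vec\<close> by an explicit coordinate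
  functional: coordinates have the required values on the basis, and values on the basis determine a
  functional.\<close>

lemma e_eq:
  assumes x: "x \<in> X"
  shows "e x = (\<lambda>v\<in>carrier V. coord v x)"
  unfolding dual_vec_def
proof (rule the_equality)
  show "(\<lambda>v\<in>carrier V. coord v x) \<in> carrier VD \<and>
      (\<forall>y\<in>X. (\<lambda>v\<in>carrier V. coord v x) y = (if y = x then \<one>\<^bsub>k\<^esub> else \<zero>\<^bsub>k\<^esub>))"
    using dual_restrictI[OF coord_linear[OF x]] x by (simp add: coord_basis)
next
  fix \<alpha> assume a: "\<alpha> \<in> carrier VD \<and> (\<forall>y\<in>X. \<alpha> y = (if y = x then \<one>\<^bsub>k\<^esub> else \<zero>\<^bsub>k\<^esub>))"
  show "\<alpha> = (\<lambda>v\<in>carrier V. coord v x)"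
  proof (rule dual_eqI)
    fix v assume "v \<in> carrier V"
    then show "\<alpha> v = (\<lambda>v\<in>carrier V. coord v x) v"
      using basis_ext[of "scalars k" \<alpha> "\<lambda>v. coord v x"] a coord_linear[OF x] x by (simp add: coord_basis)
  qed (use a dual_restrictI[OF coord_linear[OF x]] in auto)
qed

lemma e_closed [simp]: "x \<in> X \<Longrightarrow> e x \<in> carrier VD"
  using dual_restrictI[OF coord_linear] by (simp add: e_eq)

lemma e_basis: "x \<in> X \<Longrightarrow> y \<in> X \<Longrightarrow> e x y = (if y = x then \<one>\<^bsub>k\<^esub> else \<zero>\<^bsub>k\<^esub>)"
  by (simp add: e_eq coord_basis)

lemma e_expand: "v \<in> carrier V \<Longrightarrow> v = (\<Oplus>\<^bsub>V\<^esub>x\<in>X. e x v \<odot>\<^bsub>V\<^esub> x)"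
  using basis_expand[of v] finsum_eqI[of X "\<lambda>x. e x v \<odot>\<^bsub>V\<^esub> x" "\<lambda>x. coord v x \<odot>\<^bsub>V\<^esub> x" V] by (simp add: e_eq)

lemma finsum_delta:
  assumes U: "vectorspace k U" and x: "x \<in> X" and g: "\<And>y. y \<in> X \<Longrightarrow> g y \<in> carrier U"
  shows "(\<Oplus>\<^bsub>U\<^esub>y\<in>X. e y x \<odot>\<^bsub>U\<^esub> g y) = g x" "(\<Oplus>\<^bsub>U\<^esub>y\<in>X. e x y \<odot>\<^bsub>U\<^esub> g y) = g x"
proof -
  interpret U: vectorspace k U by fact
  have "(\<Oplus>\<^bsub>U\<^esub>y\<in>X. e y x \<odot>\<^bsub>U\<^esub> g y) = (\<Oplus>\<^bsub>U\<^esub>y\<in>X. if x = y then g y else \<zero>\<^bsub>U\<^esub>)"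
    by (rule finsum_eqI) (use x g in \<open>auto simp: e_basis\<close>)
  then show "(\<Oplus>\<^bsub>U\<^esub>y\<in>X. e y x \<odot>\<^bsub>U\<^esub> g y) = g x"
    using U.M.add.finprod_singleton[of x X g] x g by (auto simp: Pi_iff finsum_def)
  have "(\<Oplus>\<^bsub>U\<^esub>y\<in>X. e x y \<odot>\<^bsub>U\<^esub> g y) = (\<Oplus>\<^bsub>U\<^esub>y\<in>X. if x = y then g y else \<zero>\<^bsub>U\<^esub>)"
    by (rule finsum_eqI) (use x g in \<open>auto simp: e_basis\<close>)
  then show "(\<Oplus>\<^bsub>U\<^esub>y\<in>X. e x y \<odot>\<^bsub>U\<^esub> g y) = g x"
    using U.M.add.finprod_singleton[of x X g] x g by (auto simp: Pi_iff finsum_def)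
qed

lemma finsum_X_closed:
  assumes "vectorspace k U" "\<And>i. i \<in> X \<Longrightarrow> f i \<in> carrier U"
  shows "(\<Oplus>\<^bsub>U\<^esub>i\<in>X. f i) \<in> carrier U"
proof -
  interpret U: vectorspace k U by fact
  show ?thesis by (rule U.M.finsum_closed) (use assms in auto)
qed

lemma dual_expand:
  assumes a: "\<alpha> \<in> carrier VD"
  shows "\<alpha> = (\<Oplus>\<^bsub>VD\<^esub>x\<in>X. \<alpha> x \<odot>\<^bsub>VD\<^esub> e x)"
proof (rule dual_eqI[OF a])
  show c: "(\<Oplus>\<^bsub>VD\<^esub>x\<in>X. \<alpha> x \<odot>\<^bsub>VD\<^esub> e x) \<in> carrier VD"
    by (rule finsum_X_closed) (use a in \<open>simp_all add: dual_ops\<close>)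
  fix v assume v: "v \<in> carrier V"
  show "\<alpha> v = (\<Oplus>\<^bsub>VD\<^esub>x\<in>X. \<alpha> x \<odot>\<^bsub>VD\<^esub> e x) v"
  proof (rule basis_ext[OF dual_lin[OF a] dual_lin[OF c] _ v])
    fix x assume x: "x \<in> X"
    have "(\<Oplus>\<^bsub>VD\<^esub>x\<in>X. \<alpha> x \<odot>\<^bsub>VD\<^esub> e x) x = (\<Oplus>\<^bsub>scalars k\<^esub>y\<in>X. (\<alpha> y \<odot>\<^bsub>VD\<^esub> e y) x)"
      by (rule linear_map_finsum[OF lin_eval]) (use a x in \<open>simp_all add: dual_ops\<close>)
    also have "\<dots> = (\<Oplus>\<^bsub>scalars k\<^esub>y\<in>X. e y x \<odot>\<^bsub>scalars k\<^esub> \<alpha> y)"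
      by (rule finsum_eqI) (use a x in \<open>simp add: dual_simps, simp add: scalars_def R.m_comm\<close>)
    also have "\<dots> = \<alpha> x"
      by (rule finsum_delta(1)) (use a x in \<open>simp_all add: field_axioms\<close>, simp add: scalars_def)
    finally show "\<alpha> x = (\<Oplus>\<^bsub>VD\<^esub>x\<in>X. \<alpha> x \<odot>\<^bsub>VD\<^esub> e x) x" ..
  qed
qed

lemma dual_ext:
  assumes f: "linear_map k VD U f" and g: "linear_map k VD U g"
    and eq: "\<And>x. x \<in> X \<Longrightarrow> f (e x) = g (e x)" and a: "\<alpha> \<in> carrier VD"
  shows "f \<alpha> = g \<alpha>"
  by (rule linear_eq_on_finsum[OF f g _ _ eq dual_expand[OF a]]) (use a in simp_all)

text \<open>The first factor is contracted against coordinates. Taken with the basis of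
  \<open>V\<close>, and with the dual basis, whose coordinates are evaluations at basis vectors, it
  gives the expansions behind the coaction matrix and the left dual.\<close>

lemma tensor_expand:
  assumes [simp]: "vectorspace k P" "vectorspace k Q" "\<And>x. x \<in> X \<Longrightarrow> b x \<in> carrier P"
    "\<And>x. x \<in> X \<Longrightarrow> linear_map k P (scalars k) (f x)"
    and expand: "\<And>p. p \<in> carrier P \<Longrightarrow> p = (\<Oplus>\<^bsub>P\<^esub>x\<in>X. f x p \<odot>\<^bsub>P\<^esub> b x)"
    and t: "t \<in> carrier (tensor k P Q)"
  shows "t = (\<Oplus>\<^bsub>tensor k P Q\<^esub>x\<in>X. tens k P Q (b x) (tlift k P Q Q t (\<lambda>p q. f x p \<odot>\<^bsub>Q\<^esub> q)))"
proof -
  let ?T = "tensor k P Q"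
  let ?E = "\<lambda>x t. tlift k P Q Q t (\<lambda>p q. f x p \<odot>\<^bsub>Q\<^esub> q)"
  have fc [simp]: "f x p \<in> carrier k" if "x \<in> X" "p \<in> carrier P" for x p
    using linear_mapD(3)[OF assms(4)[OF that(1)] that(2)] by (simp add: scalars_def)
  note [simp] = vs_smult_closed[OF assms(1)] vs_smult_closed[OF assms(2)]
  have "tens k P Q p q = (\<Oplus>\<^bsub>?T\<^esub>x\<in>X. tens k P Q (b x) (?E x (tens k P Q p q)))"
    if [simp]: "p \<in> carrier P" "q \<in> carrier Q" for p q
  proof -
    have "tens k P Q p q = tens k P Q (\<Oplus>\<^bsub>P\<^esub>x\<in>X. f x p \<odot>\<^bsub>P\<^esub> b x) q"
      by (rule arg_cong[OF expand]) simp
    also have "\<dots> = (\<Oplus>\<^bsub>?T\<^esub>x\<in>X. tens k P Q (f x p \<odot>\<^bsub>P\<^esub> b x) q)"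
      by (rule tens_finsum_l) simp_all
    also have "\<dots> = (\<Oplus>\<^bsub>?T\<^esub>x\<in>X. tens k P Q (b x) (?E x (tens k P Q p q)))"
      by (rule finsum_eqI) (simp add: tens_smult_l tens_smult_r)
    finally show ?thesis .
  qed
  then have "\<forall>t\<in>carrier ?T. t = (\<Oplus>\<^bsub>?T\<^esub>x\<in>X. tens k P Q (b x) (?E x t))"
    by (intro tensor_ext_ball[where U = ?T] lin_finsum) simp_all
  with t show ?thesis by blast
qed

end

section \<open>The dual of a right-right Yetter--Drinfeld module\<close>

sublocale yd_right_right \<subseteq> bialg_right_module k C V act ..

context yd_right_right
begin

notation amult (infixl "\<cdot>" 70)

abbreviation "VC \<equiv> tensor k V C"

lemma rho_closed [simp]: "v \<in> carrier V \<Longrightarrow> \<rho> v \<in> carrier VC"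
  by (rule linear_mapD(3)[OF coact_linear])

lemma lin_rho [simp]: "linear_map k Z V f \<Longrightarrow> linear_map k Z VC (\<lambda>z. \<rho> (f z))"
  by (rule lin_comp[OF coact_linear])

lemma rho_coassoc:
  assumes [simp]: "v \<in> carrier V"
    and [simp]: "\<And>q r. q \<in> carrier C \<Longrightarrow> r \<in> carrier C \<Longrightarrow> linear_map k V U (\<lambda>p. \<beta> p q r)"
      "\<And>p r. p \<in> carrier V \<Longrightarrow> r \<in> carrier C \<Longrightarrow> linear_map k C U (\<lambda>q. \<beta> p q r)"
      "\<And>p q. p \<in> carrier V \<Longrightarrow> q \<in> carrier C \<Longrightarrow> linear_map k C U (\<lambda>r. \<beta> p q r)"
    and [simp]: "vectorspace k U"
  shows "tlift k V C U (\<rho> v) (\<lambda>w c. tlift k V C U (\<rho> w) (\<lambda>u d. \<beta> u d c)) =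
    tlift k V C U (\<rho> v) (\<lambda>w c. sw U c (\<lambda>c1 c2. \<beta> w c1 c2))"
proof -
  let ?X = "tensor k VC C"
  define L where "L = (\<lambda>t. tlift k VC C U t (\<lambda>s r. tlift k V C U s (\<lambda>p q. \<beta> p q r)))"
  have "L (tlift k V C ?X (\<rho> v) (\<lambda>w c. tens k VC C (\<rho> w) c)) =
      L (tlift k V C ?X (\<rho> v) (\<lambda>w c. sw ?X c (\<lambda>c1 c2. tens k VC C (tens k V C w c1) c2)))"
    by (simp only: coact_coassoc[OF assms(1)])
  then show ?thesis
    by (simp add: L_def pull)
qed

lemma rho_counit:
  assumes v: "v \<in> carrier V" and f: "linear_map k V U f"
  shows "tlift k V C U (\<rho> v) (\<lambda>w c. counit C c \<odot>\<^bsub>U\<^esub> f w) = f v"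
proof -
  have "f (tlift k V C V (\<rho> v) (\<lambda>x y. counit C y \<odot>\<^bsub>V\<^esub> x)) = f v" by (simp only: coact_counit[OF v])
  moreover have "f (tlift k V C V (\<rho> v) (\<lambda>x y. counit C y \<odot>\<^bsub>V\<^esub> x))
      = tlift k V C U (\<rho> v) (\<lambda>x y. f (counit C y \<odot>\<^bsub>V\<^esub> x))"
    by (rule tlift_comp[OF f]) (use v in \<open>simp_all add: vs_smult_closed[OF V_vs]\<close>)
  ultimately show ?thesis using v by (simp add: linear_mapD(5)[OF f])
qed

lemma yd_lift:
  assumes [simp]: "a \<in> carrier C" "v \<in> carrier V"
    and [simp]: "\<And>q. q \<in> carrier C \<Longrightarrow> linear_map k V U (\<lambda>p. \<beta> p q)"
      "\<And>p. p \<in> carrier V \<Longrightarrow> linear_map k C U (\<lambda>q. \<beta> p q)"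
    and [simp]: "vectorspace k U"
  shows "sw U a (\<lambda>a1 a2. tlift k V C U (\<rho> v) (\<lambda>v0 v1. \<beta> (act v0 a1) (v1 \<cdot> a2))) =
    sw U a (\<lambda>a1 a2. tlift k V C U (\<rho> (act v a2)) (\<lambda>u0 u1. \<beta> u0 (a1 \<cdot> u1)))"
proof -
  define L where "L = (\<lambda>t. tlift k V C U t \<beta>)"
  have "L (sw VC a (\<lambda>a1 a2. tlift k V C VC (\<rho> v) (\<lambda>v0 v1. tens k V C (act v0 a1) (v1 \<cdot> a2)))) =
      L (sw VC a (\<lambda>a1 a2. tlift k V C VC (\<rho> (act v a2)) (\<lambda>u0 u1. tens k V C u0 (a1 \<cdot> u1))))"
    by (simp only: yd[OF assms(1,2)])
  then show ?thesis
    by (simp add: L_def pull)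
qed

end

section \<open>Transposed action, inverse antipode and evaluation of tensors\<close>

locale yd_based = hopf_algebra k B S + yd_right_right k B V act \<rho> + based_space k V X
  for k :: "('k, 'r) ring_scheme" and B :: "('k, 'b, 'p) bialg_scheme" and S :: "'b \<Rightarrow> 'b"
    and V :: "('k, 'v, 'q) module_scheme" and act :: "'v \<Rightarrow> 'b \<Rightarrow> 'v"
    and \<rho> :: "'v \<Rightarrow> ('v \<times> 'b \<Rightarrow> 'k) set" and X :: "'v set" +
  assumes bij_S: "bij_betw S (carrier B) (carrier B)"
begin

notation amult (infixl "\<cdot>" 70)

abbreviation "tact \<equiv> transpose_action V act"
abbreviation "Sinv \<equiv> inv_into (carrier B) S"
abbreviation "BV \<equiv> tensor k B V"
abbreviation "BD \<equiv> tensor k B VD"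
abbreviation "DB \<equiv> tensor k VD B"

lemma tact_apply: "v \<in> carrier V \<Longrightarrow> tact a \<alpha> v = \<alpha> (act v a)"
  by (simp add: transpose_action_def)

lemma tact_closed [simp]: "a \<in> carrier B \<Longrightarrow> \<alpha> \<in> carrier VD \<Longrightarrow> tact a \<alpha> \<in> carrier VD"
  unfolding transpose_action_def
  by (rule dual_restrictI[OF lin_comp[OF dual_lin]]) simp_all

lemma tact_left_module: "left_module k B VD tact"
proof (intro left_module.intro bilinearI)
  fix a assume a: "a \<in> carrier B"
  show "linear_map k VD VD (tact a)"
    by (rule lin_dualI) (use a in \<open>simp_all add: tact_apply\<close>)
next
  fix \<alpha> assume \<alpha>: "\<alpha> \<in> carrier VD"
  show "linear_map k B VD (\<lambda>a. tact a \<alpha>)"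
    by (rule lin_dualI)
      (use \<alpha> in \<open>simp_all add: tact_apply lin_comp[OF dual_lin bilinearD(1)[OF act_bilinear]]\<close>)
  show "tact \<one>\<^bsub>B\<^esub> \<alpha> = \<alpha>"
    by (rule dual_eqI) (use \<alpha> in \<open>simp_all add: tact_apply act_one\<close>)
  fix a b assume "a \<in> carrier B" "b \<in> carrier B"
  then show "tact (a \<cdot> b) \<alpha> = tact a (tact b \<alpha>)"
    by (intro dual_eqI) (use \<alpha> in \<open>simp_all add: tact_apply act_mult\<close>)
qed

lemma lin_tact_l [simp]: "linear_map k Z B f \<Longrightarrow> \<alpha> \<in> carrier VD \<Longrightarrow> linear_map k Z VD (\<lambda>z. tact (f z) \<alpha>)"
  by (rule lin_comp[OF bilinearD(2)[OF left_module.act_bilinear[OF tact_left_module]]])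

lemma lin_tact_r [simp]: "linear_map k Z VD f \<Longrightarrow> a \<in> carrier B \<Longrightarrow> linear_map k Z VD (\<lambda>z. tact a (f z))"
  by (rule lin_comp[OF bilinearD(1)[OF left_module.act_bilinear[OF tact_left_module]]])

text \<open>The module axioms see only the algebra, which the co-opposite shares with
  \<open>B\<close>.\<close>

lemma tact_left_module_cop: "left_module k (cop k B) VD tact"
  using tact_left_module
  unfolding left_module_def bilinear_cong_vs[OF same_vs_cop same_vs_refl same_vs_refl] by simp

lemma Sinv [simp]: "b \<in> carrier B \<Longrightarrow> Sinv b \<in> carrier B" "b \<in> carrier B \<Longrightarrow> S (Sinv b) = b"
    "b \<in> carrier B \<Longrightarrow> Sinv (S b) = b"
  using bij_S inv_into_into[of b S "carrier B"] f_inv_into_f[of b S "carrier B"]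
  by (auto simp: bij_betw_def)

lemma S_inj: "a \<in> carrier B \<Longrightarrow> b \<in> carrier B \<Longrightarrow> S a = S b \<Longrightarrow> a = b"
  using Sinv(3) by metis

lemma Sinv_linear: "linear_map k B B Sinv"
proof (rule linear_mapI)
  note l = linear_mapD[OF antipode_linear]
  interpret BV: vectorspace k B by simp
  show "Sinv (a \<oplus>\<^bsub>B\<^esub> b) = Sinv a \<oplus>\<^bsub>B\<^esub> Sinv b" if "a \<in> carrier B" "b \<in> carrier B" for a b
    by (rule S_inj) (use that in \<open>simp_all add: l\<close>)
  show "Sinv (c \<odot>\<^bsub>B\<^esub> a) = c \<odot>\<^bsub>B\<^esub> Sinv a" if "c \<in> carrier k" "a \<in> carrier B" for a c
    by (rule S_inj) (use that in \<open>simp_all add: l\<close>)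
qed simp_all

lemma lin_Sinv [simp]: "linear_map k Z B f \<Longrightarrow> linear_map k Z B (\<lambda>z. Sinv (f z))"
  by (rule lin_comp[OF Sinv_linear])

lemmas Sinv_tlift = tlift_comp[OF Sinv_linear]

lemma counit_Sinv: "a \<in> carrier B \<Longrightarrow> counit B (Sinv a) = counit B a"
  using counit_S[of "Sinv a"] by simp

text \<open>This is the rule for \<open>S\<close> at \<open>Sinv a\<close>, with both arguments of
  the integrand precomposed with \<open>Sinv\<close>, so that the antipodes cancel.\<close>

lemma sw_Sinv:
  assumes [simp]: "a \<in> carrier B"
    and l: "\<And>v. v \<in> carrier B \<Longrightarrow> linear_map k B U (\<beta> v)"
    and r: "\<And>w. w \<in> carrier B \<Longrightarrow> linear_map k B U (\<lambda>v. \<beta> v w)"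
  shows "sw U (Sinv a) \<beta> = sw U a (\<lambda>x y. \<beta> (Sinv y) (Sinv x))"
proof -
  have "sw U (S (Sinv a)) (\<lambda>x y. \<beta> (Sinv y) (Sinv x)) = sw U (Sinv a) (\<lambda>x y. \<beta> (Sinv (S x)) (Sinv (S y)))"
    by (rule sw_S) (simp_all add: lin_comp[OF l] lin_comp[OF r])
  then show ?thesis by simp
qed

text \<open>In coordinates \<open>hat e\<^sup>x e\<^sub>y\<close> is the matrix entry \<open>R x y\<close> of the coaction.\<close>

definition hat where
  "hat \<alpha> v = tlift k V B B (\<rho> v) (\<lambda>w c. \<alpha> w \<odot>\<^bsub>B\<^esub> c)"

lemma hat_closed [simp]: "\<alpha> \<in> carrier VD \<Longrightarrow> v \<in> carrier V \<Longrightarrow> hat \<alpha> v \<in> carrier B"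
  by (simp add: hat_def)

lemma lin_hat_r [simp]: "linear_map k Z V f \<Longrightarrow> \<alpha> \<in> carrier VD \<Longrightarrow> linear_map k Z B (\<lambda>z. hat \<alpha> (f z))"
  by (simp add: hat_def)

lemma lin_hat_l' [simp]: "v \<in> carrier V \<Longrightarrow> linear_map k VD B (\<lambda>\<alpha>. hat \<alpha> v)"
  by (simp add: hat_def)

lemma lin_hat_l [simp]: "linear_map k Z VD f \<Longrightarrow> v \<in> carrier V \<Longrightarrow> linear_map k Z B (\<lambda>z. hat (f z) v)"
  by (rule lin_comp[OF lin_hat_l'])

text \<open>Evaluation of the dual factor at \<open>v\<close>. These maps jointly separate tensors,
  which makes them the test for equality in \<open>BD\<close>.\<close>

definition ev where
  "ev v t = tlift k B VD B t (\<lambda>b \<beta>. \<beta> v \<odot>\<^bsub>B\<^esub> b)"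

lemma ev_closed [simp]: "t \<in> carrier BD \<Longrightarrow> v \<in> carrier V \<Longrightarrow> ev v t \<in> carrier B"
  by (simp add: ev_def)

lemma lin_ev [simp]: "linear_map k Z BD f \<Longrightarrow> v \<in> carrier V \<Longrightarrow> linear_map k Z B (\<lambda>z. ev v (f z))"
  by (simp add: ev_def)

lemma lin_ev_l [simp]: "linear_map k Z V f \<Longrightarrow> t \<in> carrier BD \<Longrightarrow> linear_map k Z B (\<lambda>z. ev (f z) t)"
  by (rule lin_comp[of k V]) (simp_all add: ev_def)

lemma ev_tens: "b \<in> carrier B \<Longrightarrow> \<beta> \<in> carrier VD \<Longrightarrow> v \<in> carrier V \<Longrightarrow>
    ev v (tens k B VD b \<beta>) = \<beta> v \<odot>\<^bsub>B\<^esub> b"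
  by (simp add: ev_def)

lemmas ev_tlift = tlift_comp[OF lin_ev[OF lin_id]]

lemma BD_expand:
  assumes t: "t \<in> carrier BD"
  shows "t = (\<Oplus>\<^bsub>BD\<^esub>x\<in>X. tens k B VD (ev x t) (e x))"
proof -
  have "tens k B VD b \<beta> = (\<Oplus>\<^bsub>BD\<^esub>x\<in>X. tens k B VD (ev x (tens k B VD b \<beta>)) (e x))"
    if [simp]: "b \<in> carrier B" "\<beta> \<in> carrier VD" for b \<beta>
  proof -
    have "tens k B VD b \<beta> = tens k B VD b (\<Oplus>\<^bsub>VD\<^esub>x\<in>X. \<beta> x \<odot>\<^bsub>VD\<^esub> e x)"
      using dual_expand[of \<beta>] by simp
    also have "\<dots> = (\<Oplus>\<^bsub>BD\<^esub>x\<in>X. tens k B VD b (\<beta> x \<odot>\<^bsub>VD\<^esub> e x))"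
      by (rule linear_map_finsum[where k = k and f = "tens k B VD b"]) (simp_all add: dual_ops)
    also have "\<dots> = (\<Oplus>\<^bsub>BD\<^esub>x\<in>X. tens k B VD (ev x (tens k B VD b \<beta>)) (e x))"
      by (rule finsum_eqI) (simp add: ev_tens tens_smult_l tens_smult_r)
    finally show ?thesis .
  qed
  then have "\<forall>t\<in>carrier BD. t = (\<Oplus>\<^bsub>BD\<^esub>x\<in>X. tens k B VD (ev x t) (e x))"
    by (intro tensor_ext_ball[where U = BD] lin_finsum) simp_all
  with t show ?thesis by blast
qed

lemma BD_eqI:
  assumes "s \<in> carrier BD" "t \<in> carrier BD" "\<And>v. v \<in> carrier V \<Longrightarrow> ev v s = ev v t"
  shows "s = t"
  using BD_expand[OF assms(1)] BD_expand[OF assms(2)] assms(3)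
    finsum_eqI[of X "\<lambda>x. tens k B VD (ev x s) (e x)" "\<lambda>x. tens k B VD (ev x t) (e x)" BD]
  by simp

end

section \<open>The transposed coaction and the pairing identity\<close>

context yd_based
begin

lemma VB_expand:
  assumes t: "t \<in> carrier (tensor k V B)"
  shows "t = (\<Oplus>\<^bsub>tensor k V B\<^esub>x\<in>X. tens k V B x (tlift k V B B t (\<lambda>w c. e x w \<odot>\<^bsub>B\<^esub> c)))"
  by (rule tensor_expand[OF _ _ _ _ e_expand t]) (simp_all add: vectorspace_axioms)

lemma finsum_delta_alg:
  assumes "x \<in> X" "\<And>y. y \<in> X \<Longrightarrow> g y \<in> carrier B"
  shows "tlift k V B B (\<Oplus>\<^bsub>tensor k V B\<^esub>y\<in>X. tens k V B y (g y)) (\<lambda>w c. e x w \<odot>\<^bsub>B\<^esub> c) = g x"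
proof -
  have "tlift k V B B (\<Oplus>\<^bsub>tensor k V B\<^esub>y\<in>X. tens k V B y (g y)) (\<lambda>w c. e x w \<odot>\<^bsub>B\<^esub> c)
    = (\<Oplus>\<^bsub>B\<^esub>y\<in>X. tlift k V B B (tens k V B y (g y)) (\<lambda>w c. e x w \<odot>\<^bsub>B\<^esub> c))"
    by (rule linear_map_finsum[where k = k and f = "\<lambda>t. tlift k V B B t (\<lambda>w c. e x w \<odot>\<^bsub>B\<^esub> c)"])
      (use assms in simp_all)
  also have "\<dots> = (\<Oplus>\<^bsub>B\<^esub>y\<in>X. e x y \<odot>\<^bsub>B\<^esub> g y)"
    by (rule finsum_eqI) (use assms in simp)
  also have "\<dots> = g x" by (rule finsum_delta(2)) (use assms in simp_all)
  finally show ?thesis .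
qed

text \<open>Existence for the definite description is the expansion of \<open>\<rho> y\<close> along
  the basis; uniqueness holds because contracting with \<open>e x\<close> reads off a single
  coefficient.\<close>

lemma coaction_matrix:
  assumes "x \<in> X" "y \<in> X"
  shows "coaction_matrix k B V X \<rho> x y = hat (e x) y"
proof -
  define R where "R = (\<lambda>p\<in>X \<times> X. hat (e (fst p)) (snd p))"
  have RX: "R \<in> X \<times> X \<rightarrow>\<^sub>E carrier B" by (auto simp: R_def)
  have "(THE R. R \<in> X \<times> X \<rightarrow>\<^sub>E carrier B \<and>
      (\<forall>y\<in>X. \<rho> y = (\<Oplus>\<^bsub>tensor k V B\<^esub>x\<in>X. tens k V B x (R (x, y))))) = R"
  proof (rule the_equality)
    have r: "\<rho> y = (\<Oplus>\<^bsub>tensor k V B\<^esub>x\<in>X. tens k V B x (R (x, y)))" if y: "y \<in> X" for y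
    proof -
      have "\<rho> y = (\<Oplus>\<^bsub>tensor k V B\<^esub>x\<in>X. tens k V B x (hat (e x) y))"
        using VB_expand[of "\<rho> y"] y by (simp add: hat_def)
      also have "\<dots> = (\<Oplus>\<^bsub>tensor k V B\<^esub>x\<in>X. tens k V B x (R (x, y)))"
        by (rule finsum_eqI) (use y in \<open>simp add: R_def\<close>)
      finally show ?thesis .
    qed
    show "R \<in> X \<times> X \<rightarrow>\<^sub>E carrier B \<and> (\<forall>y\<in>X. \<rho> y = (\<Oplus>\<^bsub>tensor k V B\<^esub>x\<in>X. tens k V B x (R (x, y))))"
      using RX r by blast
  next
    fix Q assume Q: "Q \<in> X \<times> X \<rightarrow>\<^sub>E carrier B \<and>
      (\<forall>y\<in>X. \<rho> y = (\<Oplus>\<^bsub>tensor k V B\<^esub>x\<in>X. tens k V B x (Q (x, y))))"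
    have "Q (x, y) = R (x, y)" if "x \<in> X" "y \<in> X" for x y
    proof -
      have "hat (e x) y = tlift k V B B (\<Oplus>\<^bsub>tensor k V B\<^esub>x\<in>X. tens k V B x (Q (x, y))) (\<lambda>w c. e x w \<odot>\<^bsub>B\<^esub> c)"
        unfolding hat_def using bspec[OF conjunct2[OF Q] that(2)] by (rule arg_cong)
      also have "\<dots> = Q (x, y)"
        by (rule finsum_delta_alg[OF that(1)]) (use conjunct1[OF Q] that(2) in \<open>blast intro: PiE_mem\<close>)
      finally show ?thesis using that by (simp add: R_def)
    qed
    then show "Q = R"
      using conjunct1[OF Q] RX by (intro PiE_ext[of Q "X \<times> X" "\<lambda>_. carrier B" R]) auto
  qed
  then show ?thesis using assms by (simp add: coaction_matrix_def R_def)
qed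

abbreviation "tc \<equiv> transpose_coaction k B V X \<rho>"

lemma tc_eq: "tc \<alpha> = (\<Oplus>\<^bsub>BD\<^esub>x\<in>X. \<alpha> x \<odot>\<^bsub>BD\<^esub> (\<Oplus>\<^bsub>BD\<^esub>y\<in>X. tens k B VD (hat (e x) y) (e y)))"
  unfolding transpose_coaction_def Let_def
  by (intro finsum_eqI arg_cong2[where f = "smult BD"] refl) (simp add: coaction_matrix)

lemma lin_tc' [simp]: "linear_map k VD BD tc"
  unfolding tc_eq[abs_def]
  by (rule lin_finsum) (simp_all add: finsum_X_closed)

lemma lin_tc [simp]: "linear_map k Z VD f \<Longrightarrow> linear_map k Z BD (\<lambda>z. tc (f z))"
  by (rule lin_comp[OF lin_tc'])

lemma tc_closed [simp]: "\<alpha> \<in> carrier VD \<Longrightarrow> tc \<alpha> \<in> carrier BD"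
  by (rule linear_mapD(3)[OF lin_tc'])

text \<open>The transposed coaction becomes basis-free here: its evaluations are given by
  \<open>hat\<close>, which mentions no basis. Both sides are linear in the functional and in the
  vector, so the dual basis and the basis suffice for the check.\<close>

lemma ev_tc:
  assumes a: "\<alpha> \<in> carrier VD" and v: "v \<in> carrier V"
  shows "ev v (tc \<alpha>) = hat \<alpha> v"
proof -
  have *: "ev v (tc (e x)) = hat (e x) v" if x: "x \<in> X" and v: "v \<in> X" for x v
  proof -
    have vV: "v \<in> carrier V" using v by simp
    have t: "tens k B VD (hat (e x) y) (e y) \<in> carrier BD" if "y \<in> X" for y
      using x that by simp
    have "tc (e x) = (\<Oplus>\<^bsub>BD\<^esub>y\<in>X. tens k B VD (hat (e x) y) (e y))"
      unfolding tc_eq by (rule finsum_delta(2)) (use x in \<open>simp_all add: finsum_X_closed\<close>)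
    then have "ev v (tc (e x)) = ev v (\<Oplus>\<^bsub>BD\<^esub>y\<in>X. tens k B VD (hat (e x) y) (e y))"
      by (rule arg_cong)
    also have "\<dots> = (\<Oplus>\<^bsub>B\<^esub>y\<in>X. ev v (tens k B VD (hat (e x) y) (e y)))"
      by (rule linear_map_finsum[OF lin_ev[OF lin_id vV] t]) simp_all
    also have "\<dots> = (\<Oplus>\<^bsub>B\<^esub>y\<in>X. e y v \<odot>\<^bsub>B\<^esub> hat (e x) y)"
      by (rule finsum_eqI) (use x v in \<open>simp add: ev_tens\<close>)
    also have "\<dots> = hat (e x) v" by (rule finsum_delta(1)) (use x v in simp_all)
    finally show ?thesis .
  qed
  have l: "linear_map k VD B (\<lambda>\<alpha>. ev v (tc \<alpha>))" if "v \<in> carrier V" for v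
    by (rule lin_ev[OF lin_tc' that])
  have **: "ev v (tc \<alpha>) = hat \<alpha> v" if v: "v \<in> X" for v
    by (rule dual_ext[OF l[OF X_carrier[OF v]] lin_hat_l'[OF X_carrier[OF v]] *[OF _ v] a])
  show ?thesis
    by (rule basis_ext[OF lin_ev_l[OF lin_id tc_closed[OF a]] lin_hat_r[OF lin_id a] ** v])
      (simp_all add: vectorspace_axioms)
qed

text \<open>Coassociativity of \<open>\<rho>\<close>; in coordinates, the coproduct of
  \<open>R x y\<close> is the sum over \<open>z\<close> of
  \<open>R x z \<otimes> R z y\<close>.\<close>

lemma comult_hat:
  assumes [simp]: "\<alpha> \<in> carrier VD" "v \<in> carrier V"
  shows "comult B (hat \<alpha> v) = tlift k V B BB (\<rho> v) (\<lambda>u d. tens k B B (hat \<alpha> u) d)"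
proof -
  have "tlift k V B BB (\<rho> v) (\<lambda>u d. tens k B B (hat \<alpha> u) d) =
    tlift k V B BB (\<rho> v) (\<lambda>w c. tlift k V B BB (\<rho> w) (\<lambda>u d. \<alpha> u \<odot>\<^bsub>BB\<^esub> tens k B B d c))"
    by (simp add: hat_def pull tens_smult_l)
  also have "\<dots> = tlift k V B BB (\<rho> v) (\<lambda>w c. sw BB c (\<lambda>c1 c2. \<alpha> w \<odot>\<^bsub>BB\<^esub> tens k B B c1 c2))"
    by (rule rho_coassoc) simp_all
  also have "\<dots> = tlift k V B BB (\<rho> v) (\<lambda>w c. \<alpha> w \<odot>\<^bsub>BB\<^esub> sw BB c (\<lambda>c1 c2. tens k B B c1 c2))"
    by (simp add: smult_tlift)
  also have "\<dots> = tlift k V B BB (\<rho> v) (\<lambda>w c. comult B (\<alpha> w \<odot>\<^bsub>B\<^esub> c))"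
  proof -
    \<comment> \<open>Summing the pure tensors of the components reassembles the tensor
      itself.\<close>
    have *: "\<forall>t\<in>carrier BB. tlift k B B BB t (\<lambda>c1 c2. tens k B B c1 c2) = t"
      by (rule tensor_ext_ball[where U = BB]) simp_all
    have "\<alpha> w \<odot>\<^bsub>BB\<^esub> sw BB c (\<lambda>c1 c2. tens k B B c1 c2) = comult B (\<alpha> w \<odot>\<^bsub>B\<^esub> c)"
      if "w \<in> carrier V" "c \<in> carrier B" for w c
      using bspec[OF *, of "comult B c"] linear_mapD(5)[OF comult_linear, of "\<alpha> w" c] that by simp
    then show ?thesis by (intro tlift_cong[OF refl]) simp_all
  qed
  also have "\<dots> = comult B (hat \<alpha> v)"
    by (simp add: hat_def comult_tlift)
  finally show ?thesis ..
qed

lemma sw_hat: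
  assumes [simp]: "\<alpha> \<in> carrier VD" "v \<in> carrier V"
    and l: "\<And>v. v \<in> carrier B \<Longrightarrow> linear_map k B U (\<beta> v)"
    and r: "\<And>w. w \<in> carrier B \<Longrightarrow> linear_map k B U (\<lambda>v. \<beta> v w)"
  shows "sw U (hat \<alpha> v) \<beta> = tlift k V B U (\<rho> v) (\<lambda>u d. \<beta> (hat \<alpha> u) d)"
proof -
  have [simp]: "vectorspace k U" using linear_mapD(2)[OF l[OF unit_closed]] .
  show ?thesis by (simp add: comult_hat pull l r)
qed

text \<open>The counit law of \<open>\<rho>\<close>, read on matrix entries: their counits are
  Kronecker deltas.\<close>

lemma counit_hat:
  assumes [simp]: "\<alpha> \<in> carrier VD" "v \<in> carrier V"
  shows "counit B (hat \<alpha> v) = \<alpha> v"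
proof -
  have "counit B (hat \<alpha> v) = tlift k V B (scalars k) (\<rho> v) (\<lambda>w c. counit B (\<alpha> w \<odot>\<^bsub>B\<^esub> c))"
    unfolding hat_def by (rule tlift_comp[OF counit_linear]) simp_all
  also have "\<dots> = tlift k V B (scalars k) (\<rho> v) (\<lambda>w c. counit B c \<odot>\<^bsub>scalars k\<^esub> \<alpha> w)"
    by (simp add: linear_mapD(5)[OF counit_linear], simp add: scalars_def R.m_comm)
  also have "\<dots> = \<alpha> v" by (rule rho_counit) simp_all
  finally show ?thesis .
qed

text \<open>The coaction on the dual with both flips cancelled: passing to the co-opposite exchanges
  the legs and the push-forward exchanges them back.\<close>

definition dco where
  "dco \<alpha> = tlift k B VD BD (tc \<alpha>) (\<lambda>c w. tens k B VD (Sinv c) w)"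

lemma lin_dco [simp]: "linear_map k Z VD f \<Longrightarrow> linear_map k Z BD (\<lambda>z. dco (f z))"
  by (simp add: dco_def)

lemma dco_closed [simp]: "\<alpha> \<in> carrier VD \<Longrightarrow> dco \<alpha> \<in> carrier BD"
  by (simp add: dco_def)

lemma ev_dco:
  assumes [simp]: "\<alpha> \<in> carrier VD" "v \<in> carrier V"
  shows "ev v (dco \<alpha>) = Sinv (hat \<alpha> v)"
proof -
  have "ev v (dco \<alpha>) = Sinv (ev v (tc \<alpha>))"
    by (simp add: dco_def ev_tlift ev_tens)
      (simp add: ev_def Sinv_tlift linear_mapD(5)[OF Sinv_linear])
  then show ?thesis by (simp add: ev_tc)
qed

text \<open>Calculations with the new coaction take this shape once the dual factor is evaluated:
  the functional becomes a scalar, and \<open>f\<close> collects what happens to the algebra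
  leg.\<close>

lemma tlift_dco_eval:
  assumes [simp]: "\<alpha> \<in> carrier VD" "v \<in> carrier V" and f: "linear_map k B U f"
  shows "tlift k B VD U (dco \<alpha>) (\<lambda>c w. w v \<odot>\<^bsub>U\<^esub> f c) = f (Sinv (hat \<alpha> v))"
proof -
  have "f (ev v (dco \<alpha>)) = tlift k B VD U (dco \<alpha>) (\<lambda>c w. f (w v \<odot>\<^bsub>B\<^esub> c))"
    unfolding ev_def by (rule tlift_comp[OF f]) simp_all
  then show ?thesis by (simp add: ev_dco linear_mapD(5)[OF f])
qed

lemma push_cop_eq:
  assumes "\<alpha> \<in> carrier VD"
  shows "push_right_to_left k B VD Sinv (coact_cop_of_left k B VD tc) \<alpha> = dco \<alpha>"
  unfolding push_right_to_left_def coact_cop_of_left_def dco_def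
  by (rule tlift_flip) (use assms in simp_all)

text \<open>The transposed coaction contributes the matrix and the pushed coaction of
  \<open>v\<close> its antipode, so in coordinates the sum over \<open>m\<close> of
  \<open>R k m S(R m i)\<close> has to be the Kronecker delta times 1.\<close>

lemma pairing_identity:
  assumes [simp]: "\<alpha> \<in> carrier VD" "v \<in> carrier V"
  shows "tensor_pairing k B V (tc \<alpha>) (push_left_to_right k B V S (coact_cop_of_right k B V \<rho>) v)
    = \<alpha> v \<odot>\<^bsub>B\<^esub> \<one>\<^bsub>B\<^esub>"
proof -
  have p: "push_left_to_right k B V S (coact_cop_of_right k B V \<rho>) v =
      tlift k V B (tensor k V B) (\<rho> v) (\<lambda>w c. tens k V B w (S c))"
    unfolding push_left_to_right_def coact_cop_of_right_def by (rule tlift_flip) simp_all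
  have "tensor_pairing k B V (tc \<alpha>) (push_left_to_right k B V S (coact_cop_of_right k B V \<rho>) v) =
    tlift k B VD B (tc \<alpha>) (\<lambda>a \<beta>. tlift k V B B (\<rho> v) (\<lambda>w c. \<beta> w \<odot>\<^bsub>B\<^esub> (a \<cdot> S c)))"
    by (simp add: tensor_pairing_def p pull)
  \<comment> \<open>The exchange makes \<open>tc \<alpha>\<close> the inner sum, where evaluation at
    \<open>w\<close> turns it into \<open>hat \<alpha> w\<close>.\<close>
  also have "\<dots> = tlift k V B B (\<rho> v) (\<lambda>w c. tlift k B VD B (tc \<alpha>) (\<lambda>a \<beta>. \<beta> w \<odot>\<^bsub>B\<^esub> (a \<cdot> S c)))"
    by (rule tlift_swap) simp_all
  also have "\<dots> = tlift k V B B (\<rho> v) (\<lambda>w c. ev w (tc \<alpha>) \<cdot> S c)"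
    by (simp add: ev_def pull_alg smult_mult_l)
  also have "\<dots> = tlift k V B B (\<rho> v) (\<lambda>w c. tlift k V B B (\<rho> w) (\<lambda>u d. \<alpha> u \<odot>\<^bsub>B\<^esub> (d \<cdot> S c)))"
    by (simp add: ev_tc) (simp add: hat_def pull_alg smult_mult_l)
  also have "\<dots> = tlift k V B B (\<rho> v) (\<lambda>u c. sw B c (\<lambda>d c'. \<alpha> u \<odot>\<^bsub>B\<^esub> (d \<cdot> S c')))"
    by (rule rho_coassoc) simp_all
  also have "\<dots> = tlift k V B B (\<rho> v) (\<lambda>u c. counit B c \<odot>\<^bsub>B\<^esub> (\<alpha> u \<odot>\<^bsub>B\<^esub> \<one>\<^bsub>B\<^esub>))"
  proof -
    interpret BV: vectorspace k B by simp
    show ?thesis by (simp add: antipode_r R.m_comm flip: smult_tlift BV.smult_assoc1)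
  qed
  also have "\<dots> = \<alpha> v \<odot>\<^bsub>B\<^esub> \<one>\<^bsub>B\<^esub>"
    by (rule rho_counit) simp_all
  finally show ?thesis .
qed

end

section \<open>The Yetter-Drinfeld structure on the dual\<close>

context yd_based
begin

abbreviation "B_BD \<equiv> tensor k B BD"

definition ev2 where
  "ev2 v t = tlift k B BD BB t (\<lambda>p s. tens k B B p (ev v s))"

lemma ev2_closed [simp]: "t \<in> carrier B_BD \<Longrightarrow> v \<in> carrier V \<Longrightarrow> ev2 v t \<in> carrier BB"
  by (simp add: ev2_def)

lemma lin_ev2 [simp]: "linear_map k Z B_BD f \<Longrightarrow> v \<in> carrier V \<Longrightarrow> linear_map k Z BB (\<lambda>z. ev2 v (f z))"
  by (simp add: ev2_def)

lemma ev2_tens: "p \<in> carrier B \<Longrightarrow> s \<in> carrier BD \<Longrightarrow> v \<in> carrier V \<Longrightarrow>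
    ev2 v (tens k B BD p s) = tens k B B p (ev v s)"
  by (simp add: ev2_def)

lemmas ev2_tlift = tlift_comp[OF lin_ev2[OF lin_id]]

text \<open>The summand along \<open>e x\<close>: evaluate the innermost factor at \<open>x\<close>,
  then put \<open>e x\<close> back. Summing over \<open>X\<close> recovers the tensor, so the maps
  \<open>ev2\<close> separate elements.\<close>

definition reb where
  "reb x t = tlift k B B B_BD (ev2 x t) (\<lambda>p q. tens k B BD p (tens k B VD q (e x)))"

lemma lin_reb: "x \<in> X \<Longrightarrow> linear_map k B_BD B_BD (reb x)"
  unfolding reb_def[abs_def] by simp

lemma B_BD_expand:
  assumes t: "t \<in> carrier B_BD"
  shows "t = (\<Oplus>\<^bsub>B_BD\<^esub>x\<in>X. reb x t)"
proof -
  have "tens k B BD p s = (\<Oplus>\<^bsub>B_BD\<^esub>x\<in>X. reb x (tens k B BD p s))"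
    if p: "p \<in> carrier B" and s: "s \<in> carrier BD" for p s
  proof -
    have "tens k B BD p s = tens k B BD p (\<Oplus>\<^bsub>BD\<^esub>x\<in>X. tens k B VD (ev x s) (e x))"
      by (rule arg_cong[OF BD_expand[OF s]])
    also have "\<dots> = (\<Oplus>\<^bsub>B_BD\<^esub>x\<in>X. tens k B BD p (tens k B VD (ev x s) (e x)))"
      by (rule tens_finsum_r) (use p s in simp_all)
    also have "\<dots> = (\<Oplus>\<^bsub>B_BD\<^esub>x\<in>X. reb x (tens k B BD p s))"
      by (rule finsum_eqI) (use p s in \<open>simp add: reb_def ev2_tens\<close>)
    finally show ?thesis .
  qed
  then have "\<forall>t\<in>carrier B_BD. t = (\<Oplus>\<^bsub>B_BD\<^esub>x\<in>X. reb x t)"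
    by (intro tensor_ext_ball[where U = B_BD] lin_finsum lin_reb) simp_all
  with t show ?thesis by blast
qed

lemma B_BD_eqI:
  assumes "s \<in> carrier B_BD" "t \<in> carrier B_BD" "\<And>v. v \<in> carrier V \<Longrightarrow> ev2 v s = ev2 v t"
  shows "s = t"
proof -
  have "(\<Oplus>\<^bsub>B_BD\<^esub>x\<in>X. reb x s) = (\<Oplus>\<^bsub>B_BD\<^esub>x\<in>X. reb x t)"
    by (rule finsum_eqI) (use assms in \<open>simp add: reb_def\<close>)
  then show ?thesis using B_BD_expand[OF assms(1)] B_BD_expand[OF assms(2)] by simp
qed

text \<open>Two reversals cancel: the inverse antipode reverses the coproduct of
  \<open>hat \<alpha> v\<close>, and the co-opposite, written here by exchanging \<open>x\<close>
  and \<open>y\<close>, reverses it again.\<close>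

lemma dco_coassoc:
  assumes [simp]: "\<alpha> \<in> carrier VD"
  shows "tlift k B VD B_BD (dco \<alpha>) (\<lambda>c w. sw B_BD c (\<lambda>x y. tens k B BD y (tens k B VD x w))) =
    tlift k B VD B_BD (dco \<alpha>) (\<lambda>c w. tens k B BD c (dco w))" (is "?L = ?R")
proof (rule B_BD_eqI)
  fix v assume [simp]: "v \<in> carrier V"
  have "ev2 v ?L = tlift k B VD BB (dco \<alpha>) (\<lambda>c w. w v \<odot>\<^bsub>BB\<^esub> sw BB c (\<lambda>x y. tens k B B y x))"
    by (simp add: ev2_tlift ev2_tens ev_tens tens_smult_r smult_tlift)
  also have "\<dots> = sw BB (Sinv (hat \<alpha> v)) (\<lambda>x y. tens k B B y x)"
    by (rule tlift_dco_eval) simp_all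
  also have "\<dots> = sw BB (hat \<alpha> v) (\<lambda>x y. tens k B B (Sinv x) (Sinv y))"
    by (rule sw_Sinv) simp_all
  also have "\<dots> = tlift k V B BB (\<rho> v) (\<lambda>u d. tens k B B (Sinv (hat \<alpha> u)) (Sinv d))"
    by (rule sw_hat) simp_all
  finally have L: "ev2 v ?L = \<dots>" .
  \<comment> \<open>On this side the inner coaction is evaluated first, which brings in
    \<open>\<rho> v\<close>; after the exchange the outer one is evaluated at the vector component
    of \<open>\<rho> v\<close>.\<close>
  have "ev2 v ?R = tlift k B VD BB (dco \<alpha>) (\<lambda>c w. tlift k V B BB (\<rho> v) (\<lambda>u d. w u \<odot>\<^bsub>BB\<^esub> tens k B B c (Sinv d)))"
    by (simp add: ev2_tlift ev2_tens ev_dco)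
      (simp add: hat_def Sinv_tlift linear_mapD(5)[OF Sinv_linear] tens_tlift_r tens_smult_r)
  also have "\<dots> = tlift k V B BB (\<rho> v) (\<lambda>u d. tlift k B VD BB (dco \<alpha>) (\<lambda>c w. w u \<odot>\<^bsub>BB\<^esub> tens k B B c (Sinv d)))"
    by (rule tlift_swap) simp_all
  also have "\<dots> = tlift k V B BB (\<rho> v) (\<lambda>u d. tens k B B (Sinv (hat \<alpha> u)) (Sinv d))"
    by (rule tlift_cong[OF refl], simp_all, rule tlift_dco_eval, simp_all)
  finally show "ev2 v ?L = ev2 v ?R" using L by simp
qed simp_all

lemma dco_counit:
  assumes [simp]: "\<alpha> \<in> carrier VD"
  shows "tlift k B VD VD (dco \<alpha>) (\<lambda>c w. counit B c \<odot>\<^bsub>VD\<^esub> w) = \<alpha>"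
proof (rule dual_eqI)
  show "tlift k B VD VD (dco \<alpha>) (\<lambda>c w. counit B c \<odot>\<^bsub>VD\<^esub> w) \<in> carrier VD"
    by (simp add: dual_ops)
  fix v assume v [simp]: "v \<in> carrier V"
  have "tlift k B VD VD (dco \<alpha>) (\<lambda>c w. counit B c \<odot>\<^bsub>VD\<^esub> w) v =
      tlift k B VD (scalars k) (dco \<alpha>) (\<lambda>c w. (counit B c \<odot>\<^bsub>VD\<^esub> w) v)"
    by (rule tlift_comp[OF lin_eval[OF v]]) (simp_all add: dual_ops)
  also have "\<dots> = tlift k B VD (scalars k) (dco \<alpha>) (\<lambda>c w. w v \<odot>\<^bsub>scalars k\<^esub> counit B c)"
    by (rule tlift_cong[OF refl]) (simp_all add: dual_simps scalars_def R.m_comm)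
  also have "\<dots> = counit B (Sinv (hat \<alpha> v))"
    by (rule tlift_dco_eval) (simp_all add: counit_linear)
  also have "\<dots> = \<alpha> v" by (simp add: counit_Sinv counit_hat)
  finally show "tlift k B VD VD (dco \<alpha>) (\<lambda>c w. counit B c \<odot>\<^bsub>VD\<^esub> w) v = \<alpha> v" .
qed simp

lemma hat_tact:
  assumes [simp]: "\<alpha> \<in> carrier VD" "v \<in> carrier V" "a \<in> carrier B"
  shows "hat (tact a \<alpha>) v = tlift k V B B (\<rho> v) (\<lambda>w c. \<alpha> (act w a) \<odot>\<^bsub>B\<^esub> c)"
  unfolding hat_def by (rule tlift_cong[OF refl]) (simp_all add: tact_apply)

text \<open>The Yetter--Drinfeld condition of \<open>V\<close>, solved for the coaction of \<open>v.a\<close> with the antipode.\<close>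

lemma hat_act:
  assumes [simp]: "\<alpha> \<in> carrier VD" "v \<in> carrier V" "a \<in> carrier B"
  shows "hat \<alpha> (act v a) = sw B a (\<lambda>p y. S p \<cdot> sw B y (\<lambda>q x. hat (tact q \<alpha>) v \<cdot> x))"
proof -
  have yd': "sw B y (\<lambda>q x. q \<cdot> hat \<alpha> (act v x)) = sw B y (\<lambda>q x. hat (tact q \<alpha>) v \<cdot> x)"
    if [simp]: "y \<in> carrier B" for y
  proof -
    have "sw B y (\<lambda>q x. hat (tact q \<alpha>) v \<cdot> x) =
      sw B y (\<lambda>q x. tlift k V B B (\<rho> v) (\<lambda>v0 v1. \<alpha> (act v0 q) \<odot>\<^bsub>B\<^esub> (v1 \<cdot> x)))"
      by (simp add: hat_tact mult_tlift_l smult_mult_l)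
    also have "\<dots> = sw B y (\<lambda>q x. tlift k V B B (\<rho> (act v x)) (\<lambda>u0 u1. \<alpha> u0 \<odot>\<^bsub>B\<^esub> (q \<cdot> u1)))"
      by (rule yd_lift[where \<beta> = "\<lambda>u c. \<alpha> u \<odot>\<^bsub>B\<^esub> c"]) simp_all
    also have "\<dots> = sw B y (\<lambda>q x. q \<cdot> hat \<alpha> (act v x))"
      by (simp add: hat_def mult_tlift_r smult_mult_r)
    finally show ?thesis ..
  qed
  \<comment> \<open>The counit is expanded as \<open>S(p) q\<close>, and coassociativity groups
    \<open>q\<close> with \<open>x\<close>, so that \<open>yd'\<close> applies to their sum.\<close>
  have "hat \<alpha> (act v a) = sw B a (\<lambda>z x. counit B z \<odot>\<^bsub>B\<^esub> hat \<alpha> (act v x))"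
    by (rule sw_counit_l[symmetric]) simp_all
  also have "\<dots> = sw B a (\<lambda>z x. sw B z (\<lambda>p q. S p \<cdot> q) \<cdot> hat \<alpha> (act v x))"
    by (simp add: antipode_l smult_mult_l)
  also have "\<dots> = sw B a (\<lambda>z x. sw B z (\<lambda>p q. S p \<cdot> (q \<cdot> hat \<alpha> (act v x))))"
    by (simp add: mult_tlift_l mult_assoc)
  also have "\<dots> = sw B a (\<lambda>p y. sw B y (\<lambda>q x. S p \<cdot> (q \<cdot> hat \<alpha> (act v x))))"
    by (rule sw_coassoc) simp_all
  also have "\<dots> = sw B a (\<lambda>p y. S p \<cdot> sw B y (\<lambda>q x. hat (tact q \<alpha>) v \<cdot> x))"
    by (simp flip: mult_tlift_r yd')
  finally show ?thesis .
qed

text \<open>\<open>hat_act\<close> leaves a factor \<open>x\<close> on the right; the additional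
  \<open>S y\<close> meets it and cancels by the antipode axiom, so only the factor
  \<open>S p\<close> on the left remains.\<close>

lemma hat_act_S:
  assumes [simp]: "\<alpha> \<in> carrier VD" "v \<in> carrier V" "a \<in> carrier B"
  shows "sw B a (\<lambda>z y. hat \<alpha> (act v z) \<cdot> S y) = sw B a (\<lambda>p w. S p \<cdot> hat (tact w \<alpha>) v)"
proof -
  let ?h = "\<lambda>q. hat (tact q \<alpha>) v"
  have "sw B a (\<lambda>z y. hat \<alpha> (act v z) \<cdot> S y) =
      sw B a (\<lambda>z y. sw B z (\<lambda>p y'. S p \<cdot> sw B y' (\<lambda>q x. ?h q \<cdot> x)) \<cdot> S y)"
    by (simp add: hat_act)
  also have "\<dots> = sw B a (\<lambda>z y. sw B z (\<lambda>p y'. S p \<cdot> sw B y' (\<lambda>q x. ?h q \<cdot> (x \<cdot> S y))))"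
    by (simp add: pull_alg mult_assoc)
  also have "\<dots> = sw B a (\<lambda>p w. sw B w (\<lambda>y' y. S p \<cdot> sw B y' (\<lambda>q x. ?h q \<cdot> (x \<cdot> S y))))"
    by (rule sw_coassoc) simp_all
  also have "\<dots> = sw B a (\<lambda>p w. S p \<cdot> sw B w (\<lambda>y' y. sw B y' (\<lambda>q x. ?h q \<cdot> (x \<cdot> S y))))"
    by (simp add: mult_tlift_r)
  also have "\<dots> = sw B a (\<lambda>p w. S p \<cdot> ?h w)"
  proof -
    have "sw B w (\<lambda>y' y. sw B y' (\<lambda>q x. ?h q \<cdot> (x \<cdot> S y))) = ?h w"
      if [simp]: "w \<in> carrier B" for w
    proof -
      have "sw B w (\<lambda>y' y. sw B y' (\<lambda>q x. ?h q \<cdot> (x \<cdot> S y))) =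
        sw B w (\<lambda>q w'. sw B w' (\<lambda>x y. ?h q \<cdot> (x \<cdot> S y)))"
        by (rule sw_coassoc) simp_all
      also have "\<dots> = sw B w (\<lambda>q w'. ?h q \<cdot> sw B w' (\<lambda>x y. x \<cdot> S y))"
        by (simp add: mult_tlift_r)
      also have "\<dots> = sw B w (\<lambda>q w'. counit B w' \<odot>\<^bsub>B\<^esub> ?h q)"
        by (simp add: antipode_r smult_mult_r)
      also have "\<dots> = ?h w" by (rule sw_counit_r) simp_all
      finally show ?thesis .
    qed
    then show ?thesis by simp
  qed
  finally show ?thesis .
qed

text \<open>The components \<open>x\<close>, \<open>y\<close> of \<open>a\<close> in
  \<open>B\<close> occur in reversed roles, as the condition over the co-opposite
  prescribes.\<close>

lemma dco_yd:
  assumes [simp]: "a \<in> carrier B" "\<alpha> \<in> carrier VD"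
  shows "sw BD a (\<lambda>x y. tlift k B VD BD (dco \<alpha>) (\<lambda>c w. tens k B VD (y \<cdot> c) (tact x w))) =
    sw BD a (\<lambda>x y. tlift k B VD BD (dco (tact y \<alpha>)) (\<lambda>c w. tens k B VD (c \<cdot> x) w))"
    (is "?L = ?R")
proof (rule BD_eqI)
  fix v assume [simp]: "v \<in> carrier V"
  have e1: "tlift k B VD B (dco \<alpha>) (\<lambda>c w. w (act v x) \<odot>\<^bsub>B\<^esub> (y \<cdot> c)) = y \<cdot> Sinv (hat \<alpha> (act v x))"
    if [simp]: "x \<in> carrier B" "y \<in> carrier B" for x y
    by (rule tlift_dco_eval) simp_all
  have e2: "tlift k B VD B (dco (tact y \<alpha>)) (\<lambda>c w. w v \<odot>\<^bsub>B\<^esub> (c \<cdot> x)) = Sinv (hat (tact y \<alpha>) v) \<cdot> x"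
    if [simp]: "x \<in> carrier B" "y \<in> carrier B" for x y
    by (rule tlift_dco_eval) simp_all
  have L: "ev v ?L = sw B a (\<lambda>x y. y \<cdot> Sinv (hat \<alpha> (act v x)))"
    by (simp add: ev_tlift ev_tens tact_apply e1)
  have R: "ev v ?R = sw B a (\<lambda>x y. Sinv (hat (tact y \<alpha>) v) \<cdot> x)"
    by (simp add: ev_tlift ev_tens e2)
  show "ev v ?L = ev v ?R"
  \<comment> \<open>Mapping by \<open>S\<close> reverses the products and cancels the inverse
    antipode, which leaves the two sides of \<open>hat_act_S\<close>.\<close>
  proof (rule S_inj)
    show "S (ev v ?L) = S (ev v ?R)"
      unfolding L R by (simp add: S_tlift S_mult hat_act_S)
  qed (simp_all add: L R)
qed simp_all

text \<open>Stated for any \<open>d\<close> agreeing with \<open>dco\<close> on the dual, since the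
  coaction of the theorem is identified with \<open>dco\<close> only there.\<close>

lemma dual_yd:
  assumes d: "\<And>\<alpha>. \<alpha> \<in> carrier VD \<Longrightarrow> d \<alpha> = dco \<alpha>"
  shows "yd_left_left k (cop k B) VD tact d"
proof (intro yd_left_left.intro left_comodule.intro yd_left_left_axioms.intro)
  show "bialgebra k (cop k B)" by (rule cop_bialgebra)
  show "left_module k (cop k B) VD tact" by (rule tact_left_module_cop)
  show "linear_map k VD (tensor k (cop k B) VD) d"
    unfolding cop_norm by (rule linear_map_cong[OF d lin_dco[OF lin_id]]) simp_all
next
  fix \<alpha> assume a [simp]: "\<alpha> \<in> carrier VD"
  show "tlift k (cop k B) VD (tensor k (cop k B) (tensor k (cop k B) VD)) (d \<alpha>) (\<lambda>c w.
      tlift k (cop k B) (cop k B) (tensor k (cop k B) (tensor k (cop k B) VD)) (comult (cop k B) c)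
       (\<lambda>c1 c2. tens k (cop k B) (tensor k (cop k B) VD) c1 (tens k (cop k B) VD c2 w))) =
    tlift k (cop k B) VD (tensor k (cop k B) (tensor k (cop k B) VD)) (d \<alpha>)
     (\<lambda>c w. tens k (cop k B) (tensor k (cop k B) VD) c (d w))"
    unfolding cop_norm tlift_cop d[OF a]
    using dco_coassoc[OF a] by (simp add: sw_cop d)
  show "tlift k (cop k B) VD VD (d \<alpha>) (\<lambda>c w. counit (cop k B) c \<odot>\<^bsub>VD\<^esub> w) = \<alpha>"
    unfolding tlift_cop d[OF a] using dco_counit[OF a] by simp
  fix a assume "a \<in> carrier (cop k B)"
  then have [simp]: "a \<in> carrier B" by simp
  show "tlift k (cop k B) (cop k B) (tensor k (cop k B) VD) (comult (cop k B) a) (\<lambda>a1 a2.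
      tlift k (cop k B) VD (tensor k (cop k B) VD) (d \<alpha>) (\<lambda>vm v0.
        tens k (cop k B) VD (a1 \<otimes>\<^bsub>cop k B\<^esub> vm) (tact a2 v0))) =
    tlift k (cop k B) (cop k B) (tensor k (cop k B) VD) (comult (cop k B) a) (\<lambda>a1 a2.
      tlift k (cop k B) VD (tensor k (cop k B) VD) (d (tact a1 \<alpha>)) (\<lambda>um u0.
        tens k (cop k B) VD (um \<otimes>\<^bsub>cop k B\<^esub> a2) u0))"
    unfolding cop_norm tlift_cop cop_simps d[OF a] comult_cop
    using dco_yd[of a \<alpha>] by (simp add: tlift_flip flip_def pull d)
qed

end

section \<open>The left dual of the free bimodule\<close>

context yd_based
begin

definition evl where
  "evl x t = tlift k VD B B t (\<lambda>\<alpha> b. \<alpha> x \<odot>\<^bsub>B\<^esub> b)"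

lemma evl_closed [simp]: "x \<in> carrier V \<Longrightarrow> t \<in> carrier DB \<Longrightarrow> evl x t \<in> carrier B"
  by (simp add: evl_def)

lemma lin_evl [simp]: "linear_map k Z DB f \<Longrightarrow> x \<in> carrier V \<Longrightarrow> linear_map k Z B (\<lambda>z. evl x (f z))"
  by (simp add: evl_def)

lemma evl_tens: "\<alpha> \<in> carrier VD \<Longrightarrow> b \<in> carrier B \<Longrightarrow> x \<in> carrier V \<Longrightarrow>
    evl x (tens k VD B \<alpha> b) = \<alpha> x \<odot>\<^bsub>B\<^esub> b"
  by (simp add: evl_def)

lemma DB_expand:
  assumes t: "t \<in> carrier DB"
  shows "t = (\<Oplus>\<^bsub>DB\<^esub>x\<in>X. tens k VD B (e x) (evl x t))"
  unfolding evl_def by (rule tensor_expand[OF _ _ _ _ dual_expand t]) simp_all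

lemma evl_sum:
  assumes x: "x \<in> X" and g: "\<And>y. y \<in> X \<Longrightarrow> g y \<in> carrier B"
  shows "evl x (\<Oplus>\<^bsub>DB\<^esub>y\<in>X. tens k VD B (e y) (g y)) = g x"
proof -
  have t: "tens k VD B (e y) (g y) \<in> carrier DB" if "y \<in> X" for y using that g by simp
  have "evl x (\<Oplus>\<^bsub>DB\<^esub>y\<in>X. tens k VD B (e y) (g y)) = (\<Oplus>\<^bsub>B\<^esub>y\<in>X. evl x (tens k VD B (e y) (g y)))"
    by (rule linear_map_finsum[OF lin_evl[OF lin_id] t]) (use x in simp_all)
  also have "\<dots> = (\<Oplus>\<^bsub>B\<^esub>y\<in>X. e y x \<odot>\<^bsub>B\<^esub> g y)"
    by (rule finsum_eqI) (use x g in \<open>simp add: evl_tens\<close>)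
  also have "\<dots> = g x" by (rule finsum_delta(1)) (use x g in simp_all)
  finally show ?thesis .
qed

lemma cop_left_module: "bialg_left_module k (cop k B) VD tact"
  by (intro bialg_left_module.intro cop_bialgebra tact_left_module_cop)

abbreviation "RG \<equiv> right_generated k (cop k B) VD tact"

lemma same_vs_RG: "same_vs RG DB"
  using bialg_left_module.same_vs_right_generated[OF cop_left_module] by (simp add: cop_norm)

lemma carrier_RG [simp]: "carrier RG = carrier DB"
  using same_vs_RG by (simp add: same_vs_def)

lemma RG_covariant: "right_covariant_bimodule k (cop k B) RG"
  by (rule bialg_left_module.right_generated_covariant[OF cop_left_module])
    (simp_all add: bialg_left_module.same_vs_right_generated[OF cop_left_module]
      bialg_left_module.right_generated_simps[OF cop_left_module])

lemma RG_ract: "ract RG t c = tlift k VD B DB t (\<lambda>w b. tens k VD B w (b \<cdot> c))"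
  unfolding right_generated_def Let_def cop_norm tlift_cop cop_simps by simp

text \<open>In Sweedler components of \<open>B\<close> the second one acts on the functional,
  because the action was defined through the coproduct of the co-opposite.\<close>

lemma RG_lact:
  assumes "t \<in> carrier DB" "a \<in> carrier B"
  shows "lact RG a t = tlift k VD B DB t (\<lambda>w b. sw DB a (\<lambda>x y. tens k VD B (tact y w) (x \<cdot> b)))"
proof -
  have "lact RG a t = tlift k VD B DB t (\<lambda>w b. tlift k B B DB (comult (cop k B) a)
      (\<lambda>y x. tens k VD B (tact y w) (x \<cdot> b)))"
    unfolding right_generated_def Let_def cop_norm tlift_cop cop_simps by simp
  then show ?thesis using assms by (simp add: sw_cop)
qed

text \<open>The counit maps 1 to the nonzero unit of the field. This separates the generators
  \<open>e x \<otimes> 1\<close> for different \<open>x\<close>.\<close>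

lemma one_not_zero: "\<one>\<^bsub>B\<^esub> \<noteq> \<zero>\<^bsub>B\<^esub>"
proof
  assume "\<one>\<^bsub>B\<^esub> = \<zero>\<^bsub>B\<^esub>"
  then have "\<one>\<^bsub>k\<^esub> = \<zero>\<^bsub>k\<^esub>"
    using counit_one linear_mapD(6)[OF counit_linear] by (simp add: scalars_def)
  then show False by simp
qed

text \<open>The generators are \<open>e x \<otimes> 1\<close>. Coefficients exist by the dual basis
  expansion and are recovered by evaluation at basis vectors.\<close>

lemma RG_free: "right_free (cop k B) RG"
proof -
  interpret BV: vectorspace k B by simp
  interpret DV: vectorspace k DB by simp
  let ?u = "\<lambda>x. tens k VD B (e x) \<one>\<^bsub>B\<^esub>"
  let ?Y = "?u ` X"
  have u: "?u x \<in> carrier DB" if "x \<in> X" for x using that by simp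
  \<comment> \<open>Freeness is phrased with a set of generators; injectivity allows its sums to be
    reindexed by \<open>X\<close>.\<close>
  have inj: "inj_on ?u X"
  proof (rule inj_onI)
    fix x y assume xy: "x \<in> X" "y \<in> X" "?u x = ?u y"
    have "evl x (?u x) = evl x (?u y)" using xy(3) by (rule arg_cong)
    then have "e x x \<odot>\<^bsub>B\<^esub> \<one>\<^bsub>B\<^esub> = e y x \<odot>\<^bsub>B\<^esub> \<one>\<^bsub>B\<^esub>" using xy(1,2) by (simp add: evl_tens)
    then show "x = y" using xy(1,2) one_not_zero by (auto simp: e_basis split: if_splits)
  qed
  have ra: "ract RG (?u x) c = tens k VD B (e x) c" if "x \<in> X" "c \<in> carrier B" for x c
    using that by (simp add: RG_ract)
  \<comment> \<open>Terms with zero coefficient are restored to pass from the support to all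
    generators.\<close>
  have sum: "(\<Oplus>\<^bsub>RG\<^esub>y\<in>{y \<in> ?Y. b y \<noteq> \<zero>\<^bsub>B\<^esub>}. ract RG y (b y)) = (\<Oplus>\<^bsub>DB\<^esub>x\<in>X. tens k VD B (e x) (b (?u x)))"
    if b: "b \<in> ?Y \<rightarrow>\<^sub>E carrier B" for b
  proof -
    have bc: "b (?u x) \<in> carrier B" if "x \<in> X" for x using b that by blast
    have z: "tens k VD B (e x) \<zero>\<^bsub>B\<^esub> = \<zero>\<^bsub>DB\<^esub>" if "x \<in> X" for x
      using linear_mapD(6)[of k B DB "\<lambda>c. tens k VD B (e x) c"] that by simp
    have "(\<Oplus>\<^bsub>RG\<^esub>y\<in>{y \<in> ?Y. b y \<noteq> \<zero>\<^bsub>B\<^esub>}. ract RG y (b y)) = (\<Oplus>\<^bsub>DB\<^esub>y\<in>{y \<in> ?Y. b y \<noteq> \<zero>\<^bsub>B\<^esub>}. ract RG y (b y))"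
      using same_vs_RG by (simp add: finsum_def finprod_def same_vs_def comp_def)
    also have "\<dots> = (\<Oplus>\<^bsub>DB\<^esub>y\<in>?Y. ract RG y (b y))"
      by (rule DV.M.add.finprod_mono_neutral_cong_left[folded finsum_def])
        (use bc in \<open>auto simp: ra z\<close>)
    also have "\<dots> = (\<Oplus>\<^bsub>DB\<^esub>x\<in>X. ract RG (?u x) (b (?u x)))"
      by (rule DV.M.finsum_reindex[OF _ inj]) (use bc in \<open>auto simp: ra\<close>)
    also have "\<dots> = (\<Oplus>\<^bsub>DB\<^esub>x\<in>X. tens k VD B (e x) (b (?u x)))"
      by (rule finsum_eqI) (simp add: ra bc)
    finally show ?thesis .
  qed
  show ?thesis
    unfolding right_free_def cop_simps
  proof (intro exI[of _ ?Y] conjI ballI)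
    show "?Y \<subseteq> carrier RG" using u by auto
    fix t assume "t \<in> carrier RG"
    then have t: "t \<in> carrier DB" by simp
    define b where "b = (\<lambda>y\<in>?Y. evl (the_inv_into X ?u y) t)"
    have bu: "b (?u x) = evl x t" if "x \<in> X" for x
      using the_inv_into_f_f[OF inj that] that by (simp add: b_def)
    have b: "b \<in> ?Y \<rightarrow>\<^sub>E carrier B"
    proof (rule PiE_I)
      fix y assume "y \<in> ?Y"
      then obtain x where "x \<in> X" "y = ?u x" by blast
      then show "b y \<in> carrier B" using bu t by simp
    qed (simp add: b_def)
    have bt: "t = (\<Oplus>\<^bsub>RG\<^esub>y\<in>{y \<in> ?Y. b y \<noteq> \<zero>\<^bsub>B\<^esub>}. ract RG y (b y))"
    proof -
      have "(\<Oplus>\<^bsub>DB\<^esub>x\<in>X. tens k VD B (e x) (b (?u x))) = (\<Oplus>\<^bsub>DB\<^esub>x\<in>X. tens k VD B (e x) (evl x t))"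
        by (rule finsum_eqI) (simp only: bu)
      then show ?thesis using sum[OF b] DB_expand[OF t] by simp
    qed
    show "\<exists>!b. b \<in> ?Y \<rightarrow>\<^sub>E carrier B \<and> finite {y \<in> ?Y. b y \<noteq> \<zero>\<^bsub>B\<^esub>} \<and>
        t = (\<Oplus>\<^bsub>RG\<^esub>y\<in>{y \<in> ?Y. b y \<noteq> \<zero>\<^bsub>B\<^esub>}. ract RG y (b y))"
    proof (intro ex1I[of _ b] conjI b bt)
      show "finite {y \<in> ?Y. b y \<noteq> \<zero>\<^bsub>B\<^esub>}" by simp
      fix c assume c: "c \<in> ?Y \<rightarrow>\<^sub>E carrier B \<and> finite {y \<in> ?Y. c y \<noteq> \<zero>\<^bsub>B\<^esub>} \<and>
        t = (\<Oplus>\<^bsub>RG\<^esub>y\<in>{y \<in> ?Y. c y \<noteq> \<zero>\<^bsub>B\<^esub>}. ract RG y (c y))"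
      have c1: "c \<in> ?Y \<rightarrow>\<^sub>E carrier B" using c by blast
      have tc: "t = (\<Oplus>\<^bsub>DB\<^esub>x\<in>X. tens k VD B (e x) (c (?u x)))"
        by (rule trans[OF conjunct2[OF conjunct2[OF c]] sum[OF c1]])
      have "c (?u x) = b (?u x)" if x: "x \<in> X" for x
      proof -
        have "evl x t = evl x (\<Oplus>\<^bsub>DB\<^esub>x\<in>X. tens k VD B (e x) (c (?u x)))"
          using tc by (rule arg_cong)
        also have "\<dots> = c (?u x)"
          by (rule evl_sum[OF x]) (use c1 in blast)
        finally show ?thesis by (simp add: bu x)
      qed
      then show "c = b" by (intro PiE_ext[OF c1 b]) auto
    qed
  qed
qed

section \<open>Identification with the left dual\<close>

abbreviation "LG \<equiv> left_generated k B V act \<rho>"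
abbreviation "LDual \<equiv> left_dual k B LG"

definition pair where
  "pair t x = tlift k VD B B t (\<lambda>\<alpha> b. tlift k B V B x (\<lambda>a v. \<alpha> v \<odot>\<^bsub>B\<^esub> (a \<cdot> b)))"

lemma lin_pair_l [simp]: "linear_map k Z DB f \<Longrightarrow> x \<in> carrier BV \<Longrightarrow> linear_map k Z B (\<lambda>z. pair (f z) x)"
  by (simp add: pair_def)

lemma lin_pair_r [simp]: "linear_map k Z BV f \<Longrightarrow> t \<in> carrier DB \<Longrightarrow> linear_map k Z B (\<lambda>z. pair t (f z))"
  by (simp add: pair_def linear_mapD(1))

lemma pair_tens: "\<alpha> \<in> carrier VD \<Longrightarrow> b \<in> carrier B \<Longrightarrow> a \<in> carrier B \<Longrightarrow> v \<in> carrier V \<Longrightarrow>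
    pair (tens k VD B \<alpha> b) (tens k B V a v) = \<alpha> v \<odot>\<^bsub>B\<^esub> (a \<cdot> b)"
  by (simp add: pair_def)

lemmas pair_tlift_l = tlift_comp[OF lin_pair_l[OF lin_id]]

lemmas pair_tlift_r = tlift_comp[OF lin_pair_r[OF lin_id]]

lemma pair_ext:
  assumes "t \<in> carrier DB" "x \<in> carrier BV"
    and f: "\<And>x. x \<in> carrier BV \<Longrightarrow> linear_map k DB B (\<lambda>t. f t x)" "\<And>t. t \<in> carrier DB \<Longrightarrow> linear_map k BV B (f t)"
    and g: "\<And>x. x \<in> carrier BV \<Longrightarrow> linear_map k DB B (\<lambda>t. g t x)" "\<And>t. t \<in> carrier DB \<Longrightarrow> linear_map k BV B (g t)"
    and eq: "\<And>\<alpha> b a v. \<lbrakk>\<alpha> \<in> carrier VD; b \<in> carrier B; a \<in> carrier B; v \<in> carrier V\<rbrakk> \<Longrightarrow>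
      f (tens k VD B \<alpha> b) (tens k B V a v) = g (tens k VD B \<alpha> b) (tens k B V a v)"
  shows "f t x = g t x"
proof (rule tensor_ext[of k VD B B "\<lambda>t. f t x" "\<lambda>t. g t x"])
  fix \<alpha> b assume [simp]: "\<alpha> \<in> carrier VD" "b \<in> carrier B"
  show "f (tens k VD B \<alpha> b) x = g (tens k VD B \<alpha> b) x"
    by (rule tensor_ext[of k B V B "f (tens k VD B \<alpha> b)" "g (tens k VD B \<alpha> b)"]) (simp_all add: assms)
qed (simp_all add: assms)

lemma pair_gla:
  assumes "t \<in> carrier DB" "x \<in> carrier BV" "c \<in> carrier B"
  shows "pair t (gla c x) = c \<cdot> pair t x"
  by (rule pair_ext[OF assms(1,2), of "\<lambda>t x. pair t (gla c x)"])
    (use assms(3) in \<open>simp_all add: gmod_simps pair_tens mult_assoc smult_mult_r\<close>)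

text \<open>The co-opposite left action arises here: right multiplication by \<open>c\<close> puts
  \<open>c1\<close> between the algebra elements and lets \<open>c2\<close> act on the
  vector.\<close>

lemma pair_gra:
  assumes "t \<in> carrier DB" "x \<in> carrier BV" "c \<in> carrier B"
  shows "pair t (gra x c) =
    pair (tlift k VD B DB t (\<lambda>w b. sw DB c (\<lambda>x y. tens k VD B (tact y w) (x \<cdot> b)))) x"
  by (rule pair_ext[OF assms(1,2), of "\<lambda>t x. pair t (gra x c)"])
    (use assms(3) in \<open>simp_all add: gmod_simps pair_tens pair_tlift_l pair_tlift_r tact_apply mult_assoc\<close>)

lemma pair_ract:
  assumes "t \<in> carrier DB" "x \<in> carrier BV" "c \<in> carrier B"
  shows "pair (tlift k VD B DB t (\<lambda>w b. tens k VD B w (b \<cdot> c))) x = pair t x \<cdot> c"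
  by (rule pair_ext[OF assms(1,2), of "\<lambda>t x. pair (tlift k VD B DB t (\<lambda>w b. tens k VD B w (b \<cdot> c))) x"])
    (use assms(3) in \<open>simp_all add: pair_tens pair_tlift_l mult_assoc smult_mult_l\<close>)

text \<open>Values at \<open>1 \<otimes> v\<close> for basis vectors \<open>v\<close> are the
  coefficients of \<open>t\<close> along the dual basis, so the identification is injective.\<close>

lemma pair_one:
  assumes "t \<in> carrier DB" "v \<in> carrier V"
  shows "pair t (tens k B V \<one>\<^bsub>B\<^esub> v) = evl v t"
  using assms by (simp add: pair_def evl_def)

lemma dual_identification_eq: "dual_identification k B V = (\<lambda>t. \<lambda>x\<in>carrier BV. pair t x)"
  by (simp add: dual_identification_def pair_def fun_eq_iff)

lemma RG_iso: "bimodule_iso k B RG LDual (dual_identification k B V)"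
proof -
  interpret LG: bimodule k B LG by (rule left_generated_bimodule)
  let ?f = "\<lambda>t. \<lambda>x\<in>carrier BV. pair t x"
  have LG_lin: "linear_map k LG B = linear_map k BV B"
    by (simp only: same_vs_linear_map_l[OF same_vs_left_generated])
  have f_closed: "?f t \<in> carrier LDual" if "t \<in> carrier DB" for t
    using LG.LD_restrictI[of "pair t"] that
    by (simp add: LG_lin left_generated_simps pair_gla)
  \<comment> \<open>The bimodule axioms involve the algebra alone, so the co-opposite can be
    replaced by \<open>B\<close>.\<close>
  have bim: "bimodule k B RG"
  proof -
    interpret RGm: right_covariant_bimodule k "cop k B" RG by (rule RG_covariant)
    show ?thesis
      using RGm.bimodule_axioms k_algebra_axioms
      by (simp add: bimodule_def bimodule_axioms_def left_module_def right_module_def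
          bilinear_cong_vs[OF same_vs_cop same_vs_refl same_vs_refl]
          bilinear_cong_vs[OF same_vs_refl same_vs_cop same_vs_refl])
  qed
  show ?thesis
    unfolding dual_identification_eq
  proof (intro bimodule_iso.intro bimodule_iso_axioms.intro bim LG.left_dual_bimodule)
    show "linear_map k RG LDual ?f"
      unfolding same_vs_linear_map_l[OF same_vs_RG]
      by (rule LG.lin_LDI) (simp_all add: f_closed)
    show "bij_betw ?f (carrier RG) (carrier LDual)"
    proof (rule bij_betwI')
      fix s t assume "s \<in> carrier RG" "t \<in> carrier RG"
      then have st: "s \<in> carrier DB" "t \<in> carrier DB" by simp_all
      show "?f s = ?f t \<longleftrightarrow> s = t"
      proof
        assume eq: "?f s = ?f t"
        have "evl x s = evl x t" if x: "x \<in> X" for x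
        proof -
          have "?f s (tens k B V \<one>\<^bsub>B\<^esub> x) = ?f t (tens k B V \<one>\<^bsub>B\<^esub> x)" by (simp only: eq)
          then show ?thesis using st x by (simp add: pair_one)
        qed
        then show "s = t"
          using DB_expand[OF st(1)] DB_expand[OF st(2)]
            finsum_eqI[of X "\<lambda>x. tens k VD B (e x) (evl x s)" "\<lambda>x. tens k VD B (e x) (evl x t)" DB]
          by simp
      qed simp
    next
      show "?f t \<in> carrier LDual" if "t \<in> carrier RG" for t using that f_closed by simp
    next
      fix \<Phi> assume P: "\<Phi> \<in> carrier LDual"
      note PD = LG.LD_D[OF P, unfolded LG_lin carrier_left_generated left_generated_simps]
      \<comment> \<open>The preimage: a left module map is determined by its values on
        \<open>1 \<otimes> v\<close>, and those at basis vectors serve as coefficients along the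
        dual basis.\<close>
      define t where "t = (\<Oplus>\<^bsub>DB\<^esub>x\<in>X. tens k VD B (e x) (\<Phi> (tens k B V \<one>\<^bsub>B\<^esub> x)))"
      have t: "t \<in> carrier DB" unfolding t_def by (rule finsum_X_closed) (simp_all add: PD)
      have "pair t x = \<Phi> x" if x: "x \<in> carrier BV" for x
      proof (rule tensor_ext[OF _ _ _ PD(1) _ x])
        fix a v assume a: "a \<in> carrier B" and v: "v \<in> carrier V"
        have "evl v t = \<Phi> (tens k B V \<one>\<^bsub>B\<^esub> v)"
        proof (rule basis_ext[of B "\<lambda>v. evl v t" "\<lambda>v. \<Phi> (tens k B V \<one>\<^bsub>B\<^esub> v)", OF _ _ _ v])
          show "linear_map k V B (\<lambda>v. evl v t)"
            using t by (simp add: evl_def)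
          show "linear_map k V B (\<lambda>v. \<Phi> (tens k B V \<one>\<^bsub>B\<^esub> v))"
            by (rule lin_comp[OF PD(1)]) simp
          show "evl x t = \<Phi> (tens k B V \<one>\<^bsub>B\<^esub> x)" if "x \<in> X" for x
            unfolding t_def by (rule evl_sum[OF that]) (simp add: PD)
        qed
        \<comment> \<open>\<open>a \<otimes> v\<close> is the left multiple by \<open>a\<close> of
          \<open>1 \<otimes> v\<close>, on which both maps agree.\<close>
        then have "pair t (gla a (tens k B V \<one>\<^bsub>B\<^esub> v)) = \<Phi> (gla a (tens k B V \<one>\<^bsub>B\<^esub> v))"
          using t a v by (simp add: pair_gla pair_one PD)
        then show "pair t (tens k B V a v) = \<Phi> (tens k B V a v)"
          using a v by (simp add: gla_tens)
      qed (use t in simp_all)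
      then have "\<Phi> = ?f t"
        using PD(4) by (intro extensionalityI[of _ "carrier BV"]) auto
      then show "\<exists>t\<in>carrier RG. \<Phi> = ?f t" using t by auto
    qed
  next
    fix a t assume a: "a \<in> carrier B" and "t \<in> carrier RG"
    then have t: "t \<in> carrier DB" by simp
    show "?f (lact RG a t) = lact LDual a (?f t)"
      unfolding LG.LD_simps carrier_left_generated left_generated_simps RG_lact[OF t a]
      by (rule restrict_ext) (use a t in \<open>simp add: pair_gra\<close>)
    show "?f (ract RG t a) = ract LDual (?f t) a"
      unfolding LG.LD_simps carrier_left_generated RG_ract
      by (rule restrict_ext) (use a t in \<open>simp add: pair_ract\<close>)
  qed
qed

end

section \<open>The dual bimodule and its covariant structures\<close>

theorem corollary5p4:
  fixes k :: "('k, 'r) ring_scheme"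
    and B :: "('k, 'b, 'p) bialg_scheme" and S :: "'b \<Rightarrow> 'b"
    and V :: "('k, 'v, 'q) module_scheme" and X :: "'v set"
    and act :: "'v \<Rightarrow> 'b \<Rightarrow> 'v" and \<rho> :: "'v \<Rightarrow> ('v \<times> 'b \<Rightarrow> 'k) set"
  assumes "field k"
    and "hopf_algebra k B S"
    and "bij_betw S (carrier B) (carrier B)"
    and "vectorspace k V"
    and "vectorspace.fin_dim k V"
    and "vectorspace.basis k V X"
    and "yd_right_right k B V act \<rho>"
  shows
    "left_module k (cop k B) (dual k V) (transpose_action V act) \<and>
     right_covariant_bimodule k (cop k B)
       (right_generated k (cop k B) (dual k V) (transpose_action V act)) \<and>
     right_free (cop k B)
       (right_generated k (cop k B) (dual k V) (transpose_action V act)) \<and>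
     bimodule_iso k B
       (right_generated k (cop k B) (dual k V) (transpose_action V act))
       (left_dual k B (left_generated k B V act \<rho>))
       (dual_identification k B V) \<and>
     yd_left_left k (cop k B) (dual k V) (transpose_action V act)
       (push_right_to_left k B (dual k V) (inv_into (carrier B) S)
         (coact_cop_of_left k B (dual k V) (transpose_coaction k B V X \<rho>))) \<and>
     bicovariant_bimodule k (cop k B)
       (right_generated_yd k (cop k B) (dual k V) (transpose_action V act)
         (push_right_to_left k B (dual k V) (inv_into (carrier B) S)
           (coact_cop_of_left k B (dual k V) (transpose_coaction k B V X \<rho>)))) \<and>
     (\<forall>\<alpha>\<in>carrier (dual k V). \<forall>v\<in>carrier V.
       \<alpha> v \<odot>\<^bsub>B\<^esub> \<one>\<^bsub>B\<^esub> =
       tensor_pairing k B V (transpose_coaction k B V X \<rho> \<alpha>)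
         (push_left_to_right k B V S (coact_cop_of_right k B V \<rho>) v))"
proof -
  \<comment> \<open>A basis is linearly independent, and in finite dimension independent sets are
    finite; this makes the expansions over \<open>X\<close> finite sums.\<close>
  have fin: "finite X"
    using vectorspace.fin_dim_li_fin[OF assms(4,5), of X] assms(6)
    by (simp add: vectorspace.basis_def[OF assms(4)])
  interpret yd_based k B S V act \<rho> X
    by (intro yd_based.intro based_space.intro yd_based_axioms.intro based_space_axioms.intro assms fin)
  have yd: "yd_left_left k (cop k B) (dual k V) (transpose_action V act)
      (push_right_to_left k B (dual k V) (inv_into (carrier B) S)
        (coact_cop_of_left k B (dual k V) (transpose_coaction k B V X \<rho>)))"
    by (rule dual_yd) (rule push_cop_eq)
  show ?thesis
    by (intro conjI ballI tact_left_module_cop RG_covariant RG_free RG_iso yd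
        yd_left_left.right_generated_yd_bicovariant[OF yd] pairing_identity[symmetric])
qed

end
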